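(* Let $(g(t))_{t\in[0,T]}$ be a solution of the Ricci flow $\frac{\partial}{\partial t}g(t)=-2\,\mathrm{Ric}_{g(t)}$ on a compact surface $\Sigma$ (dimension $2$) and let $\lambda(t)$ denote an eigenvalue of the Laplacian $\Delta_{g(t)}$. Let $R_{\min}(0):=\min_{x\in\Sigma}R_{g(0)}(x)$, where $R_g$ is the scalar curvature. (1) If $R_{\min}(0)\ge0$, then $\lambda(t)$ is nondecreasing on $[0,T]$. (2) If $R_{\min}(0)>0$ and $T\le\frac1{R_{\min}(0)}$, then $(1-R_{\min}(0)t)\lambda(t)$ is nondecreasing on $[0,T]$. (3) If $R_{\min}(0)<0$, then $(1-R_{\min}(0)t)\lambda(t)$ is nondecreasing on $[0,T]$.
   Context: Compact surfaces are without boundary and $g(t)$ is a smooth family of Riemannian metrics. An eigenvalue $\lambda(t)$ of $\Delta_{g(t)}$ (a function of $t$ only) with eigenfunction $f(t)$, not identically zero, means $-\Delta_{g(t)}f(t)=\lambda(t)f(t)$; $\lambda(t)$ and $f(t)$ are assumed to depend smoothly on $t$. *)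

theory Defs
  imports "HOL-Analysis.Analysis"
begin

section \<open>Smooth functions\<close>

text \<open>
  Derivatives are taken within \<open>S\<close>, so that one-sided derivatives are used at the end points
  of a time interval. On the sets used below (open sets, nondegenerate compact intervals, and
  products of the latter with open sets) derivatives within \<open>S\<close> are unique; the domain being
  finite-dimensional, \<open>Ck_on k\<close> is the usual class C^k.
\<close>

primrec Ck_on :: "nat \<Rightarrow> 'a::euclidean_space set \<Rightarrow> ('a \<Rightarrow> 'b::real_normed_vector) \<Rightarrow> bool" where
  "Ck_on 0 S f \<longleftrightarrow> continuous_on S f"
| "Ck_on (Suc k) S f \<longleftrightarrow>
     (\<forall>x\<in>S. f differentiable (at x within S)) \<and>
     (\<forall>v. Ck_on k S (\<lambda>x. frechet_derivative f (at x within S) v))"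

definition smooth_on :: "'a::euclidean_space set \<Rightarrow> ('a \<Rightarrow> 'b::real_normed_vector) \<Rightarrow> bool" where
  "smooth_on S f \<longleftrightarrow> (\<forall>k. Ck_on k S f)"


section \<open>Smooth manifolds\<close>

text \<open>A chart is a pair of its domain and its coordinate map; all charts take values in open
  subsets of the full Euclidean space, so manifolds have no boundary.\<close>

type_synonym ('a, 'n) chart = "'a set \<times> ('a \<Rightarrow> real ^ 'n)"

abbreviation dom_chart :: "('a, 'n::finite) chart \<Rightarrow> 'a set" where
  "dom_chart c \<equiv> fst c"

abbreviation img_chart :: "('a, 'n::finite) chart \<Rightarrow> (real ^ 'n) set" where
  "img_chart c \<equiv> snd c ` fst c"

definition inv_chart :: "('a, 'n::finite) chart \<Rightarrow> real ^ 'n \<Rightarrow> 'a" where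
  "inv_chart c = inv_into (fst c) (snd c)"

definition is_chart :: "'a topology \<Rightarrow> ('a, 'n::finite) chart \<Rightarrow> bool" where
  "is_chart X c \<longleftrightarrow> openin X (dom_chart c) \<and> open (img_chart c) \<and>
     homeomorphic_map (subtopology X (dom_chart c)) (top_of_set (img_chart c)) (snd c)"

definition transition :: "('a, 'n::finite) chart \<Rightarrow> ('a, 'n) chart \<Rightarrow> real ^ 'n \<Rightarrow> real ^ 'n" where
  "transition c d = snd d \<circ> inv_chart c"

definition smooth_manifold :: "'a topology \<Rightarrow> ('a, 'n::finite) chart set \<Rightarrow> bool" where
  "smooth_manifold X A \<longleftrightarrow>
     Hausdorff_space X \<and> second_countable X \<and>
     (\<forall>c\<in>A. is_chart X c) \<and> (\<Union>c\<in>A. dom_chart c) = topspace X \<and>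
     (\<forall>c\<in>A. \<forall>d\<in>A. smooth_on (snd c ` (dom_chart c \<inter> dom_chart d)) (transition c d))"

definition compact_surface :: "'a topology \<Rightarrow> ('a, 2) chart set \<Rightarrow> bool" where
  "compact_surface X A \<longleftrightarrow> smooth_manifold X A \<and> compact_space X"

definition chart_at :: "('a, 'n::finite) chart set \<Rightarrow> 'a \<Rightarrow> ('a, 'n) chart" where
  "chart_at A p = (SOME c. c \<in> A \<and> p \<in> dom_chart c)"


section \<open>Riemannian metrics\<close>

text \<open>A metric is given by its component matrices: \<open>g c y $ i $ j\<close> is the \<open>(i, j)\<close> component,
  in the chart \<open>c\<close>, at the point with coordinates \<open>y\<close>. The values for \<open>y\<close> outside the image
  of \<open>c\<close> are irrelevant.\<close>

type_synonym ('a, 'n) tensor02 = "('a, 'n) chart \<Rightarrow> real ^ 'n \<Rightarrow> real ^ 'n ^ 'n"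

definition tensorial :: "('a, 'n::finite) chart set \<Rightarrow> ('a, 'n) tensor02 \<Rightarrow> bool" where
  "tensorial A h \<longleftrightarrow>
     (\<forall>c\<in>A. \<forall>d\<in>A. \<forall>y \<in> snd c ` (dom_chart c \<inter> dom_chart d).
        let J = matrix (frechet_derivative (transition c d) (at y))
        in h c y = transpose J ** h d (transition c d y) ** J)"

definition riemannian_metric :: "('a, 'n::finite) chart set \<Rightarrow> ('a, 'n) tensor02 \<Rightarrow> bool" where
  "riemannian_metric A g \<longleftrightarrow> tensorial A g \<and>
     (\<forall>c\<in>A. smooth_on (img_chart c) (g c) \<and>
        (\<forall>y\<in>img_chart c. transpose (g c y) = g c y \<and> (\<forall>v. v \<noteq> 0 \<longrightarrow> v \<bullet> (g c y *v v) > 0)))"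

definition smooth_metric_family ::
    "('a, 'n::finite) chart set \<Rightarrow> real \<Rightarrow> (real \<Rightarrow> ('a, 'n) tensor02) \<Rightarrow> bool" where
  "smooth_metric_family A T g \<longleftrightarrow>
     (\<forall>t\<in>{0..T}. riemannian_metric A (g t)) \<and>
     (\<forall>c\<in>A. smooth_on ({0..T} \<times> img_chart c) (\<lambda>(t, y). g t c y))"

definition smooth_function_family ::
    "('a, 'n::finite) chart set \<Rightarrow> real \<Rightarrow> (real \<Rightarrow> 'a \<Rightarrow> real) \<Rightarrow> bool" where
  "smooth_function_family A T f \<longleftrightarrow>
     (\<forall>c\<in>A. smooth_on ({0..T} \<times> img_chart c) (\<lambda>(t, y). f t (inv_chart c y)))"


section \<open>Curvature and Laplacian\<close>

text \<open>In the following coordinate expressions \<open>G\<close> is the matrix function of a metric in a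
  single chart.\<close>

definition partial :: "'n::finite \<Rightarrow> (real ^ 'n \<Rightarrow> real) \<Rightarrow> real ^ 'n \<Rightarrow> real" where
  "partial i u y = frechet_derivative u (at y) (axis i 1)"

definition christoffel ::
    "(real ^ 'n \<Rightarrow> real ^ 'n ^ 'n) \<Rightarrow> 'n::finite \<Rightarrow> 'n \<Rightarrow> 'n \<Rightarrow> real ^ 'n \<Rightarrow> real" where
  "christoffel G k i j y = 1 / 2 * (\<Sum>l\<in>UNIV. matrix_inv (G y) $ k $ l *
     (partial i (\<lambda>z. G z $ j $ l) y + partial j (\<lambda>z. G z $ i $ l) y
       - partial l (\<lambda>z. G z $ i $ j) y))"

text \<open>\<open>riemann G l i j k\<close> is the \<open>l\<close>-th component of
  \<open>\<nabla>\<^sub>i \<nabla>\<^sub>j \<partial>\<^sub>k - \<nabla>\<^sub>j \<nabla>\<^sub>i \<partial>\<^sub>k\<close>. Contracting \<open>l\<close> with \<open>i\<close> makes the Ricci tensor of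
  round spheres positive; in dimension 2 the scalar curvature is twice the Gauss curvature.\<close>

definition riemann ::
    "(real ^ 'n \<Rightarrow> real ^ 'n ^ 'n) \<Rightarrow> 'n::finite \<Rightarrow> 'n \<Rightarrow> 'n \<Rightarrow> 'n \<Rightarrow> real ^ 'n \<Rightarrow> real" where
  "riemann G l i j k y =
     partial i (christoffel G l j k) y - partial j (christoffel G l i k) y
     + (\<Sum>m\<in>UNIV. christoffel G l i m y * christoffel G m j k y
                  - christoffel G l j m y * christoffel G m i k y)"

definition ricci_coord ::
    "(real ^ 'n \<Rightarrow> real ^ 'n ^ 'n) \<Rightarrow> real ^ 'n \<Rightarrow> real ^ 'n ^ 'n::finite" where
  "ricci_coord G y = (\<chi> j k. \<Sum>i\<in>UNIV. riemann G i i j k y)"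

definition scalar_coord :: "(real ^ 'n \<Rightarrow> real ^ 'n ^ 'n) \<Rightarrow> real ^ 'n::finite \<Rightarrow> real" where
  "scalar_coord G y =
     (\<Sum>i\<in>UNIV. \<Sum>j\<in>UNIV. matrix_inv (G y) $ i $ j * ricci_coord G y $ i $ j)"

definition laplacian_coord ::
    "(real ^ 'n \<Rightarrow> real ^ 'n ^ 'n) \<Rightarrow> (real ^ 'n \<Rightarrow> real) \<Rightarrow> real ^ 'n::finite \<Rightarrow> real" where
  "laplacian_coord G u y =
     (\<Sum>i\<in>UNIV. \<Sum>j\<in>UNIV. matrix_inv (G y) $ i $ j *
        (partial i (partial j u) y - (\<Sum>k\<in>UNIV. christoffel G k i j y * partial k u y)))"

definition ricci :: "('a, 'n::finite) tensor02 \<Rightarrow> ('a, 'n) tensor02" where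
  "ricci g c = ricci_coord (g c)"

text \<open>Scalar curvature and Laplacian do not depend on the chart, so that any chart around
  the point may be used.\<close>

definition scalar_curvature ::
    "('a, 'n::finite) chart set \<Rightarrow> ('a, 'n) tensor02 \<Rightarrow> 'a \<Rightarrow> real" where
  "scalar_curvature A g p = (let c = chart_at A p in scalar_coord (g c) (snd c p))"

definition laplacian ::
    "('a, 'n::finite) chart set \<Rightarrow> ('a, 'n) tensor02 \<Rightarrow> ('a \<Rightarrow> real) \<Rightarrow> 'a \<Rightarrow> real" where
  "laplacian A g u p =
     (let c = chart_at A p in laplacian_coord (g c) (u \<circ> inv_chart c) (snd c p))"

text \<open>\<open>LEAST\<close> is the minimum of the set of values, which is attained on a nonempty compact
  manifold.\<close>

definition min_scalar_curvature ::
    "'a topology \<Rightarrow> ('a, 'n::finite) chart set \<Rightarrow> ('a, 'n) tensor02 \<Rightarrow> real" where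
  "min_scalar_curvature X A g = (LEAST r. r \<in> scalar_curvature A g ` topspace X)"

definition laplace_eigenpair ::
    "'a topology \<Rightarrow> ('a, 'n::finite) chart set \<Rightarrow> ('a, 'n) tensor02 \<Rightarrow> real \<Rightarrow> ('a \<Rightarrow> real) \<Rightarrow> bool"
  where
  "laplace_eigenpair X A g l u \<longleftrightarrow>
     (\<exists>p\<in>topspace X. u p \<noteq> 0) \<and> (\<forall>p\<in>topspace X. - laplacian A g u p = l * u p)"


section \<open>Ricci flow\<close>

definition ricci_flow ::
    "('a, 'n::finite) chart set \<Rightarrow> real \<Rightarrow> (real \<Rightarrow> ('a, 'n) tensor02) \<Rightarrow> bool" where
  "ricci_flow A T g \<longleftrightarrow> smooth_metric_family A T g \<and>
     (\<forall>c\<in>A. \<forall>y\<in>img_chart c. \<forall>t\<in>{0..T}.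
        ((\<lambda>s. g s c y) has_vector_derivative (- 2) *\<^sub>R ricci (g t) c y) (at t within {0..T}))"

end

theory Submission
  imports Defs
begin

text \<open>Write \<open>w\<close> for the area density \<open>sqrt (det g)\<close> of a metric in a chart and
\<open>L u = \<partial>\<^sub>i (w g\<^sup>i\<^sup>j \<partial>\<^sub>j u)\<close>, so that \<open>w \<Delta> u = L u\<close> (\<open>laplacian_divergence\<close>). On a surface the Ricci
tensor is \<open>R / 2\<close> times the metric (\<open>ricci_conformal\<close>), so the Ricci flow reads \<open>\<partial>\<^sub>t g = - R g\<close>. It
keeps the conformal class: \<open>w g\<^sup>i\<^sup>j\<close>, and with it the operator \<open>L\<close>, does not depend on time, while
\<open>\<partial>\<^sub>t w = - R w\<close>. Time derivatives of identities written with \<open>w\<close> and \<open>L\<close> are therefore easy to compute.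

\<^bold>\<open>Curvature.\<close> By Liouville's formula \<open>w R = \<kappa> - L (ln w)\<close>, where \<open>\<kappa>\<close> depends on the conformal class
only (\<open>scalar_conformal\<close>). The time derivative of this identity is \<open>\<partial>\<^sub>t R = \<Delta> R + R\<^sup>2\<close>
(\<open>curvature_evolution\<close>). For a constant \<open>m\<close> the function \<open>Q = (1 - m t) R - m\<close> then satisfies the
linear equation \<open>\<partial>\<^sub>t Q = \<Delta> Q + R Q\<close>, and the minimum principle gives \<open>Q \<ge> 0\<close> for all times if \<open>m\<close> is
a lower bound of the initial curvature (\<open>curvature_barrier\<close>).

\<^bold>\<open>Eigenvalue.\<close> Let \<open>h = \<partial>\<^sub>t f\<close>. The time derivative of \<open>L f = - \<lambda> w f\<close> yields
\<open>f \<Delta> h - h \<Delta> f = (\<lambda> R - \<lambda>') f\<^sup>2\<close>. The integral of the left-hand side vanishes by Green's formula,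
so it cannot be nonnegative everywhere and positive somewhere (\<open>green_no_sign\<close>). Multiplied by
\<open>1 - m t > 0\<close>, the factor of \<open>f\<^sup>2\<close> becomes \<open>\<lambda> Q - ((1 - m t) \<lambda>)'\<close>. Since \<open>Q \<ge> 0\<close>, and \<open>\<lambda> \<ge> 0\<close> as is seen at
a maximum of \<open>\<bar>f\<bar>\<close>, a negative derivative of \<open>(1 - m t) \<lambda>\<close> would make it positive
(\<open>eigenvalue_derivative_bound\<close>). So \<open>(1 - m t) \<lambda>\<close> is nondecreasing. The choice \<open>m = 0\<close> gives the
first claim, and \<open>m = R\<^sub>m\<^sub>i\<^sub>n(0)\<close> the other two.

\<^bold>\<open>Globalization.\<close> Integrals over the surface are sums of coordinate integrals weighted by a
partition of unity of class C^1. Coordinate changes are carried out to first order only: the Laplacian is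
independent of the chart because it is determined by its integrals against bump functions, in
which only gradients occur (\<open>laplacian_chart_le\<close>), and the scalar curvature because under the flow it is
minus the logarithmic time derivative of the area density (\<open>R_invariant\<close>).\<close>

section \<open>Functions of class C^k\<close>

text \<open>Points of \<open>S\<close> arbitrarily near in every coordinate direction make derivatives within \<open>S\<close> unique.
Open sets and products of a time interval with an open set have this property.\<close>

definition thick :: "'a::euclidean_space set \<Rightarrow> bool" where
  "thick S \<longleftrightarrow> (\<forall>x\<in>S. \<forall>i\<in>Basis. \<forall>e>0. \<exists>d. 0 < \<bar>d\<bar> \<and> \<bar>d\<bar> < e \<and> x + d *\<^sub>R i \<in> S)"

lemma thick_open:
  assumes "open S" shows "thick S"
  unfolding thick_def
proof (intro ballI allI impI)
  fix x i :: 'a and e :: real assume x: "x \<in> S" and i: "i \<in> Basis" and e: "e > 0"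
  obtain r where r: "r > 0" "ball x r \<subseteq> S" using assms x open_contains_ball by blast
  define d where "d = min e r / 2"
  have d: "0 < d" "d < e" "d < r" using e r by (auto simp: d_def)
  then have "x + d *\<^sub>R i \<in> ball x r" using i by (simp add: dist_norm)
  then show "\<exists>d. 0 < \<bar>d\<bar> \<and> \<bar>d\<bar> < e \<and> x + d *\<^sub>R i \<in> S"
    using r d by (intro exI[of _ d]) auto
qed

lemma thick_Times:
  assumes "thick S" "thick T" shows "thick (S \<times> T)"
  unfolding thick_def
proof (intro ballI allI impI)
  fix x i :: "'a \<times> 'b" and e :: real
  assume x: "x \<in> S \<times> T" and i: "i \<in> Basis" and e: "e > 0"
  from i consider j where "j \<in> Basis" "i = (j, 0)" | j where "j \<in> Basis" "i = (0, j)"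
    by (auto simp: Basis_prod_def)
  then show "\<exists>d. 0 < \<bar>d\<bar> \<and> \<bar>d\<bar> < e \<and> x + d *\<^sub>R i \<in> S \<times> T"
  proof cases
    case 1
    then obtain d where "0 < \<bar>d\<bar>" "\<bar>d\<bar> < e" "fst x + d *\<^sub>R j \<in> S"
      using assms(1) x e unfolding thick_def by (metis mem_Times_iff)
    then show ?thesis using x 1 by (intro exI[of _ d]) (auto simp: mem_Times_iff)
  next
    case 2
    then obtain d where "0 < \<bar>d\<bar>" "\<bar>d\<bar> < e" "snd x + d *\<^sub>R j \<in> T"
      using assms(2) x e unfolding thick_def by (metis mem_Times_iff)
    then show ?thesis using x 2 by (intro exI[of _ d]) (auto simp: mem_Times_iff)
  qed
qed

lemma thick_Icc:
  assumes "(0::real) < T" shows "thick {0..T}"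
  unfolding thick_def
proof (intro ballI allI impI)
  fix x i e :: real assume x: "x \<in> {0..T}" and i: "i \<in> Basis" and e: "e > 0"
  show "\<exists>d. 0 < \<bar>d\<bar> \<and> \<bar>d\<bar> < e \<and> x + d *\<^sub>R i \<in> {0..T}"
  proof (cases "x = 0")
    case True
    then show ?thesis using x i e assms by (intro exI[of _ "min e T / 2"]) auto
  next
    case False
    then show ?thesis using x i e assms by (intro exI[of _ "- (min e x / 2)"]) auto
  qed
qed

lemma frechet_derivative_within_eq:
  assumes "thick S" "x \<in> S" "(f has_derivative f') (at x within S)"
  shows "frechet_derivative f (at x within S) = f'"
proof (rule frechet_derivative_unique_within)
  show "(f has_derivative frechet_derivative f (at x within S)) (at x within S)"
    using assms(3) by (metis differentiable_def frechet_derivative_works)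
qed (use assms in \<open>auto simp: thick_def\<close>)

lemma has_derivative_within_cong:
  assumes "\<And>y. y \<in> S \<Longrightarrow> f y = g y" "x \<in> S"
  shows "(f has_derivative f') (at x within S) = (g has_derivative f') (at x within S)"
  using assms by (metis has_derivative_transform)

lemma frechet_derivative_within_cong:
  assumes "\<And>y. y \<in> S \<Longrightarrow> f y = g y" "x \<in> S"
  shows "frechet_derivative f (at x within S) = frechet_derivative g (at x within S)"
proof -
  have "(f has_derivative f') (at x within S) = (g has_derivative f') (at x within S)" for f'
    using assms by (intro has_derivative_within_cong) auto
  then show ?thesis unfolding frechet_derivative_def by presburger
qed

lemma Ck_on_cong:
  assumes "\<And>x. x \<in> S \<Longrightarrow> f x = g x"
  shows "Ck_on k S f = Ck_on k S g"
  using assms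
proof (induction k arbitrary: f g)
  case 0
  then show ?case by (simp cong: continuous_on_cong)
next
  case (Suc k)
  have "(f differentiable at x within S) = (g differentiable at x within S)" if "x \<in> S" for x
    unfolding differentiable_def
    using Suc.prems that by (intro ex_cong1 has_derivative_within_cong) auto
  moreover have "Ck_on k S (\<lambda>x. frechet_derivative f (at x within S) v)
      = Ck_on k S (\<lambda>x. frechet_derivative g (at x within S) v)" for v
    using frechet_derivative_within_cong[of S f g, OF Suc.prems] by (intro Suc.IH) metis
  ultimately show ?case by auto
qed

lemma Ck_on_imp_cont: "Ck_on k S f \<Longrightarrow> continuous_on S f"
  by (cases k) (simp, metis Ck_on.simps(2) continuous_on_eq_continuous_within differentiable_imp_continuous_within)

lemma Ck_on_SucD: "Ck_on (Suc k) S f \<Longrightarrow> Ck_on k S f"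
proof (induction k arbitrary: f)
  case 0 then show ?case using Ck_on_imp_cont[OF 0] by simp
next
  case (Suc k)
  then show ?case by (metis Ck_on.simps(2))
qed

lemma Ck_on_mono: "Ck_on k S f \<Longrightarrow> j \<le> k \<Longrightarrow> Ck_on j S f"
  by (induction k) (auto simp: le_Suc_eq simp del: Ck_on.simps dest: Ck_on_SucD)

lemma Ck_on_deriv:
  "Ck_on (Suc k) S f \<Longrightarrow> x \<in> S \<Longrightarrow>
     (f has_derivative frechet_derivative f (at x within S)) (at x within S)"
  by (simp add: frechet_derivative_works)

text \<open>Uniqueness allows any derivative to replace the one chosen by \<open>frechet_derivative\<close>; the closure
properties of \<open>Ck_on\<close> come from this rule.\<close>

lemma Ck_on_SucI:
  assumes "thick S" "\<And>x. x \<in> S \<Longrightarrow> (f has_derivative f' x) (at x within S)"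
    "\<And>v. Ck_on k S (\<lambda>x. f' x v)"
  shows "Ck_on (Suc k) S f"
proof -
  have "frechet_derivative f (at x within S) = f' x" if "x \<in> S" for x
    using frechet_derivative_within_eq assms that by blast
  then have "Ck_on k S (\<lambda>x. frechet_derivative f (at x within S) v)" for v
    using assms(3)[of v] Ck_on_cong[of S "\<lambda>x. frechet_derivative f (at x within S) v" "\<lambda>x. f' x v" k] by simp
  then show ?thesis using assms(2) by (auto simp: differentiable_def)
qed

lemma Ck_on_const [simp]: "thick S \<Longrightarrow> Ck_on k S (\<lambda>x. c)"
proof (induction k arbitrary: c)
  case (Suc k)
  show ?case by (rule Ck_on_SucI[OF Suc.prems, of _ "\<lambda>x v. 0"]) (auto simp: Suc)
qed simp

lemma Ck_on_linear_comp:
  assumes "thick S" "bounded_linear l" "Ck_on k S f" shows "Ck_on k S (\<lambda>x. l (f x))"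
  using assms(3)
proof (induction k arbitrary: f)
  case 0
  then show ?case using assms(2) by (simp add: bounded_linear.continuous_on)
next
  case (Suc k)
  show ?case
    by (rule Ck_on_SucI[OF assms(1), of _ "\<lambda>x v. l (frechet_derivative f (at x within S) v)"])
      (use Suc in \<open>auto simp: frechet_derivative_works intro!: Suc.IH bounded_linear.has_derivative[OF assms(2)]\<close>)
qed

lemma Ck_on_add:
  assumes "thick S" "Ck_on k S f" "Ck_on k S g" shows "Ck_on k S (\<lambda>x. f x + g x)"
  using assms(2,3)
proof (induction k arbitrary: f g)
  case 0
  then show ?case by (simp add: continuous_on_add)
next
  case (Suc k)
  show ?case
    by (rule Ck_on_SucI[OF assms(1), of _ "\<lambda>x v. frechet_derivative f (at x within S) v
           + frechet_derivative g (at x within S) v"])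
      (use Suc in \<open>auto intro!: has_derivative_add simp: frechet_derivative_works\<close>)
qed

lemma Ck_on_uminus: "thick S \<Longrightarrow> Ck_on k S f \<Longrightarrow> Ck_on k S (\<lambda>x. - f x)"
  by (rule Ck_on_linear_comp[OF _ bounded_linear_minus[OF bounded_linear_ident]])

lemma Ck_on_diff:
  "thick S \<Longrightarrow> Ck_on k S f \<Longrightarrow> Ck_on k S g \<Longrightarrow> Ck_on k S (\<lambda>x. f x - g x)"
  using Ck_on_add[OF _ _ Ck_on_uminus, of S k f g] by simp

lemma Ck_on_sum:
  "thick S \<Longrightarrow> (\<And>i. i \<in> I \<Longrightarrow> Ck_on k S (f i)) \<Longrightarrow> Ck_on k S (\<lambda>x. \<Sum>i\<in>I. f i x)"
  by (induction I rule: infinite_finite_induct) (auto intro: Ck_on_add)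

lemma Ck_on_mult:
  fixes f g :: "'a::euclidean_space \<Rightarrow> real"
  assumes "thick S" "Ck_on k S f" "Ck_on k S g" shows "Ck_on k S (\<lambda>x. f x * g x)"
  using assms(2,3)
proof (induction k arbitrary: f g)
  case 0
  then show ?case by (simp add: continuous_on_mult)
next
  case (Suc k)
  note fg = Ck_on_SucD[OF Suc.prems(1)] Ck_on_SucD[OF Suc.prems(2)]
  show ?case
    by (rule Ck_on_SucI[OF assms(1), of _ "\<lambda>x v. f x * frechet_derivative g (at x within S) v
           + frechet_derivative f (at x within S) v * g x"])
      (use Suc fg in \<open>auto intro!: has_derivative_mult Ck_on_add assms(1) simp: frechet_derivative_works\<close>)
qed

lemma Ck_on_power2:
  fixes f :: "'a::euclidean_space \<Rightarrow> real"
  shows "thick S \<Longrightarrow> Ck_on k S f \<Longrightarrow> Ck_on k S (\<lambda>x. (f x)\<^sup>2)"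
  unfolding power2_eq_square by (rule Ck_on_mult)

lemma Ck_on_inverse:
  fixes f :: "'a::euclidean_space \<Rightarrow> real"
  assumes "thick S" "Ck_on k S f" "\<And>x. x \<in> S \<Longrightarrow> f x \<noteq> 0" shows "Ck_on k S (\<lambda>x. inverse (f x))"
  using assms(2)
proof (induction k)
  case 0
  then show ?case using assms(3) by (simp add: continuous_on_inverse)
next
  case (Suc k)
  note f = Ck_on_SucD[OF Suc.prems(1)]
  show ?case
    by (rule Ck_on_SucI[OF assms(1), of _ "\<lambda>x v. - (inverse (f x) * frechet_derivative f (at x within S) v * inverse (f x))"])
      (use Suc f assms(3) in \<open>auto intro!: has_derivative_inverse Ck_on_uminus Ck_on_mult assms(1) simp: frechet_derivative_works\<close>)
qed

lemma Ck_on_divide: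
  fixes f g :: "'a::euclidean_space \<Rightarrow> real"
  shows "thick S \<Longrightarrow> Ck_on k S f \<Longrightarrow> Ck_on k S g \<Longrightarrow> (\<And>x. x \<in> S \<Longrightarrow> g x \<noteq> 0) \<Longrightarrow> Ck_on k S (\<lambda>x. f x / g x)"
  unfolding divide_inverse by (intro Ck_on_mult Ck_on_inverse)

lemma Ck_on_sqrt:
  fixes f :: "'a::euclidean_space \<Rightarrow> real"
  assumes "thick S" "Ck_on k S f" "\<And>x. x \<in> S \<Longrightarrow> f x > 0" shows "Ck_on k S (\<lambda>x. sqrt (f x))"
  using assms(2)
proof (induction k)
  case 0
  then show ?case by (simp add: continuous_on_real_sqrt)
next
  case (Suc k)
  note f = Ck_on_SucD[OF Suc.prems(1)]
  have d: "((\<lambda>x. sqrt (f x)) has_derivative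
      (\<lambda>v. frechet_derivative f (at x within S) v * (inverse (sqrt (f x)) / 2))) (at x within S)" if "x \<in> S" for x
  proof -
    have "(sqrt has_derivative (\<lambda>h. h * (inverse (sqrt (f x)) / 2))) (at (f x))"
      using DERIV_real_sqrt[OF assms(3)[OF that]] by (rule has_derivative_eq_rhs[OF has_field_derivative_imp_has_derivative]) auto
    then show ?thesis by (rule has_derivative_compose[OF Ck_on_deriv[OF Suc.prems(1) that]])
  qed
  have nz: "sqrt (f x) \<noteq> 0" if "x \<in> S" for x using assms(3)[OF that] by simp
  have c: "Ck_on k S (\<lambda>x. frechet_derivative f (at x within S) v * (inverse (sqrt (f x)) / 2))" for v
    using Suc.prems Suc.IH[OF f] assms(1) nz
    by (intro Ck_on_mult Ck_on_divide Ck_on_inverse) auto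
  show ?case
    by (rule Ck_on_SucI[OF assms(1), of _ "\<lambda>x v. frechet_derivative f (at x within S) v * (inverse (sqrt (f x)) / 2)"])
      (use Suc f d c in auto)
qed

lemma Ck_on_ln:
  fixes f :: "'a::euclidean_space \<Rightarrow> real"
  assumes "thick S" "Ck_on k S f" "\<And>x. x \<in> S \<Longrightarrow> f x > 0" shows "Ck_on k S (\<lambda>x. ln (f x))"
  using assms(2)
proof (cases k)
  case 0
  then show ?thesis using assms(2,3) by (force intro!: continuous_on_ln)
next
  case (Suc j)
  then have f: "Ck_on (Suc j) S f" using assms(2) by simp
  note f' = Ck_on_SucD[OF f]
  have nz: "f x \<noteq> 0" if "x \<in> S" for x using assms(3) that by force
  show ?thesis unfolding Suc
    by (rule Ck_on_SucI[OF assms(1), of _ "\<lambda>x v. frechet_derivative f (at x within S) v * inverse (f x)"])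
      (use f f' assms(3) nz in \<open>auto intro!: has_derivative_ln Ck_on_inverse Ck_on_mult assms(1) simp: frechet_derivative_works\<close>)
qed

lemma Ck_on_open_subset:
  assumes "open W" "W \<subseteq> S" "Ck_on k S f"
  shows "Ck_on k W f"
  using assms(3)
proof (induction k arbitrary: f)
  case 0 then show ?case using assms(2) continuous_on_subset by auto
next
  case (Suc k)
  show ?case
    by (rule Ck_on_SucI[OF thick_open[OF assms(1)], of _ "\<lambda>x. frechet_derivative f (at x within S)"])
      (use Suc assms(2) in \<open>auto intro: has_derivative_subset simp: frechet_derivative_works\<close>)
qed

lemma Ck_on_open_deriv:
  assumes "open W" "Ck_on (Suc k) W f" "x \<in> W"
  shows "(f has_derivative frechet_derivative f (at x)) (at x)"
  using Ck_on_deriv[OF assms(2,3)] at_within_open[OF assms(3,1)] by simp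

lemma Ck_on_open_deriv_Ck:
  assumes "open W" "Ck_on (Suc k) W f"
  shows "Ck_on k W (\<lambda>x. frechet_derivative f (at x) v)"
proof -
  have "Ck_on k W (\<lambda>x. frechet_derivative f (at x within W) v)" using assms(2) by simp
  then show ?thesis
    using Ck_on_cong[of W "\<lambda>x. frechet_derivative f (at x within W) v" "\<lambda>x. frechet_derivative f (at x) v"]
      at_within_open[OF _ assms(1)] by simp
qed

declare Ck_on.simps [simp del]

lemma C1_on_compose:
  assumes "thick S" "Ck_on (Suc 0) S f" "Ck_on (Suc 0) R h" "f ` S \<subseteq> R"
  shows "Ck_on (Suc 0) S (\<lambda>x. h (f x))"
proof (rule Ck_on_SucI[OF assms(1)])
  fix x assume x: "x \<in> S"
  have "(h has_derivative frechet_derivative h (at (f x) within R)) (at (f x) within f ` S)"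
    using assms(3,4) x by (intro has_derivative_subset[OF Ck_on_deriv[of 0]]) auto
  then show "((\<lambda>x. h (f x)) has_derivative
      (\<lambda>v. frechet_derivative h (at (f x) within R) (frechet_derivative f (at x within S) v))) (at x within S)"
    using has_derivative_in_compose[OF Ck_on_deriv[of 0 S f x]] assms(2) x by simp
next
  fix v
  have eq: "frechet_derivative h (at (f x) within R) (frechet_derivative f (at x within S) v)
    = (\<Sum>b\<in>Basis. (frechet_derivative f (at x within S) v \<bullet> b) *\<^sub>R frechet_derivative h (at (f x) within R) b)"
    if x: "x \<in> S" for x
  proof -
    have bl: "linear (frechet_derivative h (at (f x) within R))"
      using Ck_on_deriv[of 0 R h "f x"] assms(3,4) x by (auto intro: has_derivative_linear)
    show ?thesis
      by (subst (1) euclidean_representation[symmetric], subst linear_sum[OF bl])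
        (simp add: linear_scale[OF bl])
  qed
  have c1: "continuous_on S (\<lambda>x. frechet_derivative f (at x within S) v)" using assms(2) by (simp add: Ck_on.simps)
  have c2: "continuous_on S (\<lambda>x. frechet_derivative h (at (f x) within R) b)" for b
    by (rule continuous_on_compose2[of R "\<lambda>y. frechet_derivative h (at y within R) b",
            OF _ Ck_on_imp_cont[OF assms(2)] assms(4)])
      (use assms(3) in \<open>simp add: Ck_on.simps\<close>)
  have "continuous_on S (\<lambda>x. \<Sum>b\<in>Basis. (frechet_derivative f (at x within S) v \<bullet> b) *\<^sub>R frechet_derivative h (at (f x) within R) b)"
    by (intro continuous_intros c1 c2)
  then show "Ck_on 0 S (\<lambda>x. frechet_derivative h (at (f x) within R) (frechet_derivative f (at x within S) v))"
    by (simp add: eq Ck_on.simps cong: continuous_on_cong)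
qed

text \<open>Schwarz's theorem. Applying the mean value theorem twice to the second difference of \<open>f\<close> along
\<open>u\<close> and \<open>v\<close> gives a value of either mixed derivative at a point near \<open>x\<close>.\<close>

lemma frechet_derivative_symmetric:
  fixes f :: "'a::euclidean_space \<Rightarrow> real"
  assumes W: "open W" and f: "Ck_on 2 W f" and x: "x \<in> W"
  shows "frechet_derivative (\<lambda>y. frechet_derivative f (at y) u) (at x) v
       = frechet_derivative (\<lambda>y. frechet_derivative f (at y) v) (at x) u"
proof -
  define D where "D u y = frechet_derivative f (at y) u" for u y
  define D2 where "D2 u v y = frechet_derivative (D u) (at y) v" for u v y
  have f': "Ck_on (Suc (Suc 0)) W f" using f by (simp only: numeral_2_eq_2)
  have df: "(f has_derivative (\<lambda>u. D u y)) (at y)" if "y \<in> W" for y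
    using Ck_on_open_deriv[OF W f' that] by (simp add: D_def)
  have C1: "Ck_on (Suc 0) W (D u)" for u
    unfolding D_def[abs_def] by (rule Ck_on_open_deriv_Ck[OF W f'])
  have dD: "(D u has_derivative (\<lambda>v. D2 u v y)) (at y)" if "y \<in> W" for y u
    using Ck_on_open_deriv[OF W C1 that] by (simp add: D2_def)
  have cD2: "continuous_on W (D2 u v)" for u v
    unfolding D2_def[abs_def] by (rule Ck_on_imp_cont[OF Ck_on_open_deriv_Ck[OF W C1]])
  \<comment> \<open>The second difference quotient, read in either order, is a value of the mixed derivative nearby.\<close>
  have key: "\<exists>z\<in>ball x e. (f (x + r *\<^sub>R u + r *\<^sub>R v) - f (x + r *\<^sub>R u) - f (x + r *\<^sub>R v) + f x) = r * r * D2 u v z"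
    if e: "ball x e \<subseteq> W" and r: "r > 0" "r * (norm u + norm v) < e" for u v e r
  proof -
    have inb: "x + a *\<^sub>R u + b *\<^sub>R v \<in> ball x e" if "0 \<le> a" "a \<le> r" "0 \<le> b" "b \<le> r" for a b
    proof -
      have "norm (a *\<^sub>R u + b *\<^sub>R v) \<le> a * norm u + b * norm v"
        using that norm_triangle_ineq[of "a *\<^sub>R u" "b *\<^sub>R v"] by simp
      also have "\<dots> \<le> r * norm u + r * norm v" using that by (intro add_mono mult_right_mono) auto
      also have "\<dots> < e" using r by (simp add: algebra_simps)
      finally show ?thesis by (simp add: dist_norm add.assoc norm_minus_commute) (simp add: add.commute)
    qed
    define \<phi> where "\<phi> s = f (x + s *\<^sub>R u + r *\<^sub>R v) - f (x + s *\<^sub>R u)" for s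
    have d\<phi>: "(\<phi> has_real_derivative (D u (x + s *\<^sub>R u + r *\<^sub>R v) - D u (x + s *\<^sub>R u))) (at s)"
      if "0 \<le> s" "s \<le> r" for s
    proof -
      have w: "x + s *\<^sub>R u + r *\<^sub>R v \<in> W" "x + s *\<^sub>R u \<in> W"
        using inb[of s r] inb[of s 0] that r e by auto
      have l1: "((\<lambda>s. x + s *\<^sub>R u + r *\<^sub>R v) has_derivative (\<lambda>h. h *\<^sub>R u)) (at s)"
        and l2: "((\<lambda>s. x + s *\<^sub>R u) has_derivative (\<lambda>h. h *\<^sub>R u)) (at s)"
        by (auto intro!: derivative_eq_intros)
      have "(\<phi> has_derivative (\<lambda>h. D (h *\<^sub>R u) (x + s *\<^sub>R u + r *\<^sub>R v) - D (h *\<^sub>R u) (x + s *\<^sub>R u))) (at s)"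
        unfolding \<phi>_def
        by (intro has_derivative_diff has_derivative_compose[OF l1 df] has_derivative_compose[OF l2 df] w)
      moreover have "D (h *\<^sub>R u) y = h * D u y" if "y \<in> W" for h y
        using linear_scale[OF has_derivative_linear[OF df[OF that]], of h u] by simp
      ultimately show ?thesis using w
        unfolding has_field_derivative_def
        by (elim has_derivative_eq_rhs) (simp add: fun_eq_iff algebra_simps)
    qed
    obtain s where s: "0 < s" "s < r" "\<phi> r - \<phi> 0 = r * (D u (x + s *\<^sub>R u + r *\<^sub>R v) - D u (x + s *\<^sub>R u))"
      using MVT2[OF r(1), of \<phi> "\<lambda>s. D u (x + s *\<^sub>R u + r *\<^sub>R v) - D u (x + s *\<^sub>R u)"] d\<phi> by auto
    define \<psi> where "\<psi> b = D u (x + s *\<^sub>R u + b *\<^sub>R v)" for b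
    have d\<psi>: "(\<psi> has_real_derivative D2 u v (x + s *\<^sub>R u + b *\<^sub>R v)) (at b)"
      if "0 \<le> b" "b \<le> r" for b
    proof -
      have w: "x + s *\<^sub>R u + b *\<^sub>R v \<in> W" using inb[of s b] that s e by auto
      have l1: "((\<lambda>b. x + s *\<^sub>R u + b *\<^sub>R v) has_derivative (\<lambda>h. h *\<^sub>R v)) (at b)"
        by (auto intro!: derivative_eq_intros)
      have "(\<psi> has_derivative (\<lambda>h. D2 u (h *\<^sub>R v) (x + s *\<^sub>R u + b *\<^sub>R v))) (at b)"
        unfolding \<psi>_def by (rule has_derivative_compose[OF l1 dD[OF w]])
      moreover have "D2 u (h *\<^sub>R v) y = h * D2 u v y" if "y \<in> W" for h y
        using linear_scale[OF has_derivative_linear[OF dD[OF that, of u]], of h v] by simp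
      ultimately show ?thesis using w
        unfolding has_field_derivative_def
        by (elim has_derivative_eq_rhs) (simp add: fun_eq_iff algebra_simps)
    qed
    obtain b where b: "0 < b" "b < r" "\<psi> r - \<psi> 0 = r * D2 u v (x + s *\<^sub>R u + b *\<^sub>R v)"
      using MVT2[OF r(1), of \<psi> "\<lambda>b. D2 u v (x + s *\<^sub>R u + b *\<^sub>R v)"] d\<psi> by auto
    have "f (x + r *\<^sub>R u + r *\<^sub>R v) - f (x + r *\<^sub>R u) - f (x + r *\<^sub>R v) + f x = \<phi> r - \<phi> 0"
      by (simp add: \<phi>_def)
    also have "\<dots> = r * r * D2 u v (x + s *\<^sub>R u + b *\<^sub>R v)" using s(3) b(3) by (simp add: \<psi>_def)
    finally show ?thesis using inb[of s b] s b by (metis less_imp_le)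
  qed
  have "\<bar>D2 u v x - D2 v u x\<bar> < 2 * d" if d: "d > 0" for d
  proof -
    have cx: "continuous (at x) (D2 u v)" "continuous (at x) (D2 v u)"
      using cD2 W x by (auto simp: continuous_on_eq_continuous_at)
    obtain e1 where e1: "e1 > 0" "\<And>z. dist z x < e1 \<Longrightarrow> dist (D2 u v z) (D2 u v x) < d"
      using cx(1) d unfolding continuous_at_eps_delta by blast
    obtain e2 where e2: "e2 > 0" "\<And>z. dist z x < e2 \<Longrightarrow> dist (D2 v u z) (D2 v u x) < d"
      using cx(2) d unfolding continuous_at_eps_delta by blast
    obtain e3 where e3: "e3 > 0" "ball x e3 \<subseteq> W" using W x open_contains_ball by blast
    define e where "e = min e1 (min e2 e3)"
    have e: "e > 0" "ball x e \<subseteq> W" using e1 e2 e3 by (auto simp: e_def)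
    define r where "r = e / (norm u + norm v + 1)"
    have pos: "norm u + norm v + 1 > 0" by (smt (verit) norm_ge_zero)
    have r: "r > 0" "r * (norm u + norm v) < e"
      using e pos by (auto simp: r_def field_simps)
    obtain z1 where z1: "z1 \<in> ball x e" "f (x + r *\<^sub>R u + r *\<^sub>R v) - f (x + r *\<^sub>R u) - f (x + r *\<^sub>R v) + f x = r * r * D2 u v z1"
      using key[OF e(2) r] by blast
    obtain z2 where z2: "z2 \<in> ball x e" "f (x + r *\<^sub>R v + r *\<^sub>R u) - f (x + r *\<^sub>R v) - f (x + r *\<^sub>R u) + f x = r * r * D2 v u z2"
      using key[OF e(2) r(1), of v u] r(2) by (auto simp: add.commute)
    have "r * r * D2 u v z1 = r * r * D2 v u z2"
      using z1(2) z2(2) by (simp add: algebra_simps)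
    then have "D2 u v z1 = D2 v u z2" using r by simp
    moreover have "dist (D2 u v z1) (D2 u v x) < d" "dist (D2 v u z2) (D2 v u x) < d"
      using e1(2)[of z1] e2(2)[of z2] z1(1) z2(1) by (auto simp: e_def dist_commute)
    ultimately show ?thesis by (simp add: dist_real_def)
  qed
  from this[of "\<bar>D2 u v x - D2 v u x\<bar> / 2"] have "D2 u v x = D2 v u x" by auto
  then show ?thesis by (simp add: D2_def D_def[abs_def])
qed

section \<open>The geometry of a surface in a chart\<close>

lemma partial_eqI:
  "(f has_derivative f') (at y) \<Longrightarrow> partial i f y = f' (axis i 1)"
  unfolding partial_def by (metis frechet_derivative_at)

lemma partial_cong:
  assumes "open U" "y \<in> U" "\<And>z. z \<in> U \<Longrightarrow> f z = g z"
  shows "partial i f y = partial i g y"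
  using frechet_derivative_within_cong[of U f g y] assms at_within_open[OF assms(2,1)]
  by (simp add: partial_def)

lemma has_derivative_frechet:
  "f differentiable (at y) \<Longrightarrow> (f has_derivative frechet_derivative f (at y)) (at y)"
  by (simp add: frechet_derivative_works)

lemma partial_const [simp]: "partial i (\<lambda>z. c) y = 0"
  by (rule partial_eqI) simp

lemma partial_add:
  "f differentiable (at y) \<Longrightarrow> g differentiable (at y) \<Longrightarrow>
     partial i (\<lambda>z. f z + g z) y = partial i f y + partial i g y"
  by (subst partial_eqI[OF has_derivative_add[OF has_derivative_frechet has_derivative_frechet]])
    (auto simp: partial_def)

lemma partial_diff:
  "f differentiable (at y) \<Longrightarrow> g differentiable (at y) \<Longrightarrow>
     partial i (\<lambda>z. f z - g z) y = partial i f y - partial i g y"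
  by (subst partial_eqI[OF has_derivative_diff[OF has_derivative_frechet has_derivative_frechet]])
    (auto simp: partial_def)

lemma partial_mult:
  "f differentiable (at y) \<Longrightarrow> g differentiable (at y) \<Longrightarrow>
     partial i (\<lambda>z. f z * g z) y = partial i f y * g y + f y * partial i g y"
  by (subst partial_eqI[OF has_derivative_mult[OF has_derivative_frechet has_derivative_frechet]])
    (auto simp: partial_def)

lemma partial_cmult:
  "f differentiable (at y) \<Longrightarrow> partial i (\<lambda>z. c * f z) y = c * partial i f y"
  by (simp add: partial_mult)

lemma partial_divide:
  assumes "f differentiable (at y)" "g differentiable (at y)" "g y \<noteq> 0"
  shows "partial i (\<lambda>z. f z / g z) y = (partial i f y * g y - f y * partial i g y) / (g y)\<^sup>2"
  by (subst partial_eqI[OF has_derivative_divide[OF has_derivative_frechet has_derivative_frechet]])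
    (use assms in \<open>auto simp: partial_def field_simps power2_eq_square\<close>)

lemma partial_sqrt:
  assumes "f differentiable (at y)" "f y > 0"
  shows "partial i (\<lambda>z. sqrt (f z)) y = partial i f y / (2 * sqrt (f y))"
proof -
  have "(sqrt has_derivative (\<lambda>h. h * (inverse (sqrt (f y)) / 2))) (at (f y))"
    using DERIV_real_sqrt[OF assms(2)] by (rule has_derivative_eq_rhs[OF has_field_derivative_imp_has_derivative]) auto
  from partial_eqI[OF has_derivative_compose[OF has_derivative_frechet[OF assms(1)] this]]
  show ?thesis by (simp add: partial_def field_simps)
qed

lemma partial_ln:
  assumes "f differentiable (at y)" "f y > 0"
  shows "partial i (\<lambda>z. ln (f z)) y = partial i f y / f y"
  by (subst partial_eqI[OF has_derivative_ln[OF assms(2) has_derivative_frechet[OF assms(1)]]])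
    (auto simp: partial_def field_simps)

lemma Ck_on_differentiable:
  "open U \<Longrightarrow> Ck_on (Suc k) U f \<Longrightarrow> y \<in> U \<Longrightarrow> f differentiable (at y)"
  by (metis Ck_on_open_deriv differentiable_def)

lemma Ck_on_partial:
  "open U \<Longrightarrow> Ck_on (Suc k) U f \<Longrightarrow> Ck_on k U (partial i f)"
  unfolding partial_def[abs_def] by (rule Ck_on_open_deriv_Ck)

lemma partial_commute:
  assumes "open U" "Ck_on 2 U f" "y \<in> U"
  shows "partial i (partial j f) y = partial j (partial i f) y"
  unfolding partial_def[abs_def] by (rule frechet_derivative_symmetric[OF assms])

lemma matrix_inv_2:
  fixes M :: "real^2^2"
  assumes D: "M$1$1 * M$2$2 - M$1$2 * M$2$1 \<noteq> 0"
  shows "matrix_inv M $ 1 $ 1 = M$2$2 / (M$1$1 * M$2$2 - M$1$2 * M$2$1)"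
    "matrix_inv M $ 1 $ 2 = - M$1$2 / (M$1$1 * M$2$2 - M$1$2 * M$2$1)"
    "matrix_inv M $ 2 $ 1 = - M$2$1 / (M$1$1 * M$2$2 - M$1$2 * M$2$1)"
    "matrix_inv M $ 2 $ 2 = M$1$1 / (M$1$1 * M$2$2 - M$1$2 * M$2$1)"
proof -
  have "invertible M" using D by (simp add: det_2 invertible_det_nz)
  then have "\<exists>M'. M ** M' = mat 1 \<and> M' ** M = mat 1" by (simp add: invertible_def)
  then have inv: "M ** matrix_inv M = mat 1"
    unfolding matrix_inv_def by (rule someI2_ex) simp
  have e: "(M ** matrix_inv M) $ i $ j = M$i$1 * matrix_inv M $ 1 $ j + M$i$2 * matrix_inv M $ 2 $ j" for i j
    by (simp add: matrix_matrix_mult_def sum_2)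
  have *: "M$1$1 * matrix_inv M $ 1 $ 1 + M$1$2 * matrix_inv M $ 2 $ 1 = 1"
    "M$1$1 * matrix_inv M $ 1 $ 2 + M$1$2 * matrix_inv M $ 2 $ 2 = 0"
    "M$2$1 * matrix_inv M $ 1 $ 1 + M$2$2 * matrix_inv M $ 2 $ 1 = 0"
    "M$2$1 * matrix_inv M $ 1 $ 2 + M$2$2 * matrix_inv M $ 2 $ 2 = 1"
    unfolding e[symmetric] inv by (simp_all add: mat_def)
  have cramer: "a = d' / (a' * d' - b' * c')" "c = - c' / (a' * d' - b' * c')"
    if "a' * a + b' * c = 1" "c' * a + d' * c = 0" "a' * d' - b' * c' \<noteq> 0" for a c a' b' c' d' :: real
  proof -
    have "a * (a' * d' - b' * c') = d' * (a' * a + b' * c) - b' * (c' * a + d' * c)"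
      "c * (a' * d' - b' * c') = a' * (c' * a + d' * c) - c' * (a' * a + b' * c)"
      by (simp_all add: algebra_simps)
    then have "a * (a' * d' - b' * c') = d'" "c * (a' * d' - b' * c') = - c'"
      unfolding that(1,2) by simp_all
    then show "a = d' / (a' * d' - b' * c')" "c = - c' / (a' * d' - b' * c')"
      using that(3) by (metis nonzero_mult_div_cancel_right)+
  qed
  have D': "M$2$2 * M$1$1 - M$2$1 * M$1$2 \<noteq> 0" using D by (simp add: mult.commute)
  have sw: "M$2$2 * M$1$1 - M$2$1 * M$1$2 = M$1$1 * M$2$2 - M$1$2 * M$2$1" by (simp add: mult.commute)
  show "matrix_inv M $ 1 $ 1 = M$2$2 / (M$1$1 * M$2$2 - M$1$2 * M$2$1)"
    "matrix_inv M $ 2 $ 1 = - M$2$1 / (M$1$1 * M$2$2 - M$1$2 * M$2$1)"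
    using cramer[OF *(1,3) D] by auto
  have "M$2$2 * matrix_inv M $ 2 $ 2 + M$2$1 * matrix_inv M $ 1 $ 2 = 1"
    "M$1$2 * matrix_inv M $ 2 $ 2 + M$1$1 * matrix_inv M $ 1 $ 2 = 0" using *(2,4) by (simp_all add: add.commute)
  from cramer[OF this D'] show "matrix_inv M $ 1 $ 2 = - M$1$2 / (M$1$1 * M$2$2 - M$1$2 * M$2$1)"
    "matrix_inv M $ 2 $ 2 = M$1$1 / (M$1$1 * M$2$2 - M$1$2 * M$2$1)" unfolding sw by auto
qed

text \<open>With \<open>e\<close>, \<open>f\<close>, \<open>h\<close> the components of a metric divided by the area density, the matrix of
\<open>sqrt (det g)\<close> times the inverse metric has rows \<open>(h, - f)\<close> and \<open>(- f, e)\<close>; \<open>div_op\<close> is the divergence of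
its product with the gradient of \<open>u\<close>.\<close>

definition div_op ::
    "(real^2 \<Rightarrow> real) \<Rightarrow> (real^2 \<Rightarrow> real) \<Rightarrow> (real^2 \<Rightarrow> real) \<Rightarrow> (real^2 \<Rightarrow> real) \<Rightarrow> real^2 \<Rightarrow> real" where
  "div_op e f h u y = partial 1 (\<lambda>z. h z * partial 1 u z - f z * partial 2 u z) y
     + partial 2 (\<lambda>z. e z * partial 2 u z - f z * partial 1 u z) y"

text \<open>The conformally invariant part of the curvature density in Liouville's formula, see
\<open>scalar_conformal\<close>.\<close>

definition conf_curv ::
    "(real^2 \<Rightarrow> real) \<Rightarrow> (real^2 \<Rightarrow> real) \<Rightarrow> (real^2 \<Rightarrow> real) \<Rightarrow> real^2 \<Rightarrow> real" where
  "conf_curv e f h y =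
     partial 2 (\<lambda>z. (2 * e z * partial 1 f z - f z * partial 1 e z - e z * partial 2 e z) / e z) y
     - partial 1 (\<lambda>z. (e z * partial 1 h z - f z * partial 2 e z) / e z) y"

locale metric2 =
  fixes U :: "(real^2) set" and G :: "real^2 \<Rightarrow> real^2^2"
  assumes U: "open U"
    and smooth: "\<And>k. Ck_on k U G"
    and sym: "\<And>y. y \<in> U \<Longrightarrow> transpose (G y) = G y"
    and pos: "\<And>y v. y \<in> U \<Longrightarrow> v \<noteq> 0 \<Longrightarrow> v \<bullet> (G y *v v) > 0"
begin

definition "coef i j y = G y $ i $ j"
abbreviation "E \<equiv> coef 1 1"
abbreviation "F \<equiv> coef 1 2"
abbreviation "H \<equiv> coef 2 2"
definition "vol y = sqrt (E y * H y - (F y)\<^sup>2)"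
definition "\<Gamma> k i j = christoffel G k i j"

lemma thickU: "thick U" using U by (rule thick_open)

lemma coef_smooth: "Ck_on k U (coef i j)"
proof -
  have "bounded_linear (\<lambda>M::real^2^2. M $ i $ j)"
    using bounded_linear_compose[OF bounded_linear_vec_nth bounded_linear_vec_nth] .
  from Ck_on_linear_comp[OF thickU this smooth] show ?thesis by (simp add: coef_def[abs_def])
qed

lemma coef_sym: assumes "y \<in> U" shows "coef i j y = coef j i y"
proof -
  have "transpose (G y) $ i $ j = G y $ i $ j" using sym[OF assms] by simp
  then show ?thesis by (simp add: transpose_def coef_def)
qed

lemma coef_21: "y \<in> U \<Longrightarrow> coef 2 1 y = F y"
  by (rule coef_sym)

lemma quad: "v \<bullet> (G y *v v) = E y * (v$1)\<^sup>2 + (F y + coef 2 1 y) * v$1 * v$2 + H y * (v$2)\<^sup>2"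
  by (simp add: inner_vec_def matrix_vector_mult_def sum_2 coef_def power2_eq_square algebra_simps)

lemma E_pos: assumes "y \<in> U" shows "E y > 0"
proof -
  have "axis 1 1 \<noteq> (0::real^2)" by (simp add: axis_eq_0_iff)
  from pos[OF assms this] show ?thesis by (simp add: quad axis_def)
qed

lemma D_pos: assumes y: "y \<in> U" shows "E y * H y - (F y)\<^sup>2 > 0"
proof -
  \<comment> \<open>This vector is orthogonal to the first coordinate direction; its squared length is \<open>E\<close> times the determinant.\<close>
  define v :: "real^2" where "v = (\<chi> i. if i = 1 then - F y else E y)"
  have v12: "v$1 = - F y" "v$2 = E y" by (auto simp: v_def)
  have "v \<noteq> 0" using E_pos[OF y] v12 by (metis less_irrefl zero_index)
  from pos[OF y this] have "0 < E y * (E y * H y - (F y)\<^sup>2)"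
    unfolding quad coef_21[OF y] v12 by (simp add: power2_eq_square algebra_simps)
  then show ?thesis using E_pos[OF y] by (simp add: zero_less_mult_iff)
qed

lemma D_smooth: "Ck_on k U (\<lambda>y. E y * H y - (F y)\<^sup>2)"
  by (intro Ck_on_diff Ck_on_mult Ck_on_power2 coef_smooth thickU)

lemma vol_smooth: "Ck_on k U vol"
  unfolding vol_def[abs_def] by (intro Ck_on_sqrt thickU D_smooth D_pos)

lemma vol_pos: "y \<in> U \<Longrightarrow> vol y > 0"
  using D_pos by (simp add: vol_def)

lemma vol_sq: "y \<in> U \<Longrightarrow> (vol y)\<^sup>2 = E y * H y - (F y)\<^sup>2"
  using D_pos[of y] by (simp add: vol_def)

lemma minv:
  assumes y: "y \<in> U"
  shows "matrix_inv (G y) $ 1 $ 1 = H y / (vol y)\<^sup>2" "matrix_inv (G y) $ 1 $ 2 = - F y / (vol y)\<^sup>2"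
    "matrix_inv (G y) $ 2 $ 1 = - F y / (vol y)\<^sup>2" "matrix_inv (G y) $ 2 $ 2 = E y / (vol y)\<^sup>2"
proof -
  have c: "G y $ 1 $ 1 = E y" "G y $ 1 $ 2 = F y" "G y $ 2 $ 1 = F y" "G y $ 2 $ 2 = H y"
    using coef_21[OF y] by (auto simp: coef_def)
  have d: "G y $ 1 $ 1 * G y $ 2 $ 2 - G y $ 1 $ 2 * G y $ 2 $ 1 = (vol y)\<^sup>2"
    using vol_sq[OF y] by (simp add: c power2_eq_square)
  have "G y $ 1 $ 1 * G y $ 2 $ 2 - G y $ 1 $ 2 * G y $ 2 $ 1 \<noteq> 0"
    using d vol_pos[OF y] by simp
  from matrix_inv_2[OF this, unfolded d]
  show "matrix_inv (G y) $ 1 $ 1 = H y / (vol y)\<^sup>2" "matrix_inv (G y) $ 1 $ 2 = - F y / (vol y)\<^sup>2"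
    "matrix_inv (G y) $ 2 $ 1 = - F y / (vol y)\<^sup>2" "matrix_inv (G y) $ 2 $ 2 = E y / (vol y)\<^sup>2"
    by (simp_all add: c)
qed

lemma partial_coef_sym: "y \<in> U \<Longrightarrow> partial k (coef 2 1) y = partial k F y"
  by (rule partial_cong[OF U]) (auto simp: coef_21)

lemma \<Gamma>_eq:
  assumes y: "y \<in> U"
  shows "\<Gamma> 1 i j y = 1 / (2 * (vol y)\<^sup>2) *
       (H y * (partial i (coef j 1) y + partial j (coef i 1) y - partial 1 (coef i j) y)
        - F y * (partial i (coef j 2) y + partial j (coef i 2) y - partial 2 (coef i j) y))"
    "\<Gamma> 2 i j y = 1 / (2 * (vol y)\<^sup>2) *
       (E y * (partial i (coef j 2) y + partial j (coef i 2) y - partial 2 (coef i j) y)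
        - F y * (partial i (coef j 1) y + partial j (coef i 1) y - partial 1 (coef i j) y))"
proof -
  have c: "(\<lambda>z. G z $ i $ j) = coef i j" for i j by (simp add: coef_def[abs_def])
  have q: "(vol y)\<^sup>2 \<noteq> 0" using vol_pos[OF y] by simp
  have a: "1 / 2 * (b / r * x + c / r * z) = 1 / (2 * r) * (b * x + c * z)" if "r \<noteq> 0" for b c r x z :: real
    using that by (simp add: field_simps)
  show "\<Gamma> 1 i j y = 1 / (2 * (vol y)\<^sup>2) *
       (H y * (partial i (coef j 1) y + partial j (coef i 1) y - partial 1 (coef i j) y)
        - F y * (partial i (coef j 2) y + partial j (coef i 2) y - partial 2 (coef i j) y))"
    unfolding \<Gamma>_def christoffel_def sum_2 minv[OF y] c a[OF q] by simp
  show "\<Gamma> 2 i j y = 1 / (2 * (vol y)\<^sup>2) *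
       (E y * (partial i (coef j 2) y + partial j (coef i 2) y - partial 2 (coef i j) y)
        - F y * (partial i (coef j 1) y + partial j (coef i 1) y - partial 1 (coef i j) y))"
    unfolding \<Gamma>_def christoffel_def sum_2 minv[OF y] c a[OF q] by simp
qed

lemma \<Gamma>_sym: assumes y: "y \<in> U" shows "\<Gamma> k i j y = \<Gamma> k j i y"
proof -
  have "partial a (coef i j) y = partial a (coef j i) y" for a
    by (rule partial_cong[OF U y coef_sym])
  then have "partial a (coef j i) y = partial a (coef i j) y" for a by simp
  then show ?thesis using exhaust_2[of k] by (auto simp: \<Gamma>_eq[OF y] add.commute)
qed

lemma \<Gamma>_smooth: "Ck_on k U (\<Gamma> l i j)"
proof -
  have nz: "2 * (vol y)\<^sup>2 \<noteq> 0" if "y \<in> U" for y using vol_pos[OF that] by simp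
  have p: "Ck_on k U (partial a (coef i j))" for a i j
    by (rule Ck_on_partial[OF U coef_smooth])
  have 1: "Ck_on k U (\<lambda>y. 1 / (2 * (vol y)\<^sup>2) *
       (H y * (partial i (coef j 1) y + partial j (coef i 1) y - partial 1 (coef i j) y)
        - F y * (partial i (coef j 2) y + partial j (coef i 2) y - partial 2 (coef i j) y)))"
    by (intro Ck_on_mult Ck_on_diff Ck_on_add Ck_on_divide Ck_on_power2 Ck_on_const thickU p coef_smooth vol_smooth nz)
  have 2: "Ck_on k U (\<lambda>y. 1 / (2 * (vol y)\<^sup>2) *
       (E y * (partial i (coef j 2) y + partial j (coef i 2) y - partial 2 (coef i j) y)
        - F y * (partial i (coef j 1) y + partial j (coef i 1) y - partial 1 (coef i j) y)))"
    by (intro Ck_on_mult Ck_on_diff Ck_on_add Ck_on_divide Ck_on_power2 Ck_on_const thickU p coef_smooth vol_smooth nz)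
  from exhaust_2[of l] show ?thesis
    using 1 2 Ck_on_cong[of U, OF \<Gamma>_eq(1)] Ck_on_cong[of U, OF \<Gamma>_eq(2)] by auto
qed

text \<open>This is \<open>\<nabla> g = 0\<close>, which lets Christoffel symbols replace the derivatives of the metric in the
curvature identities.\<close>

lemma metric_compat:
  assumes y: "y \<in> U"
  shows "partial a (coef i j) y =
    \<Gamma> 1 a i y * coef 1 j y + \<Gamma> 2 a i y * coef 2 j y + \<Gamma> 1 a j y * coef 1 i y + \<Gamma> 2 a j y * coef 2 i y"
proof -
  have lower: "\<Gamma> 1 a b y * coef 1 c y + \<Gamma> 2 a b y * coef 2 c y
      = (partial a (coef b c) y + partial b (coef a c) y - partial c (coef a b) y) / 2" for a b c
  proof -
    \<comment> \<open>\<open>X1\<close> and \<open>X2\<close> are twice the Christoffel symbols of the first kind.\<close>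
    define X1 where "X1 = partial a (coef b 1) y + partial b (coef a 1) y - partial 1 (coef a b) y"
    define X2 where "X2 = partial a (coef b 2) y + partial b (coef a 2) y - partial 2 (coef a b) y"
    note D = vol_sq[OF y] and nz = vol_pos[OF y]
    have a: "V * (2 * (1 / (2 * V) * p * r + 1 / (2 * V) * q * s)) = p * r + q * s"
      if "V \<noteq> 0" for V p q r s :: real using that by (simp add: field_simps)
    have V: "(vol y)\<^sup>2 \<noteq> 0" using nz by simp
    have "(vol y)\<^sup>2 * (2 * (\<Gamma> 1 a b y * E y + \<Gamma> 2 a b y * F y)) = (E y * H y - (F y)\<^sup>2) * X1"
      unfolding \<Gamma>_eq[OF y] X1_def[symmetric] X2_def[symmetric] a[OF V]
      by (simp add: algebra_simps power2_eq_square)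
    then have 1: "\<Gamma> 1 a b y * E y + \<Gamma> 2 a b y * F y = X1 / 2"
      using nz unfolding D[symmetric] by simp
    have "(vol y)\<^sup>2 * (2 * (\<Gamma> 1 a b y * F y + \<Gamma> 2 a b y * H y)) = (E y * H y - (F y)\<^sup>2) * X2"
      unfolding \<Gamma>_eq[OF y] X1_def[symmetric] X2_def[symmetric] a[OF V]
      by (simp add: algebra_simps power2_eq_square)
    then have 2: "\<Gamma> 1 a b y * F y + \<Gamma> 2 a b y * H y = X2 / 2"
      using nz unfolding D[symmetric] by simp
    from exhaust_2[of c] show ?thesis
      using 1 2 by (auto simp: X1_def X2_def coef_21[OF y])
  qed
  have s: "partial a (coef i j) y = partial a (coef j i) y" for a i j
    by (rule partial_cong[OF U y coef_sym])
  show ?thesis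
    using lower[of a i j] lower[of a j i] s[of j a i] s[of i a j] s[of a i j] by simp
qed

lemma diffs:
  assumes y: "y \<in> U"
  shows "coef i j differentiable (at y)" "vol differentiable (at y)" "\<Gamma> k i j differentiable (at y)"
  using Ck_on_differentiable[OF U coef_smooth y] Ck_on_differentiable[OF U vol_smooth y]
    Ck_on_differentiable[OF U \<Gamma>_smooth y] by auto

lemma riemann_eq:
  "riemann G l i j k y = partial i (\<Gamma> l j k) y - partial j (\<Gamma> l i k) y
     + (\<Gamma> l i 1 y * \<Gamma> 1 j k y - \<Gamma> l j 1 y * \<Gamma> 1 i k y + \<Gamma> l i 2 y * \<Gamma> 2 j k y - \<Gamma> l j 2 y * \<Gamma> 2 i k y)"
  by (simp add: riemann_def \<Gamma>_def sum_2)

text \<open>Expand the second derivatives of a component of the metric by \<open>metric_compat\<close> and let them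
commute. What remains is the skew symmetry of the curvature tensor, with its upper index lowered, in
that index and the last one.\<close>

lemma riemann_antisym:
  assumes y: "y \<in> U"
  shows "riemann G 1 a b i y * coef 1 j y + riemann G 2 a b i y * coef 2 j y
       + riemann G 1 a b j y * coef 1 i y + riemann G 2 a b j y * coef 2 i y = 0"
proof -
  note d = diffs[OF y]
  have second: "partial b (partial a (coef i j)) y =
    partial b (\<Gamma> 1 a i) y * coef 1 j y + \<Gamma> 1 a i y * partial b (coef 1 j) y
    + (partial b (\<Gamma> 2 a i) y * coef 2 j y + \<Gamma> 2 a i y * partial b (coef 2 j) y)
    + (partial b (\<Gamma> 1 a j) y * coef 1 i y + \<Gamma> 1 a j y * partial b (coef 1 i) y)
    + (partial b (\<Gamma> 2 a j) y * coef 2 i y + \<Gamma> 2 a j y * partial b (coef 2 i) y)" for a b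
  proof -
    have "partial b (partial a (coef i j)) y = partial b (\<lambda>y.
        \<Gamma> 1 a i y * coef 1 j y + \<Gamma> 2 a i y * coef 2 j y + \<Gamma> 1 a j y * coef 1 i y + \<Gamma> 2 a j y * coef 2 i y) y"
      by (rule partial_cong[OF U y metric_compat])
    also have "\<dots> = partial b (\<Gamma> 1 a i) y * coef 1 j y + \<Gamma> 1 a i y * partial b (coef 1 j) y
    + (partial b (\<Gamma> 2 a i) y * coef 2 j y + \<Gamma> 2 a i y * partial b (coef 2 j) y)
    + (partial b (\<Gamma> 1 a j) y * coef 1 i y + \<Gamma> 1 a j y * partial b (coef 1 i) y)
    + (partial b (\<Gamma> 2 a j) y * coef 2 i y + \<Gamma> 2 a j y * partial b (coef 2 i) y)"
      using d by (simp add: partial_add partial_mult)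
    finally show ?thesis .
  qed
  have comm: "partial b (partial a (coef i j)) y = partial a (partial b (coef i j)) y"
    by (rule partial_commute[OF U coef_smooth y])
  have s: "coef 2 1 y = coef 1 2 y" by (rule coef_21[OF y])
  have i: "i = 1 \<or> i = 2" and j: "j = 1 \<or> j = 2" using exhaust_2 by auto
  show ?thesis
    using comm unfolding second metric_compat[OF y] riemann_eq
    using i j by (elim disjE) (simp_all add: s algebra_simps)
qed

text \<open>The two skew symmetries express the curvature tensor by the metric and a single number \<open>q\<close>, and
its trace is \<open>- q\<close> times the metric.\<close>

lemma ricci_conformal:
  assumes y: "y \<in> U"
  shows "ricci_coord G y $ i $ j = scalar_coord G y / 2 * coef i j y"
    and "scalar_coord G y / 2 * E y = riemann G 2 2 1 1 y"
proof -
  define V where "V = (vol y)\<^sup>2"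
  have V: "V > 0" using vol_pos[OF y] by (simp add: V_def)
  have VD: "V = E y * H y - F y * F y" using vol_sq[OF y] by (simp add: V_def power2_eq_square)
  note s = coef_21[OF y]
  define a b c d where abcd: "a = riemann G 1 1 2 1 y" "b = riemann G 2 1 2 1 y"
    "c = riemann G 1 1 2 2 y" "d = riemann G 2 1 2 2 y"
  have z: "riemann G l i i k y = 0" for l i k by (simp add: riemann_eq)
  have n: "riemann G l 2 1 k y = - riemann G l 1 2 k y" for l k by (simp add: riemann_eq)
  have 1: "a * E y + b * F y = 0" "c * F y + d * H y = 0" "a * F y + b * H y + c * E y + d * F y = 0"
    using riemann_antisym[OF y, of 1 2 1 1] riemann_antisym[OF y, of 1 2 2 2] riemann_antisym[OF y, of 1 2 1 2]
    unfolding abcd s by linarith+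
  define q where "q = (a * F y + b * H y) / V"
  have q: "q * V = a * F y + b * H y" using V by (simp add: q_def)
  \<comment> \<open>Cramer's rule: the three relations \<open>1\<close> determine the four components up to the factor \<open>q\<close>.\<close>
  have "b * V = E y * (a * F y + b * H y) - F y * (a * E y + b * F y)"
    "a * V = H y * (a * E y + b * F y) - F y * (a * F y + b * H y)"
    "c * V = H y * (a * F y + b * H y + c * E y + d * F y) - H y * (a * F y + b * H y) - F y * (c * F y + d * H y)"
    "d * V = E y * (c * F y + d * H y) - F y * (a * F y + b * H y + c * E y + d * F y) + F y * (a * F y + b * H y)"
    unfolding VD by (simp_all add: algebra_simps)
  then have "b * V = E y * q * V" "a * V = - F y * q * V" "c * V = - H y * q * V" "d * V = F y * q * V"
    unfolding 1 using q by simp_all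
  then have abcdq: "b = E y * q" "a = - F y * q" "c = - H y * q" "d = F y * q"
    using V mult_right_cancel[of V] by blast+
  have ric: "ricci_coord G y $ 1 $ 1 = - q * E y" "ricci_coord G y $ 1 $ 2 = - q * F y"
    "ricci_coord G y $ 2 $ 1 = - q * F y" "ricci_coord G y $ 2 $ 2 = - q * H y"
    by (simp_all add: ricci_coord_def sum_2 z n abcd[symmetric] abcdq)
  have scal: "scalar_coord G y = - 2 * q"
  proof -
    have "scalar_coord G y = (H y * (- q * E y) - F y * (- q * F y) - F y * (- q * F y) + E y * (- q * H y)) / V"
      by (simp add: scalar_coord_def sum_2 ric minv[OF y] V_def[symmetric] add_divide_distrib diff_divide_distrib)
    also have "\<dots> = - 2 * q * V / V" unfolding VD by (simp add: algebra_simps)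
    finally show ?thesis using V by simp
  qed
  show "ricci_coord G y $ i $ j = scalar_coord G y / 2 * coef i j y"
    using exhaust_2[of i] exhaust_2[of j] by (auto simp: scal ric s)
  show "scalar_coord G y / 2 * E y = riemann G 2 2 1 1 y"
    by (simp add: scal n abcd[symmetric] abcdq)
qed

lemma partial_vol:
  assumes y: "y \<in> U"
  shows "partial a vol y = vol y * (\<Gamma> 1 a 1 y + \<Gamma> 2 a 2 y)"
proof -
  note d = diffs[OF y]
  have dD: "(\<lambda>y. E y * H y - (F y)\<^sup>2) differentiable (at y)"
    by (rule Ck_on_differentiable[OF U D_smooth y])
  have "partial a (\<lambda>y. E y * H y - (F y)\<^sup>2) y
      = partial a E y * H y + E y * partial a H y - (partial a F y * F y + F y * partial a F y)"
    using d unfolding power2_eq_square by (simp add: partial_diff partial_mult)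
  also have "\<dots> = 2 * (E y * H y - (F y)\<^sup>2) * (\<Gamma> 1 a 1 y + \<Gamma> 2 a 2 y)"
    unfolding metric_compat[OF y] by (simp add: coef_21[OF y] algebra_simps power2_eq_square)
  finally have "partial a vol y = (2 * (vol y)\<^sup>2 * (\<Gamma> 1 a 1 y + \<Gamma> 2 a 2 y)) / (2 * vol y)"
    unfolding vol_def[abs_def] partial_sqrt[OF dD D_pos[OF y]]
    using D_pos[OF y] by simp
  then show ?thesis using vol_pos[OF y] by (simp add: power2_eq_square)
qed

text \<open>The components of the metric divided by the area density; a conformal factor cancels, so they
represent the conformal class.\<close>

definition "cf i j y = coef i j y / vol y"

lemma cf_smooth: "Ck_on k U (cf i j)"
  unfolding cf_def[abs_def] using vol_pos
  by (intro Ck_on_divide coef_smooth vol_smooth thickU) fastforce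

lemma partial_cf:
  assumes y: "y \<in> U"
  shows "partial a (cf i j) y = (partial a (coef i j) y - coef i j y * (\<Gamma> 1 a 1 y + \<Gamma> 2 a 2 y)) / vol y"
proof -
  have nz: "vol y \<noteq> 0" using vol_pos[OF y] by simp
  show ?thesis unfolding cf_def[abs_def] partial_divide[OF diffs(1,2)[OF y] nz] partial_vol[OF y]
    using nz by (simp add: field_simps power2_eq_square)
qed

text \<open>By \<open>metric_compat\<close> and \<open>partial_vol\<close>, the divergence of the rows of \<open>sqrt (det g)\<close> times the inverse
metric is minus \<open>sqrt (det g)\<close> times the trace of the Christoffel symbols, the first-order part of the
Laplacian.\<close>

lemma laplacian_divergence:
  assumes y: "y \<in> U" and u: "Ck_on 2 U u"
  shows "vol y * laplacian_coord G u y = div_op (cf 1 1) (cf 1 2) (cf 2 2) u y"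
proof -
  have u': "Ck_on (Suc (Suc 0)) U u" using u by (simp add: numeral_2_eq_2)
  have du: "partial i u differentiable (at y)" for i
    by (rule Ck_on_differentiable[OF U Ck_on_partial[OF U u'] y])
  have dc: "cf i j differentiable (at y)" for i j
    by (rule Ck_on_differentiable[OF U cf_smooth y])
  have dm: "(\<lambda>z. cf i j z * partial k u z) differentiable (at y)" for i j k
    using du dc by (intro differentiable_mult) auto
  define v where "v = vol y"
  have v: "v > 0" using vol_pos[OF y] by (simp add: v_def)
  define X where "X = H y * (partial 1 (partial 1 u) y - \<Gamma> 1 1 1 y * partial 1 u y - \<Gamma> 2 1 1 y * partial 2 u y)
    - 2 * F y * (partial 1 (partial 2 u) y - \<Gamma> 1 1 2 y * partial 1 u y - \<Gamma> 2 1 2 y * partial 2 u y)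
    + E y * (partial 2 (partial 2 u) y - \<Gamma> 1 2 2 y * partial 1 u y - \<Gamma> 2 2 2 y * partial 2 u y)"
  have comm: "partial 2 (partial 1 u) y = partial 1 (partial 2 u) y"
    by (rule partial_commute[OF U u y])
  have "v * laplacian_coord G u y = v * (X / v\<^sup>2)"
    unfolding laplacian_coord_def sum_2 \<Gamma>_def[symmetric] minv[OF y] comm \<Gamma>_sym[OF y, of _ 2 1] v_def[symmetric] X_def
    by (simp add: add_divide_distrib diff_divide_distrib algebra_simps)
  also have "\<dots> = X / v" using v by (simp add: power2_eq_square)
  finally have L: "v * laplacian_coord G u y = X / v" .
  have "div_op (cf 1 1) (cf 1 2) (cf 2 2) u y =
     partial 1 (cf 2 2) y * partial 1 u y + cf 2 2 y * partial 1 (partial 1 u) y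
     - (partial 1 (cf 1 2) y * partial 2 u y + cf 1 2 y * partial 1 (partial 2 u) y)
     + (partial 2 (cf 1 1) y * partial 2 u y + cf 1 1 y * partial 2 (partial 2 u) y
     - (partial 2 (cf 1 2) y * partial 1 u y + cf 1 2 y * partial 2 (partial 1 u) y))"
    unfolding div_op_def using du dc dm by (simp add: partial_diff partial_mult)
  also have "\<dots> = X / v"
    unfolding partial_cf[OF y] metric_compat[OF y] comm cf_def v_def[symmetric] X_def
    using v by (simp add: divide_simps coef_21[OF y] \<Gamma>_sym[OF y, of _ 2 1]) (simp add: algebra_simps)
  finally show ?thesis using L by (simp add: v_def)
qed

text \<open>\<open>R / 2\<close> times \<open>E\<close> is the component \<open>(1, 1)\<close> of the Ricci tensor, that is one component of the curvature
tensor. When the product rule is applied on the left, the derivatives of \<open>vol / E\<close> produce exactly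
the terms of that component which are quadratic in Christoffel symbols.\<close>

lemma liouville:
  assumes y: "y \<in> U"
  shows "partial 2 (\<lambda>z. vol z / E z * \<Gamma> 2 1 1 z) y - partial 1 (\<lambda>z. vol z / E z * \<Gamma> 2 1 2 z) y
       = vol y * scalar_coord G y / 2"
proof -
  note d = diffs[OF y]
  have e: "E y \<noteq> 0" using E_pos[OF y] by simp
  have dq: "(\<lambda>z. vol z / E z) differentiable (at y)"
    using d e by (intro differentiable_divide) auto
  define v x where "v = vol y" and "x = E y"
  have "partial 2 (\<lambda>z. vol z / E z * \<Gamma> 2 1 1 z) y - partial 1 (\<lambda>z. vol z / E z * \<Gamma> 2 1 2 z) y
     = (partial 2 vol y * x - v * partial 2 E y) / x\<^sup>2 * \<Gamma> 2 1 1 y + v / x * partial 2 (\<Gamma> 2 1 1) y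
     - ((partial 1 vol y * x - v * partial 1 E y) / x\<^sup>2 * \<Gamma> 2 1 2 y + v / x * partial 1 (\<Gamma> 2 1 2) y)"
    by (simp only: partial_mult[OF dq d(3)] partial_divide[OF d(2) d(1) e] v_def x_def)
  also have "\<dots> = v / x * riemann G 2 2 1 1 y"
  proof -
    have "partial 1 (\<Gamma> 2 2 1) y = partial 1 (\<Gamma> 2 1 2) y"
      by (rule partial_cong[OF U y]) (rule \<Gamma>_sym)
    then show ?thesis
      unfolding partial_vol[OF y] metric_compat[OF y] riemann_eq v_def[symmetric] coef_21[OF y] \<Gamma>_sym[OF y, of _ 2 1] x_def[symmetric]
      using e[folded x_def] by (simp add: divide_simps power2_eq_square) (simp add: algebra_simps)
  qed
  also have "\<dots> = v * scalar_coord G y / 2"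
    unfolding ricci_conformal(2)[OF y, symmetric] using e by (simp add: x_def)
  finally show ?thesis by (simp add: v_def)
qed

text \<open>Insert \<open>E = vol * e\<close> and so on in \<open>liouville\<close>: derivatives of \<open>vol\<close> enter the two fluxes only through
\<open>\<nabla> (ln vol)\<close>, and they combine to the flux in \<open>div_op\<close>.\<close>

lemma scalar_conformal:
  assumes y: "y \<in> U"
  shows "vol y * scalar_coord G y
    = conf_curv (cf 1 1) (cf 1 2) (cf 2 2) y - div_op (cf 1 1) (cf 1 2) (cf 2 2) (\<lambda>z. ln (vol z)) y"
proof -
  define l where "l z = ln (vol z)" for z
  define A where "A z = (2 * cf 1 1 z * partial 1 (cf 1 2) z - cf 1 2 z * partial 1 (cf 1 1) z - cf 1 1 z * partial 2 (cf 1 1) z) / cf 1 1 z" for z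
  define B where "B z = (cf 1 1 z * partial 1 (cf 2 2) z - cf 1 2 z * partial 2 (cf 1 1) z) / cf 1 1 z" for z
  define C1 where "C1 z = cf 2 2 z * partial 1 l z - cf 1 2 z * partial 2 l z" for z
  define C2 where "C2 z = cf 1 1 z * partial 2 l z - cf 1 2 z * partial 1 l z" for z
  have l: "Ck_on k U l" for k
    unfolding l_def[abs_def] by (intro Ck_on_ln thickU vol_smooth vol_pos)
  have cfnz: "cf 1 1 z \<noteq> 0" if "z \<in> U" for z using E_pos[OF that] vol_pos[OF that] by (simp add: cf_def)
  have pc: "Ck_on k U (partial a (cf i j))" for k a i j by (rule Ck_on_partial[OF U cf_smooth])
  have pl: "Ck_on k U (partial a l)" for k a by (rule Ck_on_partial[OF U l])
  have smooth': "Ck_on (Suc 0) U A" "Ck_on (Suc 0) U B" "Ck_on (Suc 0) U C1" "Ck_on (Suc 0) U C2"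
    unfolding A_def[abs_def] B_def[abs_def] C1_def[abs_def] C2_def[abs_def]
    by (intro Ck_on_divide Ck_on_diff Ck_on_mult Ck_on_const pc pl cf_smooth thickU; simp add: cfnz)+
  note d = smooth'[THEN Ck_on_differentiable[OF U _ y]]
  have dsub: "A differentiable (at y)" "B differentiable (at y)" "C1 differentiable (at y)" "C2 differentiable (at y)"
    using d by auto
  have eqs: "vol z / E z * \<Gamma> 2 1 1 z = 1/2 * A z - 1/2 * C2 z"
    "vol z / E z * \<Gamma> 2 1 2 z = 1/2 * B z + 1/2 * C1 z" if z: "z \<in> U" for z
  proof -
    define v e f h where "v = vol z" and "e = cf 1 1 z" and "f = cf 1 2 z" and "h = cf 2 2 z"
    have v: "v > 0" and e: "e \<noteq> 0" using vol_pos[OF z] cfnz[OF z] by (auto simp: v_def e_def)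
    have g: "E z = v * e" "F z = v * f" "H z = v * h" using v by (auto simp: v_def e_def f_def h_def cf_def)
    have vd: "cf i j differentiable (at z)" for i j by (rule Ck_on_differentiable[OF U cf_smooth z])
    have pg: "partial a (coef i j) z = partial a vol z * cf i j z + v * partial a (cf i j) z" for a i j
    proof -
      have "partial a (coef i j) z = partial a (\<lambda>z. vol z * cf i j z) z"
        using vol_pos by (intro partial_cong[OF U z]) (force simp: cf_def)
      then show ?thesis using vd diffs(2)[OF z] by (simp add: partial_mult v_def)
    qed
    have pl: "partial a l z = partial a vol z / v" for a
      unfolding l_def[abs_def] v_def by (rule partial_ln[OF diffs(2)[OF z] vol_pos[OF z]])
    show "vol z / E z * \<Gamma> 2 1 1 z = 1/2 * A z - 1/2 * C2 z"
      unfolding \<Gamma>_eq(2)[OF z] g pg A_def C2_def pl v_def[symmetric] e_def[symmetric] f_def[symmetric]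
      using v e by (simp add: divide_simps power2_eq_square) (simp add: algebra_simps)
    show "vol z / E z * \<Gamma> 2 1 2 z = 1/2 * B z + 1/2 * C1 z"
      unfolding \<Gamma>_eq(2)[OF z] partial_coef_sym[OF z]
      unfolding g pg B_def C1_def pl v_def[symmetric] e_def[symmetric] f_def[symmetric] h_def[symmetric]
      using v e by (simp add: divide_simps power2_eq_square) (simp add: algebra_simps)
  qed
  have "partial 2 (\<lambda>z. vol z / E z * \<Gamma> 2 1 1 z) y = 1/2 * partial 2 A y - 1/2 * partial 2 C2 y"
    by (subst partial_cong[OF U y eqs(1)]) (use dsub in \<open>simp_all add: partial_diff partial_cmult del: mult_1 times_divide_eq_left\<close>)
  moreover have "partial 1 (\<lambda>z. vol z / E z * \<Gamma> 2 1 2 z) y = 1/2 * partial 1 B y + 1/2 * partial 1 C1 y"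
    by (subst partial_cong[OF U y eqs(2)]) (use dsub in \<open>simp_all add: partial_add partial_cmult del: mult_1 times_divide_eq_left\<close>)
  moreover have "conf_curv (cf 1 1) (cf 1 2) (cf 2 2) y = partial 2 A y - partial 1 B y"
    by (simp add: conf_curv_def A_def[abs_def] B_def[abs_def])
  moreover have "div_op (cf 1 1) (cf 1 2) (cf 2 2) l y = partial 1 C1 y + partial 2 C2 y"
    by (simp add: div_op_def C1_def[abs_def] C2_def[abs_def])
  ultimately show ?thesis using liouville[OF y] by (simp add: l_def[abs_def])
qed

end

section \<open>Minima and integrals in the plane\<close>

lemma frechet_eq_partial_2:
  fixes f :: "real^2 \<Rightarrow> real"
  assumes "f differentiable (at y)"
  shows "frechet_derivative f (at y) v = v$1 * partial 1 f y + v$2 * partial 2 f y"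
proof -
  have l: "linear (frechet_derivative f (at y))"
    using assms by (rule linear_frechet_derivative)
  have v: "v = v$1 *\<^sub>R axis 1 1 + v$2 *\<^sub>R axis 2 1"
    by (simp add: vec_eq_iff forall_2 axis_def)
  show ?thesis
    by (subst v, subst linear_add[OF l]) (simp add: linear_scale[OF l] partial_def)
qed

text \<open>The second derivative test in one variable, on the line through \<open>y\<close> in direction \<open>v\<close>.\<close>

lemma local_min_second_derivative:
  fixes u :: "real^2 \<Rightarrow> real" and v :: "real^2"
  assumes U: "open U" and y: "y \<in> U" and u: "Ck_on 2 U u" and min: "\<And>z. z \<in> U \<Longrightarrow> u y \<le> u z"
  shows "partial i u y = 0"
    and "0 \<le> (v$1)\<^sup>2 * partial 1 (partial 1 u) y + 2 * v$1 * v$2 * partial 1 (partial 2 u) y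
           + (v$2)\<^sup>2 * partial 2 (partial 2 u) y"
proof -
  have u': "Ck_on (Suc (Suc 0)) U u" using u by (simp add: numeral_2_eq_2)
  note du = Ck_on_differentiable[OF U u']
  have dpu: "partial i u differentiable (at z)" if "z \<in> U" for i z
    by (rule Ck_on_differentiable[OF U Ck_on_partial[OF U u'] that])
  show p0: "partial i u y = 0" for i
    using differential_zero_maxmin[OF y U Ck_on_open_deriv[OF U u' y]] min
    by (simp add: partial_def)
  define Q where "Q = (v$1)\<^sup>2 * partial 1 (partial 1 u) y + 2 * v$1 * v$2 * partial 1 (partial 2 u) y
           + (v$2)\<^sup>2 * partial 2 (partial 2 u) y"
  show "0 \<le> Q"
  proof (rule ccontr)
    assume "\<not> 0 \<le> Q"
    obtain r where r: "r > 0" "ball y r \<subseteq> U" using U y open_contains_ball by blast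
    define R where "R = r / (norm v + 1)"
    have R: "R > 0" using r by (simp add: R_def add_nonneg_pos)
    have inU: "y + s *\<^sub>R v \<in> U" if "0 \<le> s" "s < R" for s
    proof -
      have "s * norm v \<le> s * (norm v + 1)" using that by (simp add: mult_left_mono)
      also have "\<dots> < r" using that by (simp add: R_def less_divide_eq add_nonneg_pos)
      finally show ?thesis using r that by (intro subsetD[OF r(2)]) (simp add: dist_norm)
    qed
    define p where "p s = v$1 * partial 1 u (y + s *\<^sub>R v) + v$2 * partial 2 u (y + s *\<^sub>R v)" for s
    have line: "((\<lambda>s. y + s *\<^sub>R v) has_derivative (\<lambda>h. h *\<^sub>R v)) (at s)" for s
      by (auto intro!: derivative_eq_intros)
    have chain: "((\<lambda>s. w (y + s *\<^sub>R v)) has_real_derivative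
        (v$1 * partial 1 w (y + s *\<^sub>R v) + v$2 * partial 2 w (y + s *\<^sub>R v))) (at s)"
      if "w differentiable (at (y + s *\<^sub>R v))" for w s
      unfolding has_field_derivative_def
      by (rule has_derivative_eq_rhs[OF has_derivative_compose[OF line has_derivative_frechet[OF that]]])
        (simp add: fun_eq_iff frechet_eq_partial_2[OF that] algebra_simps)
    have d1: "((\<lambda>s. u (y + s *\<^sub>R v)) has_real_derivative p s) (at s)" if "0 \<le> s" "s < R" for s
      unfolding p_def using chain[OF du[OF inU[OF that]]] .
    have "(p has_real_derivative Q) (at 0)"
      unfolding p_def[abs_def] Q_def
      by (rule DERIV_cong[OF DERIV_add[OF DERIV_cmult[OF chain] DERIV_cmult[OF chain]]])
        (use dpu[OF y] partial_commute[OF U u y, of 2 1] in \<open>simp_all add: algebra_simps power2_eq_square\<close>)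
    moreover have "Q < 0" using \<open>\<not> 0 \<le> Q\<close> by simp
    ultimately have "\<exists>d>0. \<forall>h>0. h < d \<longrightarrow> p (0 + h) < p 0" by (rule DERIV_neg_dec_right)
    then have "\<exists>d>0. \<forall>h>0. h < d \<longrightarrow> p h < p 0" by simp
    then obtain d where d: "d > 0" "\<And>h. 0 < h \<Longrightarrow> h < d \<Longrightarrow> p h < p 0" by blast
    define h where "h = min d R / 2"
    have h: "0 < h" "h < d" "h < R" using d(1) R by (auto simp: h_def)
    obtain s where s: "0 < s" "s < h" "u (y + h *\<^sub>R v) - u (y + 0 *\<^sub>R v) = (h - 0) * p s"
      using MVT2[OF h(1), of "\<lambda>s. u (y + s *\<^sub>R v)" p] d1 h by auto
    have "p 0 = 0" by (simp add: p_def p0)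
    then have "h * p s < 0" using d(2)[of s] s h by (simp add: mult_pos_neg)
    then have "u (y + h *\<^sub>R v) < u y" using s by simp
    with min[OF inU[of h]] h show False by simp
  qed
qed

lemma div_op_expand:
  assumes U: "open U" and y: "y \<in> U" and u: "Ck_on 2 U u"
    and c: "Ck_on (Suc 0) U e" "Ck_on (Suc 0) U f" "Ck_on (Suc 0) U h"
  shows "div_op e f h u y = h y * partial 1 (partial 1 u) y - 2 * f y * partial 1 (partial 2 u) y
     + e y * partial 2 (partial 2 u) y
     + (partial 1 h y - partial 2 f y) * partial 1 u y + (partial 2 e y - partial 1 f y) * partial 2 u y"
proof -
  have u': "Ck_on (Suc (Suc 0)) U u" using u by (simp add: numeral_2_eq_2)
  have dpu: "partial i u differentiable (at y)" for i
    by (rule Ck_on_differentiable[OF U Ck_on_partial[OF U u'] y])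
  note d = c[THEN Ck_on_differentiable[OF U _ y]]
  have dm: "(\<lambda>z. w z * partial k u z) differentiable (at y)" if "w differentiable (at y)" for w k
    using that dpu by (intro differentiable_mult) auto
  show ?thesis
    unfolding div_op_def using d dpu dm partial_commute[OF U u y, of 2 1]
    by (simp add: partial_diff partial_mult) (simp add: algebra_simps)
qed

lemma div_op_local_min:
  assumes U: "open U" and y: "y \<in> U" and u: "Ck_on 2 U u" and min: "\<And>z. z \<in> U \<Longrightarrow> u y \<le> u z"
    and c: "Ck_on (Suc 0) U e" "Ck_on (Suc 0) U f" "Ck_on (Suc 0) U h"
    and pos: "e y > 0" "e y * h y - (f y)\<^sup>2 \<ge> 0"
  shows "div_op e f h u y \<ge> 0"
proof -
  note p0 = local_min_second_derivative(1)[OF U y u min] and Q = local_min_second_derivative(2)[OF U y u min]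
  define a b d where "a = partial 1 (partial 1 u) y" and "b = partial 1 (partial 2 u) y" and "d = partial 2 (partial 2 u) y"
  have "a \<ge> 0" using Q[of "\<chi> i. if i = 1 then 1 else 0"] by (simp add: a_def)
  moreover have "0 \<le> (f y)\<^sup>2 * a - 2 * f y * e y * b + (e y)\<^sup>2 * d"
    using Q[of "\<chi> i. if i = 1 then f y else - e y"] by (simp add: a_def b_def d_def)
  moreover have "e y * (h y * a - 2 * f y * b + e y * d)
      = (e y * h y - (f y)\<^sup>2) * a + ((f y)\<^sup>2 * a - 2 * f y * e y * b + (e y)\<^sup>2 * d)"
    by (simp add: algebra_simps power2_eq_square)
  ultimately have "e y * (h y * a - 2 * f y * b + e y * d) \<ge> 0" using pos(2) by simp
  then have "h y * a - 2 * f y * b + e y * d \<ge> 0" using pos(1) by (simp add: zero_le_mult_iff)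
  then show ?thesis unfolding div_op_expand[OF U y u c] by (simp add: p0 a_def b_def d_def)
qed

lemma Ck_on_Un:
  assumes "open V" "open W" "Ck_on k V f" "Ck_on k W f" shows "Ck_on k (V \<union> W) f"
  using assms(3,4)
proof (induction k arbitrary: f)
  case 0 then show ?case using assms by (simp add: Ck_on.simps continuous_on_open_Un)
next
  case (Suc k)
  have "Ck_on k (V \<union> W) (\<lambda>y. frechet_derivative f (at y) v)" for v
    using Suc assms Ck_on_open_deriv_Ck by blast
  moreover have "(f has_derivative frechet_derivative f (at y)) (at y within V \<union> W)" if "y \<in> V \<union> W" for y
    using that Ck_on_open_deriv[OF assms(1) Suc.prems(1)] Ck_on_open_deriv[OF assms(2) Suc.prems(2)]
    by (auto intro: has_derivative_at_withinI)
  ultimately show ?case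
    using assms by (intro Ck_on_SucI[OF thick_open]) auto
qed

lemma Ck_on_zero_extension:
  assumes U: "open U" and f: "Ck_on k U f" and K: "compact K" "K \<subseteq> U"
    and z: "\<And>y. y \<in> U \<Longrightarrow> y \<notin> K \<Longrightarrow> f y = 0"
  shows "Ck_on k UNIV (\<lambda>y. if y \<in> U then f y else 0)" (is "Ck_on k UNIV ?F")
proof -
  have K': "open (- K)" using K(1) compact_imp_closed by blast
  have "Ck_on k U ?F" using f Ck_on_cong[of U ?F f k] by simp
  moreover have "Ck_on k (- K) ?F"
    using Ck_on_const[OF thick_open[OF K'], of k 0] Ck_on_cong[of "- K" ?F "\<lambda>_. 0" k] z by auto
  ultimately have "Ck_on k (U \<union> - K) ?F" using Ck_on_Un[OF U K'] by blast
  moreover have "U \<union> - K = UNIV" using K(2) by auto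
  ultimately show ?thesis by simp
qed

lemma absolutely_integrable_compact_support:
  fixes f :: "real^2 \<Rightarrow> real"
  assumes U: "open U" and f: "continuous_on U f" and K: "compact K" "K \<subseteq> U"
    and z: "\<And>y. y \<in> U \<Longrightarrow> y \<notin> K \<Longrightarrow> f y = 0"
  shows "f absolutely_integrable_on U"
proof -
  have "Ck_on 0 U f" using f by (simp add: Ck_on.simps)
  from Ck_on_zero_extension[OF U this K z]
  have c: "continuous_on UNIV (\<lambda>y. if y \<in> U then f y else 0)" (is "continuous_on UNIV ?F")
    by (simp add: Ck_on.simps)
  obtain a where a: "K \<subseteq> cbox (-a) a" using bounded_subset_cbox_symmetric[OF compact_imp_bounded[OF K(1)]] .
  have "?F absolutely_integrable_on cbox (-a) a"
    using c continuous_on_subset by (intro absolutely_integrable_continuous) blast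
  then have "(\<lambda>x. if x \<in> cbox (-a) a then ?F x else 0) absolutely_integrable_on UNIV"
    by (simp only: absolutely_integrable_restrict_UNIV)
  moreover have "(\<lambda>x. if x \<in> cbox (-a) a then ?F x else 0) = ?F"
    using a z by fastforce
  ultimately have "?F absolutely_integrable_on UNIV" by simp
  then show ?thesis by (simp only: absolutely_integrable_restrict_UNIV)
qed

text \<open>The integral of a translate of \<open>F\<close> is independent of the translation; differentiate it under the
integral sign.\<close>

lemma has_integral_partial_compact_support:
  fixes F :: "real^2 \<Rightarrow> real"
  assumes F: "Ck_on (Suc 0) UNIV F" and K: "compact K" and z: "\<And>y. y \<notin> K \<Longrightarrow> F y = 0"
  shows "(partial i F has_integral 0) UNIV"
proof -
  define v :: "real^2" where "v = axis i 1"
  have v: "norm v = 1" by (simp add: v_def)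
  note dF = Ck_on_open_deriv[OF open_UNIV F UNIV_I]
  have cF: "continuous_on UNIV F" by (rule Ck_on_imp_cont[OF F])
  have cP: "continuous_on UNIV (partial i F)"
    by (rule Ck_on_imp_cont[OF Ck_on_partial[OF open_UNIV F]])
  obtain r where r: "K \<subseteq> ball 0 r" using bounded_subset_ballD[OF compact_imp_bounded[OF K], of 0] by blast
  obtain a :: "real^2" where a: "ball 0 (r + 1) \<subseteq> cbox (-a) a"
    using bounded_subset_cbox_symmetric[OF bounded_ball] .
  have Ka: "K \<subseteq> cbox (-a) a" using r a subset_ball[of r "r + 1" 0] by auto
  have pz: "partial i F y = 0" if "y \<notin> K" for y
  proof -
    have "open (- K)" using K compact_imp_closed by blast
    then have "partial i F y = partial i (\<lambda>z. 0) y" using that z by (intro partial_cong[of "- K"]) auto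
    then show ?thesis by simp
  qed
  define I where "I = integral (cbox (-a) a) F"
  have FI: "(F has_integral I) (cbox (-a) a)"
    unfolding I_def using cF continuous_on_subset by (intro integrable_integral integrable_continuous) blast
  have FU: "(F has_integral I) UNIV"
    by (rule has_integral_on_superset[OF FI]) (use z Ka in auto)
  have shift: "((\<lambda>x. F (x + s *\<^sub>R v)) has_integral I) (cbox (-a) a)" if s: "\<bar>s\<bar> \<le> 1" for s
  proof -
    have sub: "K \<subseteq> cbox (-a + s *\<^sub>R v) (a + s *\<^sub>R v)"
    proof
      fix x assume "x \<in> K"
      then have "norm x < r" using r by auto
      then have "norm (x - s *\<^sub>R v) < r + 1"
        using norm_triangle_ineq4[of x "s *\<^sub>R v"] s v by simp
      then have "x - s *\<^sub>R v \<in> cbox (-a) a" using a by (auto simp: dist_norm)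
      then show "x \<in> cbox (-a + s *\<^sub>R v) (a + s *\<^sub>R v)"
        by (auto simp: mem_box inner_diff_left inner_add_left algebra_simps)
    qed
    have "(F has_integral integral (cbox (-a + s *\<^sub>R v) (a + s *\<^sub>R v)) F) (cbox (-a + s *\<^sub>R v) (a + s *\<^sub>R v))"
      using cF continuous_on_subset by (intro integrable_integral integrable_continuous) blast
    moreover from this have "(F has_integral integral (cbox (-a + s *\<^sub>R v) (a + s *\<^sub>R v)) F) UNIV"
      by (rule has_integral_on_superset) (use sub z in auto)
    then have "integral (cbox (-a + s *\<^sub>R v) (a + s *\<^sub>R v)) F = I" using FU has_integral_unique by blast
    ultimately have "(F has_integral I) (cbox (-a + s *\<^sub>R v) (a + s *\<^sub>R v))" by simp
    then show ?thesis
      using has_integral_shift_cbox_iff[of F "s *\<^sub>R v" I "-a" a] by (simp add: o_def add.commute)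
  qed
  have line: "((\<lambda>s. x + s *\<^sub>R v) has_derivative (\<lambda>h. h *\<^sub>R v)) (at s within S)" for x s S
    by (auto intro!: derivative_eq_intros)
  \<comment> \<open>For \<open>\<bar>s\<bar> \<le> 1\<close> the support of the translate stays in the box, where the Leibniz rule applies.\<close>
  have "((\<lambda>s. integral (cbox (-a) a) (\<lambda>x. F (x + s *\<^sub>R v))) has_field_derivative
      integral (cbox (-a) a) (\<lambda>x. partial i F (x + 0 *\<^sub>R v))) (at 0 within {-1..1})"
  proof (rule leibniz_rule_field_derivative)
    fix s :: real and x assume "s \<in> {-1..1}"
    show "((\<lambda>s. F (x + s *\<^sub>R v)) has_field_derivative partial i F (x + s *\<^sub>R v)) (at s within {-1..1})"
      unfolding has_field_derivative_def
      by (rule has_derivative_eq_rhs[OF has_derivative_compose[OF line dF]])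
        (simp add: fun_eq_iff partial_def v_def linear_scale[OF has_derivative_linear[OF dF]])
    show "(\<lambda>x. F (x + s *\<^sub>R v)) integrable_on cbox (-a) a"
      using shift[of s] \<open>s \<in> {-1..1}\<close> has_integral_integrable by fastforce
  next
    show "continuous_on ({-1..1} \<times> cbox (-a) a) (\<lambda>(s, x). partial i F (x + s *\<^sub>R v))"
      unfolding case_prod_beta
      by (rule continuous_on_compose2[OF cP]) (auto intro!: continuous_intros)
  qed auto
  then have d: "((\<lambda>s. integral (cbox (-a) a) (\<lambda>x. F (x + s *\<^sub>R v))) has_field_derivative
      integral (cbox (-a) a) (partial i F)) (at 0)"
    by (simp add: at_within_interior[of 0 "{-1..1::real}"])
  have "((\<lambda>s. I) has_field_derivative integral (cbox (-a) a) (partial i F)) (at 0)"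
    by (rule has_field_derivative_transform_within_open[OF d, of "{-1<..<1}"])
      (use shift in \<open>auto intro!: integral_unique\<close>)
  then have "integral (cbox (-a) a) (partial i F) = 0"
    using DERIV_unique DERIV_const by blast
  moreover have "(partial i F has_integral integral (cbox (-a) a) (partial i F)) (cbox (-a) a)"
    using cP continuous_on_subset by (intro integrable_integral integrable_continuous) blast
  ultimately have "(partial i F has_integral 0) (cbox (-a) a)" by simp
  then show ?thesis by (rule has_integral_on_superset) (use pz Ka in auto)
qed

lemma has_integral_partial_open:
  fixes F :: "real^2 \<Rightarrow> real"
  assumes U: "open U" and F: "Ck_on (Suc 0) U F" and K: "compact K" "K \<subseteq> U"
    and z: "\<And>y. y \<in> U \<Longrightarrow> y \<notin> K \<Longrightarrow> F y = 0"
  shows "(partial i F has_integral 0) U"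
proof -
  let ?F = "\<lambda>y. if y \<in> U then F y else 0"
  have "(partial i ?F has_integral 0) UNIV"
    by (rule has_integral_partial_compact_support[OF Ck_on_zero_extension[OF U F K z] K(1)]) (use z in auto)
  moreover have "partial i ?F y = (if y \<in> U then partial i F y else 0)" for y
  proof (cases "y \<in> U")
    case True
    then show ?thesis by (auto intro: partial_cong[OF U])
  next
    case False
    have "open (- K)" using K compact_imp_closed by blast
    then have "partial i ?F y = partial i (\<lambda>z. 0) y" using False z K(2) by (intro partial_cong[of "- K"]) auto
    then show ?thesis using False by simp
  qed
  ultimately have "((\<lambda>y. if y \<in> U then partial i F y else 0) has_integral 0) UNIV" by (simp cong: has_integral_cong)
  then show ?thesis by (simp only: has_integral_restrict_UNIV)
qed

lemma integral_pos_continuous: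
  fixes f :: "real^2 \<Rightarrow> real"
  assumes U: "open U" and f: "continuous_on U f" and i: "f integrable_on U"
    and nn: "\<And>y. y \<in> U \<Longrightarrow> f y \<ge> 0" and y: "y \<in> U" "f y > 0"
  shows "integral U f > 0"
proof -
  obtain a b where ab: "cbox a b \<subseteq> U" "y \<in> box a b"
    using open_contains_cbox[OF U y(1)] by metis
  have c: "continuous_on (cbox a b) f" using f ab continuous_on_subset by blast
  have ib: "f integrable_on cbox a b" using c by (rule integrable_continuous)
  have le: "integral (cbox a b) f \<le> integral U f"
    using ab ib i nn by (intro integral_subset_le) auto
  have "integral (cbox a b) f \<noteq> 0"
  proof
    assume "integral (cbox a b) f = 0"
    then have "(f has_integral 0) (cbox a b)" using ib integrable_integral by metis
    then have "f y = 0"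
      using has_integral_0_cbox_imp_0[OF c] nn ab box_subset_cbox by blast
    then show False using y by simp
  qed
  moreover have "integral (cbox a b) f \<ge> 0" using ib nn ab by (intro integral_nonneg) auto
  ultimately show ?thesis using le by simp
qed

lemma change_of_variables_real:
  fixes f :: "real^2 \<Rightarrow> real"
  assumes "open S" "\<And>x. x \<in> S \<Longrightarrow> (g has_derivative g' x) (at x)" "inj_on g S"
    "(\<lambda>x. \<bar>det (matrix (g' x))\<bar> * f (g x)) absolutely_integrable_on S"
  shows "integral (g ` S) f = integral S (\<lambda>x. \<bar>det (matrix (g' x))\<bar> * f (g x))"
proof -
  have S: "S \<in> sets lebesgue" using assms(1) by (simp add: borel_open)
  have "integral (g ` S) (\<lambda>x. vec (f x) :: real^1)
      = integral S (\<lambda>x. \<bar>det (matrix (g' x))\<bar> *\<^sub>R (vec (f (g x)) :: real^1))"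
  proof (rule integral_change_of_variables[OF S _ assms(3)])
    show "(\<lambda>x. vec (f x) :: real^1) absolutely_integrable_on g ` S \<or>
      (\<lambda>x. \<bar>det (matrix (g' x))\<bar> *\<^sub>R (vec (f (g x)) :: real^1)) absolutely_integrable_on S"
      using assms(4) by (simp add: absolutely_integrable_on_1_iff)
  qed (use assms in \<open>auto intro: has_derivative_at_withinI\<close>)
  then show ?thesis by (simp add: integral_on_1_eq vec_eq_iff)
qed

lemma C1_square_pos_part: "Ck_on (Suc 0) UNIV (\<lambda>x::real. (max 0 x)\<^sup>2)"
proof (rule Ck_on_SucI[OF thick_open[OF open_UNIV]])
  fix x :: real
  have "((\<lambda>x. (max 0 x)\<^sup>2) has_real_derivative 2 * max 0 x) (at x)"
  proof -
    consider "x > 0" | "x < 0" | "x = 0" by linarith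
    then show ?thesis
    proof cases
      case 1
      have "((\<lambda>x. x\<^sup>2) has_real_derivative 2 * max 0 x) (at x)"
        using 1 by (auto intro!: derivative_eq_intros)
      then show ?thesis
        by (rule has_field_derivative_transform_within_open[of _ _ _ "{0<..}"]) (use 1 in auto)
    next
      case 2
      have "((\<lambda>x. 0) has_real_derivative 2 * max 0 x) (at x)" using 2 by auto
      then show ?thesis
        by (rule has_field_derivative_transform_within_open[of _ _ _ "{..<0}"]) (use 2 in auto)
    next
      case 3
      have "((\<lambda>h. (max 0 h)\<^sup>2 / h) \<longlongrightarrow> 0) (at (0::real))"
      proof (rule Lim_null_comparison)
        show "\<forall>\<^sub>F h in at 0. norm ((max 0 h)\<^sup>2 / h) \<le> \<bar>h::real\<bar>"
          by (rule always_eventually) (auto simp: max_def power2_eq_square)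
      qed (auto intro!: tendsto_eq_intros)
      then show ?thesis using 3 by (simp add: DERIV_def)
    qed
  qed
  then show "((\<lambda>x. (max 0 x)\<^sup>2) has_derivative (\<lambda>h. 2 * max 0 x * h)) (at x within UNIV)"
    by (simp add: has_field_derivative_def)
next
  show "Ck_on 0 UNIV (\<lambda>x. 2 * max 0 x * v)" for v :: real
    by (auto simp: Ck_on.simps intro!: continuous_intros)
qed

text \<open>The square makes the positive part continuously differentiable.\<close>

definition bump :: "real^2 \<Rightarrow> real \<Rightarrow> real^2 \<Rightarrow> real" where
  "bump a r y = (max 0 (r\<^sup>2 - (y - a) \<bullet> (y - a)))\<^sup>2"

lemma bump_nonneg: "bump a r y \<ge> 0" by (simp add: bump_def)

lemma bump_pos_iff: "r > 0 \<Longrightarrow> bump a r y > 0 \<longleftrightarrow> dist y a < r"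
  unfolding bump_def dist_norm power2_norm_eq_inner[symmetric]
  by (auto simp: max_def abs_le_square_iff[symmetric] not_le power2_less_imp_less
      dest: power_strict_mono[of _ r 2])

lemma bump_zero: "r > 0 \<Longrightarrow> y \<notin> cball a r \<Longrightarrow> bump a r y = 0"
  using bump_pos_iff[of r a y] bump_nonneg[of a r y] by (simp add: dist_commute)

lemma Ck_on_id: "thick S \<Longrightarrow> Ck_on k S (\<lambda>x. x)"
proof (cases k)
  case (Suc j)
  assume "thick S"
  then show ?thesis unfolding Suc by (intro Ck_on_SucI[of _ _ "\<lambda>x v. v"]) auto
qed (simp add: Ck_on.simps)

lemma C1_bump: "Ck_on (Suc 0) UNIV (bump a r)"
proof -
  have t: "thick (UNIV :: (real^2) set)" by (rule thick_open) simp
  have c: "Ck_on k UNIV (\<lambda>y::real^2. y $ i)" for k i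
    by (rule Ck_on_linear_comp[OF t bounded_linear_vec_nth Ck_on_id[OF t]])
  have "Ck_on (Suc 0) UNIV (\<lambda>y::real^2. r\<^sup>2 - ((y$1 - a$1) * (y$1 - a$1) + (y$2 - a$2) * (y$2 - a$2)))"
    by (intro Ck_on_diff Ck_on_add Ck_on_mult Ck_on_const t c)
  from C1_on_compose[OF t this C1_square_pos_part]
  show ?thesis by (simp add: bump_def[abs_def] inner_vec_def sum_2)
qed

section \<open>Charts, supports and partitions of unity\<close>

locale surface =
  fixes X :: "'a topology" and A :: "('a, 2) chart set"
  assumes compact_surface: "compact_surface X A"
begin

lemma chart_basic:
  assumes "c \<in> A"
  shows "openin X (dom_chart c)" "open (img_chart c)" "dom_chart c \<subseteq> topspace X"
    "homeomorphic_map (subtopology X (dom_chart c)) (top_of_set (img_chart c)) (snd c)"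
    "inj_on (snd c) (dom_chart c)"
proof -
  have c: "is_chart X c" using compact_surface assms
    by (auto simp: compact_surface_def smooth_manifold_def)
  then show 1: "openin X (dom_chart c)" "open (img_chart c)"
    and 2: "homeomorphic_map (subtopology X (dom_chart c)) (top_of_set (img_chart c)) (snd c)"
    by (auto simp: is_chart_def)
  show 3: "dom_chart c \<subseteq> topspace X" using 1 openin_subset by blast
  show "inj_on (snd c) (dom_chart c)"
    using homeomorphic_imp_injective_map[OF 2] 3 by (simp add: topspace_subtopology Int_absorb1)
qed

lemma inv_chart_chart: "c \<in> A \<Longrightarrow> p \<in> dom_chart c \<Longrightarrow> inv_chart c (snd c p) = p"
  using chart_basic(5) by (simp add: inv_chart_def)

lemma chart_inv_chart: "y \<in> img_chart c \<Longrightarrow> snd c (inv_chart c y) = y"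
  by (simp add: inv_chart_def f_inv_into_f)

lemma inv_chart_in: "y \<in> img_chart c \<Longrightarrow> inv_chart c y \<in> dom_chart c"
  by (simp add: inv_chart_def inv_into_into)

lemma inv_chart_in_space: "c \<in> A \<Longrightarrow> y \<in> img_chart c \<Longrightarrow> inv_chart c y \<in> topspace X"
  by (rule subsetD[OF chart_basic(3) inv_chart_in])

lemma chart_cover: "p \<in> topspace X \<Longrightarrow> \<exists>c\<in>A. p \<in> dom_chart c"
  using compact_surface by (auto simp: compact_surface_def smooth_manifold_def)

lemma chart_at: "p \<in> topspace X \<Longrightarrow> chart_at A p \<in> A \<and> p \<in> dom_chart (chart_at A p)"
  unfolding chart_at_def using chart_cover[of p] by (intro someI_ex[of "\<lambda>c. c \<in> A \<and> p \<in> dom_chart c"]) blast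

lemma continuous_inv_chart:
  assumes c: "c \<in> A"
  shows "continuous_map (top_of_set (img_chart c)) X (inv_chart c)"
proof -
  obtain h where h: "homeomorphic_maps (subtopology X (dom_chart c)) (top_of_set (img_chart c)) (snd c) h"
    using chart_basic(4)[OF c] homeomorphic_map_maps by blast
  then have ch: "continuous_map (top_of_set (img_chart c)) (subtopology X (dom_chart c)) h"
    and inv: "\<And>p. p \<in> dom_chart c \<Longrightarrow> h (snd c p) = p"
    using chart_basic(3)[OF c] by (auto simp: homeomorphic_maps_def topspace_subtopology_subset)
  have "continuous_map (top_of_set (img_chart c)) X h"
    using ch continuous_map_in_subtopology by blast
  moreover have "h y = inv_chart c y" if "y \<in> topspace (top_of_set (img_chart c))" for y
    using inv[OF inv_chart_in[of y c]] chart_inv_chart[of y c] that by simp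
  ultimately show ?thesis using continuous_map_eq by blast
qed

lemma openin_chart_preimage:
  assumes c: "c \<in> A" and "open V"
  shows "openin X {p \<in> dom_chart c. snd c p \<in> V}"
proof -
  have "continuous_map (subtopology X (dom_chart c)) (top_of_set (img_chart c)) (snd c)"
    using chart_basic(4)[OF c] homeomorphic_imp_continuous_map by blast
  then have "continuous_map (subtopology X (dom_chart c)) euclidean (snd c)"
    using continuous_map_in_subtopology by blast
  moreover have "topspace (subtopology X (dom_chart c)) = dom_chart c"
    using chart_basic(3)[OF c] by (simp add: topspace_subtopology Int_absorb1)
  ultimately have "openin (subtopology X (dom_chart c)) {p \<in> dom_chart c. snd c p \<in> V}"
    using openin_continuous_map_preimage[of "subtopology X (dom_chart c)" euclidean "snd c" V] assms(2)
    by (simp only: open_openin)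
  then show ?thesis using chart_basic(1)[OF c] openin_open_subtopology by blast
qed

lemma open_inv_chart_preimage:
  assumes c: "c \<in> A" and "openin X V"
  shows "open {y \<in> img_chart c. inv_chart c y \<in> V}"
  using openin_continuous_map_preimage[OF continuous_inv_chart[OF c] assms(2)] chart_basic(2)[OF c]
  by (simp add: openin_open_eq)

definition overlap :: "('a, 2) chart \<Rightarrow> ('a, 2) chart \<Rightarrow> (real^2) set" where
  "overlap c d = snd c ` (dom_chart c \<inter> dom_chart d)"

lemma overlap_eq:
  assumes "c \<in> A" shows "overlap c d = {y \<in> img_chart c. inv_chart c y \<in> dom_chart d}"
proof safe
  fix y assume "y \<in> overlap c d"
  then obtain p where "p \<in> dom_chart c" "p \<in> dom_chart d" "y = snd c p" by (auto simp: overlap_def)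
  then show "y \<in> img_chart c" "inv_chart c y \<in> dom_chart d" using inv_chart_chart[OF assms] by auto
next
  fix p assume "p \<in> dom_chart c" "inv_chart c (snd c p) \<in> dom_chart d"
  then show "snd c p \<in> overlap c d" using inv_chart_chart[OF assms] by (auto simp: overlap_def)
qed

lemma overlap_open: "c \<in> A \<Longrightarrow> d \<in> A \<Longrightarrow> open (overlap c d)"
  unfolding overlap_eq by (intro open_inv_chart_preimage chart_basic)

lemma overlap_subset: "overlap c d \<subseteq> img_chart c" by (auto simp: overlap_def)

lemma transition_eq: "transition c d y = snd d (inv_chart c y)" by (simp add: transition_def)

lemma inv_chart_transition:
  "c \<in> A \<Longrightarrow> d \<in> A \<Longrightarrow> y \<in> overlap c d \<Longrightarrow> inv_chart d (transition c d y) = inv_chart c y"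
  by (simp add: overlap_eq transition_eq inv_chart_chart)

lemma transition_in_overlap:
  assumes "c \<in> A" "d \<in> A" "y \<in> overlap c d"
  shows "transition c d y \<in> overlap d c"
proof -
  have "inv_chart c y \<in> dom_chart c \<inter> dom_chart d"
    using assms inv_chart_in[of y c] by (simp add: overlap_eq)
  then show ?thesis unfolding transition_eq overlap_def by blast
qed

lemma transition_transition:
  assumes "c \<in> A" "d \<in> A" "y \<in> overlap c d"
  shows "transition d c (transition c d y) = y"
  using inv_chart_transition[OF assms] chart_inv_chart[OF subsetD[OF overlap_subset assms(3)]]
  by (simp add: transition_eq[of d c])

lemma transition_image:
  assumes "c \<in> A" "d \<in> A" shows "transition c d ` overlap c d = overlap d c"
proof
  show "overlap d c \<subseteq> transition c d ` overlap c d"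
    using transition_transition[OF assms(2,1)] transition_in_overlap[OF assms(2,1)]
    by (metis imageI subsetI)
qed (auto intro: transition_in_overlap[OF assms])

lemma transition_inj: assumes "c \<in> A" "d \<in> A" shows "inj_on (transition c d) (overlap c d)"
proof (rule inj_onI)
  fix y z assume yz: "y \<in> overlap c d" "z \<in> overlap c d" and eq: "transition c d y = transition c d z"
  have "inv_chart c y = inv_chart c z"
    using inv_chart_transition[OF assms yz(1)] inv_chart_transition[OF assms yz(2)] eq by simp
  then have "snd c (inv_chart c y) = snd c (inv_chart c z)" by (rule arg_cong)
  then show "y = z"
    unfolding chart_inv_chart[OF subsetD[OF overlap_subset yz(1)]] chart_inv_chart[OF subsetD[OF overlap_subset yz(2)]] .
qed

lemma transition_smooth: "c \<in> A \<Longrightarrow> d \<in> A \<Longrightarrow> Ck_on k (overlap c d) (transition c d)"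
  using compact_surface unfolding compact_surface_def smooth_manifold_def smooth_on_def overlap_def by metis

lemma transition_has_derivative:
  assumes "c \<in> A" "d \<in> A" "y \<in> overlap c d"
  shows "(transition c d has_derivative frechet_derivative (transition c d) (at y)) (at y)"
  by (rule Ck_on_open_deriv[OF overlap_open[OF assms(1,2)] transition_smooth[OF assms(1,2), of "Suc 0"] assms(3)])

definition Cfun :: "nat \<Rightarrow> ('a \<Rightarrow> real) \<Rightarrow> bool" where
  "Cfun k u \<longleftrightarrow> (\<forall>c\<in>A. Ck_on k (img_chart c) (u \<circ> inv_chart c))"

lemma thick_img: "c \<in> A \<Longrightarrow> thick (img_chart c)"
  by (simp add: thick_open chart_basic)

lemma CfunD: "Cfun k u \<Longrightarrow> c \<in> A \<Longrightarrow> Ck_on k (img_chart c) (u \<circ> inv_chart c)"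
  by (simp add: Cfun_def)

lemma Cfun_mono: "Cfun k u \<Longrightarrow> j \<le> k \<Longrightarrow> Cfun j u"
  using Ck_on_mono unfolding Cfun_def by blast

lemma Cfun_diff: "Cfun k u \<Longrightarrow> Cfun k v \<Longrightarrow> Cfun k (\<lambda>q. u q - v q)"
  by (simp add: Cfun_def o_def thick_img Ck_on_diff)

lemma Cfun_mult: "Cfun k u \<Longrightarrow> Cfun k v \<Longrightarrow> Cfun k (\<lambda>q. u q * v q)"
  by (simp add: Cfun_def o_def thick_img Ck_on_mult)

lemma Cfun_sum: "(\<And>i. i \<in> I \<Longrightarrow> Cfun k (u i)) \<Longrightarrow> Cfun k (\<lambda>q. \<Sum>i\<in>I. u i q)"
  by (simp add: Cfun_def o_def thick_img Ck_on_sum)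

lemma Cfun_divide:
  "Cfun k u \<Longrightarrow> Cfun k v \<Longrightarrow> (\<And>q. q \<in> topspace X \<Longrightarrow> v q \<noteq> 0) \<Longrightarrow> Cfun k (\<lambda>q. u q / v q)"
  by (simp add: Cfun_def o_def thick_img Ck_on_divide inv_chart_in_space)

text \<open>The compact set lies in the image of the chart, where integrals are taken; \<open>supportedE\<close> carries it
back to the surface.\<close>

definition supported :: "('a, 2) chart \<Rightarrow> ('a \<Rightarrow> real) \<Rightarrow> bool" where
  "supported c s \<longleftrightarrow> (\<exists>K. compact K \<and> K \<subseteq> img_chart c \<and>
     (\<forall>p\<in>topspace X. s p \<noteq> 0 \<longrightarrow> p \<in> dom_chart c \<and> snd c p \<in> K))"

lemma supported_mult: "supported c s \<Longrightarrow> supported c (\<lambda>q. s q * u q)" "supported c s \<Longrightarrow> supported c (\<lambda>q. u q * s q)"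
  unfolding supported_def by (metis mult_zero_left, metis mult_zero_right)

text \<open>\<open>Z\<close> is the support as a subset of the surface. It is closed because compact sets in a Hausdorff
space are closed.\<close>

lemma supportedE:
  assumes "supported c s" "c \<in> A"
  obtains K Z where "compact K" "K \<subseteq> img_chart c" "closedin X Z" "Z \<subseteq> dom_chart c"
    "\<And>q. q \<in> dom_chart c \<Longrightarrow> q \<in> Z \<longleftrightarrow> snd c q \<in> K"
    "\<And>q. q \<in> topspace X \<Longrightarrow> q \<notin> Z \<Longrightarrow> s q = 0"
proof -
  obtain K where K: "compact K" "K \<subseteq> img_chart c" "\<And>p. p\<in>topspace X \<Longrightarrow> s p \<noteq> 0 \<Longrightarrow> p \<in> dom_chart c \<and> snd c p \<in> K"
    using assms by (auto simp: supported_def)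
  define Z where "Z = inv_chart c ` K"
  have "compactin (top_of_set (img_chart c)) K" using K by (simp add: compactin_subtopology)
  then have "compactin X Z" unfolding Z_def by (rule image_compactin[OF _ continuous_inv_chart[OF assms(2)]])
  then have cl: "closedin X Z"
    using compact_surface compactin_imp_closedin unfolding compact_surface_def smooth_manifold_def by metis
  have sub: "Z \<subseteq> dom_chart c" unfolding Z_def by (intro image_subsetI inv_chart_in subsetD[OF K(2)])
  have Z: "q \<in> Z \<longleftrightarrow> snd c q \<in> K" if q: "q \<in> dom_chart c" for q
  proof
    assume "q \<in> Z"
    then obtain y where "y \<in> K" "q = inv_chart c y" unfolding Z_def by blast
    then show "snd c q \<in> K" using chart_inv_chart[OF subsetD[OF K(2)]] by metis
  next
    assume "snd c q \<in> K"
    then have "inv_chart c (snd c q) \<in> Z" unfolding Z_def by (rule imageI)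
    then show "q \<in> Z" by (simp only: inv_chart_chart[OF assms(2) q])
  qed
  have z: "s q = 0" if "q \<in> topspace X" "q \<notin> Z" for q using K(3)[OF that(1)] Z[of q] that(2) by blast
  show ?thesis by (rule that[OF K(1,2) cl sub Z z])
qed

lemma supported_zero_nbhd:
  assumes "closedin X Z" "d \<in> A"
  shows "open {y \<in> img_chart d. inv_chart d y \<notin> Z}"
proof -
  have "{y \<in> img_chart d. inv_chart d y \<notin> Z} = {y \<in> img_chart d. inv_chart d y \<in> topspace X - Z}"
    using inv_chart_in_space[OF assms(2)] by auto
  then show ?thesis using open_inv_chart_preimage[OF assms(2), of "topspace X - Z"] assms(1)
    by (simp add: closedin_def)
qed

definition chart_bump :: "('a, 2) chart \<Rightarrow> real^2 \<Rightarrow> real \<Rightarrow> 'a \<Rightarrow> real" where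
  "chart_bump c a r q = (if q \<in> dom_chart c then bump a r (snd c q) else 0)"

lemma chart_bump_nonneg: "chart_bump c a r q \<ge> 0"
  by (simp add: chart_bump_def bump_nonneg)

lemma chart_bump_supported:
  assumes "r > 0" "cball a r \<subseteq> img_chart c" shows "supported c (chart_bump c a r)"
  unfolding supported_def
proof (intro exI conjI ballI impI)
  show "compact (cball a r)" by simp
  fix p assume "chart_bump c a r p \<noteq> 0"
  then show "p \<in> dom_chart c" "snd c p \<in> cball a r"
    using bump_zero[OF assms(1)] by (auto simp: chart_bump_def split: if_splits)
qed (rule assms)

text \<open>The image of another chart \<open>d\<close> is the union of two open sets: the overlap with \<open>c\<close>, where the
function is a bump composed with a transition map, and the complement of the support, where it is zero.\<close>

lemma chart_bump_C1:
  assumes c: "c \<in> A" and r: "r > 0" "cball a r \<subseteq> img_chart c"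
  shows "Cfun (Suc 0) (chart_bump c a r)"
  unfolding Cfun_def
proof
  fix d assume d: "d \<in> A"
  obtain K Z where Z: "closedin X Z" "Z \<subseteq> dom_chart c" "\<And>q. q \<in> topspace X \<Longrightarrow> q \<notin> Z \<Longrightarrow> chart_bump c a r q = 0"
    using supportedE[OF chart_bump_supported[OF r] c] by metis
  define W where "W = {y \<in> img_chart d. inv_chart d y \<notin> Z}"
  have W: "open W" unfolding W_def by (rule supported_zero_nbhd[OF Z(1) d])
  have "Ck_on (Suc 0) (overlap d c) (\<lambda>y. bump a r (transition d c y))"
    by (rule C1_on_compose[OF thick_open[OF overlap_open[OF d c]] transition_smooth[OF d c] C1_bump]) simp
  then have 1: "Ck_on (Suc 0) (overlap d c) (chart_bump c a r \<circ> inv_chart d)"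
    by (subst Ck_on_cong) (auto simp: chart_bump_def overlap_eq[OF d] transition_eq)
  have "Ck_on (Suc 0) W (\<lambda>y. 0::real)" by (simp add: thick_open W)
  then have 2: "Ck_on (Suc 0) W (chart_bump c a r \<circ> inv_chart d)"
    by (subst Ck_on_cong[where g = "\<lambda>y. 0"]) (auto simp: W_def Z inv_chart_in_space[OF d])
  have "overlap d c \<union> W = img_chart d" using Z(2) by (auto simp: W_def overlap_eq[OF d])
  then show "Ck_on (Suc 0) (img_chart d) (chart_bump c a r \<circ> inv_chart d)"
    using Ck_on_Un[OF overlap_open[OF d c] W 1 2] by simp
qed

lemma finite_bump_cover:
  obtains P :: "'a set" and ch :: "'a \<Rightarrow> ('a, 2) chart" and r :: "'a \<Rightarrow> real"
  where "finite P" "P \<subseteq> topspace X" "\<And>p. p \<in> P \<Longrightarrow> ch p \<in> A" "\<And>p. p \<in> P \<Longrightarrow> r p > 0"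
    "\<And>p. p \<in> P \<Longrightarrow> cball (snd (ch p) p) (r p) \<subseteq> img_chart (ch p)"
    "\<And>q. q \<in> topspace X \<Longrightarrow> \<exists>p\<in>P. chart_bump (ch p) (snd (ch p) p) (r p) q > 0"
proof -
  define ch where "ch p = chart_at A p" for p
  have ch: "ch p \<in> A" "p \<in> dom_chart (ch p)" if "p \<in> topspace X" for p
    using chart_at[OF that] by (auto simp: ch_def)
  have "\<exists>r>0. cball (snd (ch p) p) r \<subseteq> img_chart (ch p)" if "p \<in> topspace X" for p
    using chart_basic(2)[OF ch(1)[OF that]] ch(2)[OF that] by (simp add: open_contains_cball)
  then obtain r where r: "\<And>p. p \<in> topspace X \<Longrightarrow> r p > 0"
    "\<And>p. p \<in> topspace X \<Longrightarrow> cball (snd (ch p) p) (r p) \<subseteq> img_chart (ch p)"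
    by metis
  define N where "N p = {q \<in> dom_chart (ch p). snd (ch p) q \<in> ball (snd (ch p) p) (r p)}" for p
  have "\<forall>V \<in> N ` topspace X. openin X V"
    unfolding N_def using ch openin_chart_preimage by blast
  moreover have "topspace X \<subseteq> \<Union>(N ` topspace X)" using ch r by (auto simp: N_def)
  moreover have "compactin X (topspace X)"
    using compact_surface by (simp add: compact_surface_def compact_space_def)
  ultimately obtain \<F> where F: "finite \<F>" "\<F> \<subseteq> N ` topspace X" "topspace X \<subseteq> \<Union>\<F>"
    unfolding compactin_def by metis
  then obtain P where P: "finite P" "P \<subseteq> topspace X" "\<F> = N ` P"
    by (metis finite_subset_image)
  show ?thesis
  proof (rule that[of P ch r])
    fix q assume "q \<in> topspace X"
    then obtain p where p: "p \<in> P" "q \<in> N p" using F P by auto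
    then have "chart_bump (ch p) (snd (ch p) p) (r p) q > 0"
      using bump_pos_iff[of "r p"] r P by (auto simp: chart_bump_def N_def dist_commute)
    then show "\<exists>p\<in>P. chart_bump (ch p) (snd (ch p) p) (r p) q > 0" using p by blast
  next
    show "cball (snd (ch p) p) (r p) \<subseteq> img_chart (ch p)" if "p \<in> P" for p
      by (rule r(2)[OF subsetD[OF P(2) that]])
  qed (use P ch r in auto)
qed

lemma partition_of_unity:
  obtains P :: "'a set" and ch :: "'a \<Rightarrow> ('a, 2) chart" and \<rho> :: "'a \<Rightarrow> 'a \<Rightarrow> real"
  where "finite P" "\<And>p. p \<in> P \<Longrightarrow> ch p \<in> A" "\<And>p. p \<in> P \<Longrightarrow> Cfun (Suc 0) (\<rho> p)"
    "\<And>p. p \<in> P \<Longrightarrow> supported (ch p) (\<rho> p)" "\<And>p q. p \<in> P \<Longrightarrow> q \<in> topspace X \<Longrightarrow> \<rho> p q \<ge> 0"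
    "\<And>q. q \<in> topspace X \<Longrightarrow> (\<Sum>p\<in>P. \<rho> p q) = 1"
proof -
  obtain P :: "'a set" and ch :: "'a \<Rightarrow> ('a, 2) chart" and r :: "'a \<Rightarrow> real"
  where P: "finite P" "P \<subseteq> topspace X" "\<And>p. p \<in> P \<Longrightarrow> ch p \<in> A" "\<And>p. p \<in> P \<Longrightarrow> r p > 0"
    "\<And>p. p \<in> P \<Longrightarrow> cball (snd (ch p) p) (r p) \<subseteq> img_chart (ch p)"
    "\<And>q. q \<in> topspace X \<Longrightarrow> \<exists>p\<in>P. chart_bump (ch p) (snd (ch p) p) (r p) q > 0"
    using finite_bump_cover by blast
  define b where "b p = chart_bump (ch p) (snd (ch p) p) (r p)" for p
  define B where "B q = (\<Sum>p\<in>P. b p q)" for q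
  have b0: "b p q \<ge> 0" for p q by (simp add: b_def chart_bump_nonneg)
  have B: "B q > 0" if q: "q \<in> topspace X" for q
  proof -
    obtain p where p: "p \<in> P" "b p q > 0" using P(6)[OF q] by (auto simp: b_def)
    then show ?thesis unfolding B_def using P(1) b0 by (intro sum_pos2) auto
  qed
  have C: "Cfun (Suc 0) (b p)" "supported (ch p) (b p)" if "p \<in> P" for p
    unfolding b_def
    by (rule chart_bump_C1[OF P(3)[OF that] P(4)[OF that] P(5)[OF that]],
        rule chart_bump_supported[OF P(4)[OF that] P(5)[OF that]])
  have CB: "Cfun (Suc 0) B" unfolding B_def[abs_def] by (intro Cfun_sum C)
  have Bnz: "B q \<noteq> 0" if "q \<in> topspace X" for q using B[OF that] by simp
  show ?thesis
  proof (rule that[of P ch "\<lambda>p q. b p q / B q"])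
    show "Cfun (Suc 0) (\<lambda>q. b p q / B q)" if "p \<in> P" for p
      by (rule Cfun_divide[OF C(1)[OF that] CB Bnz])
    show "supported (ch p) (\<lambda>q. b p q / B q)" if "p \<in> P" for p
      using supported_mult(1)[OF C(2)[OF that]] by (simp add: divide_inverse)
    show "(\<Sum>p\<in>P. b p q / B q) = 1" if "q \<in> topspace X" for q
      using Bnz[OF that] by (simp add: B_def sum_divide_distrib[symmetric])
    show "b p q / B q \<ge> 0" if "q \<in> topspace X" for p q
      using b0 B[OF that] by (simp add: less_imp_le)
  qed (use P in auto)
qed

text \<open>The surface is a union of finitely many coordinate balls, so the values of \<open>Q\<close> are a finite union
of continuous images of compact sets.\<close>

lemma attains_min:
  fixes Q :: "real \<Rightarrow> 'a \<Rightarrow> real" and J :: "real set"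
  assumes J: "compact J" "J \<noteq> {}" and X: "topspace X \<noteq> {}"
    and Q: "\<And>c. c \<in> A \<Longrightarrow> continuous_on (J \<times> img_chart c) (\<lambda>(t, y). Q t (inv_chart c y))"
  obtains t p where "t \<in> J" "p \<in> topspace X" "\<And>s q. s \<in> J \<Longrightarrow> q \<in> topspace X \<Longrightarrow> Q t p \<le> Q s q"
proof -
  obtain P :: "'a set" and ch :: "'a \<Rightarrow> ('a, 2) chart" and r :: "'a \<Rightarrow> real"
  where P: "finite P" "P \<subseteq> topspace X" "\<And>p. p \<in> P \<Longrightarrow> ch p \<in> A" "\<And>p. p \<in> P \<Longrightarrow> r p > 0"
    "\<And>p. p \<in> P \<Longrightarrow> cball (snd (ch p) p) (r p) \<subseteq> img_chart (ch p)"
    "\<And>q. q \<in> topspace X \<Longrightarrow> \<exists>p\<in>P. chart_bump (ch p) (snd (ch p) p) (r p) q > 0"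
    using finite_bump_cover by blast
  define V where "V = (\<lambda>(t, q). Q t q) ` (J \<times> topspace X)"
  define V' where "V' p = (\<lambda>(t, y). Q t (inv_chart (ch p) y)) ` (J \<times> cball (snd (ch p) p) (r p))" for p
  have "compact (V' p)" if "p \<in> P" for p
    unfolding V'_def
    by (intro compact_continuous_image compact_Times J compact_cball
        continuous_on_subset[OF Q[OF P(3)[OF that]]] Sigma_mono order_refl P(5)[OF that])
  then have "compact (\<Union>p\<in>P. V' p)" using P(1) by blast
  moreover have "V = (\<Union>p\<in>P. V' p)"
  proof safe
    fix v assume "v \<in> V"
    then obtain t q where tq: "v = Q t q" "t \<in> J" "q \<in> topspace X" by (auto simp: V_def)
    then obtain p where p: "p \<in> P" "chart_bump (ch p) (snd (ch p) p) (r p) q > 0" using P by blast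
    then have q: "q \<in> dom_chart (ch p)" "snd (ch p) q \<in> cball (snd (ch p) p) (r p)"
      using bump_zero[OF P(4)[OF p(1)], of "snd (ch p) q" "snd (ch p) p"]
      by (auto simp: chart_bump_def split: if_splits)
    have "v = Q t (inv_chart (ch p) (snd (ch p) q))"
      using tq inv_chart_chart[OF P(3)[OF p(1)] q(1)] by simp
    then have "v \<in> V' p" unfolding V'_def
      by (intro image_eqI[where x = "(t, snd (ch p) q)"]) (simp_all add: tq(2) q(2)[unfolded mem_cball])
    then show "v \<in> (\<Union>p\<in>P. V' p)" using p(1) by blast
  next
    fix v p assume p: "p \<in> P" and "v \<in> V' p"
    then obtain t y where ty: "t \<in> J" "y \<in> cball (snd (ch p) p) (r p)" "v = Q t (inv_chart (ch p) y)"
      by (auto simp: V'_def)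
    then have "inv_chart (ch p) y \<in> topspace X"
      by (intro inv_chart_in_space P(3)[OF p] subsetD[OF P(5)[OF p]])
    then show "v \<in> V" unfolding V_def using ty by blast
  qed
  ultimately have "compact V" by simp
  moreover have "V \<noteq> {}" using J X by (auto simp: V_def)
  ultimately obtain v where v: "v \<in> V" "\<And>w. w \<in> V \<Longrightarrow> v \<le> w" using compact_attains_inf by metis
  then obtain t p where tp: "t \<in> J" "p \<in> topspace X" "v = Q t p" by (auto simp: V_def)
  have "Q s q \<in> V" if "s \<in> J" "q \<in> topspace X" for s q
    unfolding V_def using that by (intro image_eqI[where x = "(s, q)"]) auto
  then show ?thesis using that[OF tp(1,2)] v(2) tp(3) by blast
qed

end

section \<open>Integration over a surface and Green's formula\<close>

definition grad_prod :: "(real^2 \<Rightarrow> real^2^2) \<Rightarrow> (real^2 \<Rightarrow> real) \<Rightarrow> (real^2 \<Rightarrow> real) \<Rightarrow> real^2 \<Rightarrow> real" where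
  "grad_prod G u v y = (G y$2$2 * partial 1 u y * partial 1 v y
     - G y$1$2 * (partial 1 u y * partial 2 v y + partial 2 u y * partial 1 v y)
     + G y$1$1 * partial 2 u y * partial 2 v y) / (metric2.vol G y)\<^sup>2"

locale riemannian_surface = surface +
  fixes g :: "('a, 2) tensor02"
  assumes metric: "riemannian_metric A g"
begin

lemma metric2: "c \<in> A \<Longrightarrow> metric2 (img_chart c) (g c)"
  using metric chart_basic(2)[of c] unfolding riemannian_metric_def smooth_on_def
  by unfold_locales blast+

abbreviation "vol c \<equiv> metric2.vol (g c)"

lemmas vol_pos = metric2.vol_pos[OF metric2]
lemmas vol_smooth = metric2.vol_smooth[OF metric2]

text \<open>Both are consequences of the transformation law \<open>g c = J\<^sup>T (g d) J\<close>: take determinants, and combine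
it with the chain rule.\<close>

lemma transition_vol_and_gradient:
  assumes c: "c \<in> A" and d: "d \<in> A" and y: "y \<in> overlap c d"
  defines "J \<equiv> frechet_derivative (transition c d) (at y)"
  shows "vol c y = \<bar>det (matrix J)\<bar> * vol d (transition c d y)"
    and "Cfun (Suc 0) u \<Longrightarrow> Cfun (Suc 0) v \<Longrightarrow>
      grad_prod (g c) (u \<circ> inv_chart c) (v \<circ> inv_chart c) y
      = grad_prod (g d) (u \<circ> inv_chart d) (v \<circ> inv_chart d) (transition c d y)"
proof -
  interpret C: metric2 "img_chart c" "g c" by (rule metric2[OF c])
  interpret D: metric2 "img_chart d" "g d" by (rule metric2[OF d])
  define z where "z = transition c d y"
  have yc: "y \<in> img_chart c" using subsetD[OF overlap_subset y] .
  have zo: "z \<in> overlap d c" unfolding z_def by (rule transition_in_overlap[OF c d y])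
  have zd: "z \<in> img_chart d" by (rule subsetD[OF overlap_subset zo])
  define M where "M = matrix J"
  have "g c y = transpose M ** g d z ** M"
    using metric c d y unfolding riemannian_metric_def tensorial_def overlap_def Let_def M_def J_def z_def by blast
  then have G: "g c y $ i $ j = M$1$i * (g d z$1$1 * M$1$j + g d z$1$2 * M$2$j)
      + M$2$i * (g d z$2$1 * M$1$j + g d z$2$2 * M$2$j)" for i j
    by (simp add: matrix_matrix_mult_def transpose_def sum_2 algebra_simps)
  define e f h where "e = g d z$1$1" and "f = g d z$1$2" and "h = g d z$2$2"
  have f21: "g d z$2$1 = f" using D.coef_21[OF zd] by (simp add: f_def D.coef_def)
  have E: "g c y$1$1 = e * (M$1$1)\<^sup>2 + 2 * f * M$1$1 * M$2$1 + h * (M$2$1)\<^sup>2"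
    "g c y$1$2 = e * M$1$1 * M$1$2 + f * (M$1$1 * M$2$2 + M$2$1 * M$1$2) + h * M$2$1 * M$2$2"
    "g c y$2$2 = e * (M$1$2)\<^sup>2 + 2 * f * M$1$2 * M$2$2 + h * (M$2$2)\<^sup>2"
    unfolding G f21 e_def[symmetric] f_def[symmetric] h_def[symmetric]
    by (simp_all add: algebra_simps power2_eq_square)
  have detM: "det M = M$1$1 * M$2$2 - M$1$2 * M$2$1" by (simp add: det_2)
  have vd: "(vol d z)\<^sup>2 = e * h - f\<^sup>2" using D.vol_sq[OF zd] by (simp add: D.coef_def e_def f_def h_def)
  have vc: "(vol c y)\<^sup>2 = g c y$1$1 * g c y$2$2 - (g c y$1$2)\<^sup>2" using C.vol_sq[OF yc] by (simp add: C.coef_def)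
  have sq: "(vol c y)\<^sup>2 = (det M)\<^sup>2 * (vol d z)\<^sup>2"
    unfolding vc vd E detM by (simp add: algebra_simps power2_eq_square)
  then have "(vol c y)\<^sup>2 = (\<bar>det M\<bar> * vol d z)\<^sup>2" by (simp add: power_mult_distrib)
  then show "vol c y = \<bar>det (matrix J)\<bar> * vol d (transition c d y)"
    using C.vol_pos[OF yc] D.vol_pos[OF zd] by (simp add: M_def z_def power2_eq_iff_nonneg)
  assume u: "Cfun (Suc 0) u" and v: "Cfun (Suc 0) v"
  have chain: "partial i (w \<circ> inv_chart c) y
      = M$1$i * partial 1 (w \<circ> inv_chart d) z + M$2$i * partial 2 (w \<circ> inv_chart d) z"
    if w: "Cfun (Suc 0) w" for w i
  proof -
    have dw: "(w \<circ> inv_chart d) differentiable (at z)"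
      by (rule Ck_on_differentiable[OF chart_basic(2)[OF d] CfunD[OF w d] zd])
    have tr: "(transition c d has_derivative J) (at y)"
      unfolding J_def by (rule transition_has_derivative[OF c d y])
    have "partial i (w \<circ> inv_chart c) y = partial i (\<lambda>y. (w \<circ> inv_chart d) (transition c d y)) y"
      by (rule partial_cong[OF overlap_open[OF c d] y]) (simp add: inv_chart_transition[OF c d])
    also have "\<dots> = frechet_derivative (w \<circ> inv_chart d) (at z) (J (axis i 1))"
      by (rule partial_eqI[OF has_derivative_compose[OF tr has_derivative_frechet[OF dw, unfolded z_def]], folded z_def])
    also have "\<dots> = M$1$i * partial 1 (w \<circ> inv_chart d) z + M$2$i * partial 2 (w \<circ> inv_chart d) z"
      unfolding frechet_eq_partial_2[OF dw] by (simp add: M_def matrix_def)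
    finally show ?thesis .
  qed
  have dnz: "(det M)\<^sup>2 \<noteq> 0" "(vol d z)\<^sup>2 \<noteq> 0" using sq C.vol_pos[OF yc] by auto
  have "g c y$2$2 * partial 1 (u \<circ> inv_chart c) y * partial 1 (v \<circ> inv_chart c) y
     - g c y$1$2 * (partial 1 (u \<circ> inv_chart c) y * partial 2 (v \<circ> inv_chart c) y
         + partial 2 (u \<circ> inv_chart c) y * partial 1 (v \<circ> inv_chart c) y)
     + g c y$1$1 * partial 2 (u \<circ> inv_chart c) y * partial 2 (v \<circ> inv_chart c) y
    = (det M)\<^sup>2 * (h * partial 1 (u \<circ> inv_chart d) z * partial 1 (v \<circ> inv_chart d) z
     - f * (partial 1 (u \<circ> inv_chart d) z * partial 2 (v \<circ> inv_chart d) z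
         + partial 2 (u \<circ> inv_chart d) z * partial 1 (v \<circ> inv_chart d) z)
     + e * partial 2 (u \<circ> inv_chart d) z * partial 2 (v \<circ> inv_chart d) z)"
    unfolding chain[OF u] chain[OF v] E detM by (simp add: algebra_simps power2_eq_square)
  then show "grad_prod (g c) (u \<circ> inv_chart c) (v \<circ> inv_chart c) y
      = grad_prod (g d) (u \<circ> inv_chart d) (v \<circ> inv_chart d) (transition c d y)"
    unfolding grad_prod_def sq z_def[symmetric] e_def[symmetric] f_def[symmetric] h_def[symmetric]
    using dnz by simp
qed

definition chart_int :: "('a, 2) chart \<Rightarrow> ('a \<Rightarrow> real) \<Rightarrow> real" where
  "chart_int c s = integral (img_chart c) (\<lambda>y. s (inv_chart c y) * vol c y)"

lemma chart_integrable:
  assumes c: "c \<in> A" and s: "continuous_on (img_chart c) (s \<circ> inv_chart c)" "supported c s"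
  shows "(\<lambda>y. s (inv_chart c y) * vol c y) absolutely_integrable_on img_chart c"
proof -
  obtain K where K: "compact K" "K \<subseteq> img_chart c" "\<And>p. p\<in>topspace X \<Longrightarrow> s p \<noteq> 0 \<Longrightarrow> p \<in> dom_chart c \<and> snd c p \<in> K"
    using s(2) unfolding supported_def by metis
  have "s (inv_chart c y) = 0" if "y \<in> img_chart c" "y \<notin> K" for y
    using K(3)[OF inv_chart_in_space[OF c that(1)]] chart_inv_chart[OF that(1)] that(2) by metis
  then show ?thesis
    using s(1) Ck_on_imp_cont[OF vol_smooth[OF c, of 0]]
    by (intro absolutely_integrable_compact_support[OF chart_basic(2)[OF c] _ K(1,2)] continuous_on_mult)
      (auto simp: o_def)
qed

lemma supported_outside:
  assumes "c \<in> A" "supported d s" "y \<in> img_chart c" "y \<notin> overlap c d"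
  shows "s (inv_chart c y) = 0"
  using assms inv_chart_in_space[OF assms(1,3)] unfolding supported_def overlap_eq[OF assms(1)] by blast

lemma chart_int_overlap:
  assumes "c \<in> A" "supported d s"
  shows "chart_int c s = integral (overlap c d) (\<lambda>y. s (inv_chart c y) * vol c y)"
proof -
  have "(if y \<in> img_chart c then s (inv_chart c y) * vol c y else 0)
      = (if y \<in> overlap c d then s (inv_chart c y) * vol c y else 0)" for y
    using supported_outside[OF assms, of y] subsetD[OF overlap_subset, of y c d] by auto
  then show ?thesis unfolding chart_int_def
    by (subst (1 2) integral_restrict_UNIV[symmetric]) presburger
qed

text \<open>The Jacobian determinant in the change of variables is absorbed by the area density.\<close>

lemma chart_int_eq:
  assumes c: "c \<in> A" and d: "d \<in> A" and s: "continuous_on (img_chart c) (s \<circ> inv_chart c)"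
    and sup: "supported c s" "supported d s"
  shows "chart_int c s = chart_int d s"
proof -
  let ?J = "\<lambda>y. frechet_derivative (transition c d) (at y)"
  let ?f = "\<lambda>z. s (inv_chart d z) * vol d z"
  have eq: "\<bar>det (matrix (?J y))\<bar> * ?f (transition c d y) = s (inv_chart c y) * vol c y"
    if "y \<in> overlap c d" for y
    using transition_vol_and_gradient(1)[OF c d that] inv_chart_transition[OF c d that] by simp
  have "(\<lambda>y. s (inv_chart c y) * vol c y) absolutely_integrable_on overlap c d"
    by (rule set_integrable_subset[OF chart_integrable[OF c s sup(1)] _ overlap_subset])
      (simp add: borel_open overlap_open[OF c d])
  then have ai: "(\<lambda>y. \<bar>det (matrix (?J y))\<bar> * ?f (transition c d y)) absolutely_integrable_on overlap c d"
    using eq by (simp cong: set_integrable_cong)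
  have "chart_int d s = integral (transition c d ` overlap c d) ?f"
    unfolding transition_image[OF c d] by (rule chart_int_overlap[OF d sup(1)])
  also have "\<dots> = integral (overlap c d) (\<lambda>y. \<bar>det (matrix (?J y))\<bar> * ?f (transition c d y))"
    by (rule change_of_variables_real[OF overlap_open[OF c d] transition_has_derivative[OF c d] transition_inj[OF c d] ai])
  also have "\<dots> = integral (overlap c d) (\<lambda>y. s (inv_chart c y) * vol c y)"
    by (intro integral_cong eq)
  also have "\<dots> = chart_int c s" by (rule chart_int_overlap[OF c sup(2), symmetric])
  finally show ?thesis by simp
qed


definition grad :: "('a \<Rightarrow> real) \<Rightarrow> ('a \<Rightarrow> real) \<Rightarrow> 'a \<Rightarrow> real" where
  "grad u v p = (let c = chart_at A p in grad_prod (g c) (u \<circ> inv_chart c) (v \<circ> inv_chart c) (snd c p))"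

lemma grad_in_chart:
  assumes c: "c \<in> A" and y: "y \<in> img_chart c" and uv: "Cfun (Suc 0) u" "Cfun (Suc 0) v"
  shows "grad u v (inv_chart c y) = grad_prod (g c) (u \<circ> inv_chart c) (v \<circ> inv_chart c) y"
proof -
  define d where "d = chart_at A (inv_chart c y)"
  have d: "d \<in> A" "inv_chart c y \<in> dom_chart d"
    using chart_at[OF inv_chart_in_space[OF c y]] by (simp_all add: d_def)
  have "y \<in> overlap c d" using y d by (simp add: overlap_eq[OF c])
  from transition_vol_and_gradient(2)[OF c d(1) this uv] show ?thesis
    by (simp only: grad_def Let_def d_def[symmetric] transition_eq)
qed

lemma grad_continuous:
  assumes c: "c \<in> A" and uv: "Cfun (Suc 0) u" "Cfun (Suc 0) v"
  shows "continuous_on (img_chart c) (grad u v \<circ> inv_chart c)"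
proof -
  interpret C: metric2 "img_chart c" "g c" by (rule metric2[OF c])
  have p: "Ck_on 0 (img_chart c) (partial i (w \<circ> inv_chart c))" if "Cfun (Suc 0) w" for w i
    by (rule Ck_on_partial[OF chart_basic(2)[OF c] CfunD[OF that c]])
  have "Ck_on 0 (img_chart c) (grad_prod (g c) (u \<circ> inv_chart c) (v \<circ> inv_chart c))"
    unfolding grad_prod_def[abs_def] C.coef_def[symmetric]
    by (intro Ck_on_divide Ck_on_add Ck_on_diff Ck_on_mult Ck_on_power2 p uv C.coef_smooth C.vol_smooth thick_img c)
      (use C.vol_pos in force)
  then have "continuous_on (img_chart c) (grad_prod (g c) (u \<circ> inv_chart c) (v \<circ> inv_chart c))"
    by (simp only: Ck_on.simps)
  then show ?thesis
    by (rule continuous_on_eq) (simp add: grad_in_chart[OF c _ uv])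
qed

lemma grad_sym: "grad u v p = grad v u p"
  by (simp add: grad_def Let_def grad_prod_def algebra_simps)

lemma supported_grad:
  assumes c: "c \<in> A" and s: "supported c u" and u: "Cfun (Suc 0) u"
  shows "supported c (grad u v)"
proof -
  obtain K Z where Z: "compact K" "K \<subseteq> img_chart c" "closedin X Z" "Z \<subseteq> dom_chart c"
    "\<And>q. q \<in> dom_chart c \<Longrightarrow> q \<in> Z \<longleftrightarrow> snd c q \<in> K" "\<And>q. q \<in> topspace X \<Longrightarrow> q \<notin> Z \<Longrightarrow> u q = 0"
    using supportedE[OF s c] by metis
  have "grad u v p = 0" if p: "p \<in> topspace X" "p \<notin> Z" for p
  proof -
    define d where "d = chart_at A p"
    have d: "d \<in> A" "p \<in> dom_chart d" using chart_at[OF p(1)] by (simp_all add: d_def)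
    let ?W = "{y \<in> img_chart d. inv_chart d y \<notin> Z}"
    have W: "open ?W" by (rule supported_zero_nbhd[OF Z(3) d(1)])
    have y: "snd d p \<in> ?W" using p d by (simp add: inv_chart_chart)
    have "partial i (u \<circ> inv_chart d) (snd d p) = partial i (\<lambda>y. 0) (snd d p)" for i
      by (rule partial_cong[OF W y]) (simp add: Z(6) inv_chart_in_space[OF d(1)])
    then show ?thesis by (simp add: grad_def Let_def grad_prod_def d_def[symmetric])
  qed
  then show ?thesis unfolding supported_def using Z by (metis subsetD)
qed

text \<open>The flux of \<open>\<eta> \<nabla> u\<close> has compact support in the chart, so the integral of its divergence vanishes.\<close>

lemma green_in_chart:
  assumes c: "c \<in> A" and \<eta>: "Cfun (Suc 0) \<eta>" "supported c \<eta>" and u: "Cfun 2 u"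
  shows "integral (img_chart c) (\<lambda>y. \<eta> (inv_chart c y) * laplacian_coord (g c) (u \<circ> inv_chart c) y * vol c y)
    = - chart_int c (grad \<eta> u)"
proof -
  interpret C: metric2 "img_chart c" "g c" by (rule metric2[OF c])
  define w where "w = u \<circ> inv_chart c"
  define b where "b = \<eta> \<circ> inv_chart c"
  have w: "Ck_on 2 (img_chart c) w" and b: "Ck_on (Suc 0) (img_chart c) b"
    unfolding w_def b_def using CfunD[OF u c] CfunD[OF \<eta>(1) c] by auto
  have w': "Ck_on (Suc (Suc 0)) (img_chart c) w" using w by (simp add: numeral_2_eq_2)
  have u1: "Cfun (Suc 0) u" using Cfun_mono[OF u] by simp
  obtain K where K: "compact K" "K \<subseteq> img_chart c" "\<And>p. p\<in>topspace X \<Longrightarrow> \<eta> p \<noteq> 0 \<Longrightarrow> p \<in> dom_chart c \<and> snd c p \<in> K"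
    using \<eta>(2) unfolding supported_def by metis
  have b0: "b y = 0" if "y \<in> img_chart c" "y \<notin> K" for y
    unfolding b_def o_def
    using K(3)[OF inv_chart_in_space[OF c that(1)]] chart_inv_chart[OF that(1)] that(2) by metis
  define V1 where "V1 y = C.cf 2 2 y * partial 1 w y - C.cf 1 2 y * partial 2 w y" for y
  define V2 where "V2 y = C.cf 1 1 y * partial 2 w y - C.cf 1 2 y * partial 1 w y" for y
  have V: "Ck_on (Suc 0) (img_chart c) V1" "Ck_on (Suc 0) (img_chart c) V2"
    unfolding V1_def[abs_def] V2_def[abs_def]
    by (intro Ck_on_diff Ck_on_mult thick_img[OF c] C.cf_smooth Ck_on_partial[OF chart_basic(2)[OF c] w'])+
  have i: "(partial i (\<lambda>y. b y * W y) has_integral 0) (img_chart c)"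
    if "Ck_on (Suc 0) (img_chart c) W" for i W
    by (rule has_integral_partial_open[OF chart_basic(2)[OF c] Ck_on_mult[OF thick_img[OF c] b that] K(1,2)])
      (simp add: b0)
  note dd = Ck_on_differentiable[OF chart_basic(2)[OF c]]
  have eq: "partial 1 (\<lambda>y. b y * V1 y) y + partial 2 (\<lambda>y. b y * V2 y) y
      = \<eta> (inv_chart c y) * laplacian_coord (g c) w y * vol c y + grad \<eta> u (inv_chart c y) * vol c y"
    if y: "y \<in> img_chart c" for y
  proof -
    have "partial 1 (\<lambda>y. b y * V1 y) y + partial 2 (\<lambda>y. b y * V2 y) y
      = b y * (partial 1 V1 y + partial 2 V2 y) + (partial 1 b y * V1 y + partial 2 b y * V2 y)"
      using dd[OF b y] dd[OF V(1) y] dd[OF V(2) y] by (simp add: partial_mult algebra_simps)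
    moreover have "partial 1 V1 y + partial 2 V2 y = vol c y * laplacian_coord (g c) w y"
      using C.laplacian_divergence[OF y w] by (simp add: div_op_def V1_def[abs_def] V2_def[abs_def])
    moreover have "partial 1 b y * V1 y + partial 2 b y * V2 y = grad \<eta> u (inv_chart c y) * vol c y"
      unfolding grad_in_chart[OF c y \<eta>(1) u1] grad_prod_def b_def[symmetric] w_def[symmetric]
        V1_def V2_def C.cf_def C.coef_def
      using C.vol_pos[OF y] by (simp add: field_simps power2_eq_square)
    ultimately show ?thesis by (simp add: b_def algebra_simps)
  qed
  have "((\<lambda>y. partial 1 (\<lambda>y. b y * V1 y) y + partial 2 (\<lambda>y. b y * V2 y) y) has_integral (0 + 0)) (img_chart c)"
    by (intro has_integral_add i V)
  then have tot: "((\<lambda>y. \<eta> (inv_chart c y) * laplacian_coord (g c) w y * vol c y + grad \<eta> u (inv_chart c y) * vol c y)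
      has_integral 0) (img_chart c)"
    using has_integral_cong[of "img_chart c", OF eq] by simp
  have gi: "(\<lambda>y. grad \<eta> u (inv_chart c y) * vol c y) integrable_on img_chart c"
    using chart_integrable[OF c grad_continuous[OF c \<eta>(1) u1] supported_grad[OF c \<eta>(2,1)]]
    by (rule set_lebesgue_integral_eq_integral)
  then have "((\<lambda>y. grad \<eta> u (inv_chart c y) * vol c y) has_integral chart_int c (grad \<eta> u)) (img_chart c)"
    unfolding chart_int_def by (rule integrable_integral)
  from has_integral_diff[OF tot this]
  have "((\<lambda>y. \<eta> (inv_chart c y) * laplacian_coord (g c) w y * vol c y) has_integral - chart_int c (grad \<eta> u)) (img_chart c)"
    by simp
  then show "integral (img_chart c) (\<lambda>y. \<eta> (inv_chart c y) * laplacian_coord (g c) (u \<circ> inv_chart c) y * vol c y)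
    = - chart_int c (grad \<eta> u)"
    unfolding w_def by (rule integral_unique)
qed

end

lemma (in metric2) laplacian_smooth:
  assumes u: "Ck_on (Suc (Suc k)) U u"
  shows "Ck_on k U (laplacian_coord G u)"
proof -
  have u2: "Ck_on 2 U u" using Ck_on_mono[OF u, of 2] by simp
  have p: "Ck_on (Suc k) U (partial i u)" for i by (rule Ck_on_partial[OF U u])
  have p1: "Ck_on k U (partial i u)" for i by (rule Ck_on_SucD[OF p])
  have p2: "Ck_on k U (partial j (partial i u))" for i j by (rule Ck_on_partial[OF U p])
  have pc: "Ck_on k U (partial a (cf i j))" for a i j by (rule Ck_on_partial[OF U cf_smooth])
  have nz: "vol y \<noteq> 0" if "y \<in> U" for y using vol_pos[OF that] by simp
  let ?f = "\<lambda>y. (cf 2 2 y * partial 1 (partial 1 u) y - 2 * cf 1 2 y * partial 1 (partial 2 u) y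
     + cf 1 1 y * partial 2 (partial 2 u) y
     + (partial 1 (cf 2 2) y - partial 2 (cf 1 2) y) * partial 1 u y
     + (partial 2 (cf 1 1) y - partial 1 (cf 1 2) y) * partial 2 u y) / vol y"
  have "Ck_on k U ?f"
    by (intro Ck_on_divide Ck_on_add Ck_on_diff Ck_on_mult Ck_on_const thickU p1 p2 pc cf_smooth vol_smooth nz)
  moreover have "laplacian_coord G u y = ?f y" if y: "y \<in> U" for y
    using laplacian_divergence[OF y u2] nz[OF y]
    unfolding div_op_expand[OF U y u2 cf_smooth cf_smooth cf_smooth] by (simp add: eq_divide_eq mult.commute)
  ultimately show ?thesis using Ck_on_cong[of U "laplacian_coord G u" ?f k] by blast
qed

context riemannian_surface
begin

lemma laplacian_coord_continuous:
  assumes c: "c \<in> A" and u: "Cfun 2 u"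
  shows "continuous_on (img_chart c) (laplacian_coord (g c) (u \<circ> inv_chart c))"
proof -
  have "Ck_on 0 (img_chart c) (laplacian_coord (g c) (u \<circ> inv_chart c))"
    by (rule metric2.laplacian_smooth[OF metric2[OF c]]) (use CfunD[OF u c] in \<open>simp add: numeral_2_eq_2\<close>)
  then show ?thesis by (simp only: Ck_on.simps)
qed

lemma supported_other_chart:
  assumes c: "c \<in> A" and d: "d \<in> A" and r: "r > 0" "cball a r \<subseteq> overlap c d"
  shows "supported d (chart_bump c a r)"
  unfolding supported_def
proof (intro exI conjI ballI impI)
  show "compact (transition c d ` cball a r)"
    using continuous_on_subset[OF Ck_on_imp_cont[OF transition_smooth[OF c d]] r(2)]
    by (intro compact_continuous_image) auto
  have "transition c d ` cball a r \<subseteq> transition c d ` overlap c d" using r(2) by (rule image_mono)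
  then show "transition c d ` cball a r \<subseteq> img_chart d"
    unfolding transition_image[OF c d] using overlap_subset by (rule order_trans)
  fix p assume "chart_bump c a r p \<noteq> 0"
  then have p: "p \<in> dom_chart c" "snd c p \<in> cball a r"
    using bump_zero[OF r(1), of "snd c p" a] by (auto simp: chart_bump_def split: if_splits)
  then have "snd c p \<in> overlap c d" using r(2) by blast
  then show "p \<in> dom_chart d" unfolding overlap_eq[OF c] by (simp add: inv_chart_chart[OF c p(1)])
  have "snd d p = transition c d (snd c p)" by (simp add: transition_eq inv_chart_chart[OF c p(1)])
  then show "snd d p \<in> transition c d ` cball a r" using p(2) by simp
qed

text \<open>If the Laplacian in the chart \<open>c\<close> were larger than in \<open>d\<close> at a point, it would be so on a ball. But
the integrals of both against a bump \<open>\<eta>\<close> supported in this ball agree: by \<open>green_in_chart\<close> they are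
minus the integral of the product of the gradients of \<open>\<eta>\<close> and \<open>u\<close>, which does not depend on the chart.\<close>

lemma laplacian_chart_le:
  assumes c: "c \<in> A" and d: "d \<in> A" and y0: "y0 \<in> overlap c d" and u: "Cfun 2 u"
  shows "laplacian_coord (g c) (u \<circ> inv_chart c) y0 \<le> laplacian_coord (g d) (u \<circ> inv_chart d) (transition c d y0)"
proof (rule ccontr)
  define Lc where "Lc = laplacian_coord (g c) (u \<circ> inv_chart c)"
  define Ld where "Ld = laplacian_coord (g d) (u \<circ> inv_chart d)"
  define \<delta> where "\<delta> y = Lc y - Ld (transition c d y)" for y
  let ?O = "overlap c d"
  have O: "open ?O" by (rule overlap_open[OF c d])
  assume "\<not> ?thesis"
  then have d0: "\<delta> y0 > 0" by (simp add: \<delta>_def Lc_def Ld_def)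
  have contLc: "continuous_on (img_chart c) Lc" unfolding Lc_def by (rule laplacian_coord_continuous[OF c u])
  have contLd: "continuous_on (img_chart d) Ld" unfolding Ld_def by (rule laplacian_coord_continuous[OF d u])
  have contLd': "continuous_on ?O (\<lambda>y. Ld (transition c d y))"
    by (rule continuous_on_compose2[OF contLd Ck_on_imp_cont[OF transition_smooth[OF c d]]])
      (simp add: transition_image[OF c d] overlap_subset)
  have cont\<delta>: "continuous_on ?O \<delta>"
    unfolding \<delta>_def[abs_def]
    by (intro continuous_on_diff contLd' continuous_on_subset[OF contLc overlap_subset])
  have "open (?O \<inter> \<delta> -` {0<..})" by (rule continuous_open_preimage[OF cont\<delta> O]) simp
  moreover have "y0 \<in> ?O \<inter> \<delta> -` {0<..}" using y0 d0 by simp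
  ultimately obtain r where r: "r > 0" "cball y0 r \<subseteq> ?O \<inter> \<delta> -` {0<..}"
    by (metis open_contains_cball)
  then have rO: "cball y0 r \<subseteq> ?O" and r\<delta>: "\<And>y. y \<in> cball y0 r \<Longrightarrow> \<delta> y > 0" by auto
  have rc: "cball y0 r \<subseteq> img_chart c" using rO overlap_subset by (rule order_trans)
  define \<eta> where "\<eta> = chart_bump c y0 r"
  have \<eta>1: "Cfun (Suc 0) \<eta>" unfolding \<eta>_def by (rule chart_bump_C1[OF c r(1) rc])
  have sc: "supported c \<eta>" unfolding \<eta>_def by (rule chart_bump_supported[OF r(1) rc])
  have sd: "supported d \<eta>" unfolding \<eta>_def by (rule supported_other_chart[OF c d r(1) rO])
  have u1: "Cfun (Suc 0) u" using Cfun_mono[OF u] by simp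
  \<comment> \<open>As functions on the surface, the two integrands can be compared in the single chart \<open>c\<close>.\<close>
  define s1 where "s1 q = \<eta> q * Lc (snd c q)" for q
  define s2 where "s2 q = \<eta> q * Ld (snd d q)" for q
  have s1: "supported c s1" "supported d s1" and s2: "supported c s2" "supported d s2"
    unfolding s1_def[abs_def] s2_def[abs_def] by (intro supported_mult(1) sc sd)+
  have "chart_int c s1 = integral (img_chart c) (\<lambda>y. \<eta> (inv_chart c y) * Lc y * vol c y)"
    unfolding chart_int_def by (intro integral_cong) (simp add: s1_def chart_inv_chart)
  also have "\<dots> = - chart_int c (grad \<eta> u)"
    unfolding Lc_def by (rule green_in_chart[OF c \<eta>1 sc u])
  also have "\<dots> = - chart_int d (grad \<eta> u)"
    using chart_int_eq[OF c d grad_continuous[OF c \<eta>1 u1] supported_grad[OF c sc \<eta>1] supported_grad[OF d sd \<eta>1]] by simp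
  also have "\<dots> = integral (img_chart d) (\<lambda>y. \<eta> (inv_chart d y) * Ld y * vol d y)"
    unfolding Ld_def by (rule green_in_chart[OF d \<eta>1 sd u, symmetric])
  also have "\<dots> = chart_int d s2"
    unfolding chart_int_def by (intro integral_cong) (simp add: s2_def chart_inv_chart)
  also have "\<dots> = chart_int c s2"
  proof (rule chart_int_eq[OF d c _ s2(2,1)])
    have "continuous_on (img_chart d) (\<lambda>z. (\<eta> \<circ> inv_chart d) z * Ld z)"
      by (intro continuous_on_mult contLd Ck_on_imp_cont[OF CfunD[OF \<eta>1 d]])
    then show "continuous_on (img_chart d) (s2 \<circ> inv_chart d)"
      by (rule continuous_on_eq) (simp add: s2_def chart_inv_chart)
  qed
  finally have eq: "chart_int c s1 = chart_int c s2" .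
  define f1 where "f1 y = \<eta> (inv_chart c y) * Lc y * vol c y" for y
  define f2 where "f2 y = \<eta> (inv_chart c y) * Ld (transition c d y) * vol c y" for y
  have i1: "chart_int c s1 = integral ?O f1"
    unfolding chart_int_overlap[OF c s1(2)]
    by (intro integral_cong) (simp add: f1_def s1_def chart_inv_chart[OF subsetD[OF overlap_subset]])
  have i2: "chart_int c s2 = integral ?O f2"
    unfolding chart_int_overlap[OF c s2(2)]
    by (intro integral_cong) (simp add: f2_def s2_def transition_eq)
  have \<eta>c: "continuous_on ?O (\<lambda>y. \<eta> (inv_chart c y))"
    using continuous_on_subset[OF Ck_on_imp_cont[OF CfunD[OF \<eta>1 c]] overlap_subset] by (simp add: o_def)
  have vc: "continuous_on ?O (vol c)"
    by (rule continuous_on_subset[OF Ck_on_imp_cont[OF vol_smooth[OF c, of 0]] overlap_subset])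
  have \<eta>0: "\<eta> (inv_chart c y) = bump y0 r y" if "y \<in> ?O" for y
    using subsetD[OF overlap_subset that] by (simp add: \<eta>_def chart_bump_def inv_chart_in chart_inv_chart)
  have f1i: "f1 integrable_on ?O" unfolding f1_def[abs_def]
    by (intro set_lebesgue_integral_eq_integral(1) absolutely_integrable_compact_support[OF O _ compact_cball rO]
        continuous_on_mult \<eta>c vc continuous_on_subset[OF contLc overlap_subset])
      (simp add: \<eta>0 bump_zero[OF r(1)])
  have f2i: "f2 integrable_on ?O" unfolding f2_def[abs_def]
    by (intro set_lebesgue_integral_eq_integral(1) absolutely_integrable_compact_support[OF O _ compact_cball rO]
        continuous_on_mult \<eta>c vc contLd')
      (simp add: \<eta>0 bump_zero[OF r(1)])
  have "integral ?O (\<lambda>y. f1 y - f2 y) > 0"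
  proof (rule integral_pos_continuous[OF O _ integrable_diff[OF f1i f2i] _ y0])
    show "continuous_on ?O (\<lambda>y. f1 y - f2 y)"
      unfolding f1_def f2_def by (intro continuous_intros \<eta>c vc contLd' continuous_on_subset[OF contLc overlap_subset])
    have *: "f1 y - f2 y = \<eta> (inv_chart c y) * \<delta> y * vol c y" for y
      by (simp add: f1_def f2_def \<delta>_def algebra_simps)
    show "f1 y - f2 y \<ge> 0" if y: "y \<in> ?O" for y
    proof (cases "y \<in> cball y0 r")
      case True
      then show ?thesis unfolding * \<eta>0[OF y]
        using r\<delta>[OF True] vol_pos[OF c subsetD[OF overlap_subset y]] bump_nonneg[of y0 r y] by simp
    qed (simp add: * \<eta>0[OF y] bump_zero[OF r(1)])
    show "f1 y0 - f2 y0 > 0"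
      unfolding * \<eta>0[OF y0] using d0 vol_pos[OF c subsetD[OF overlap_subset y0]] bump_pos_iff[OF r(1), of y0 y0] r(1)
      by simp
  qed
  then show False using integral_diff[OF f1i f2i] i1 i2 eq by simp
qed

lemma laplacian_in_chart:
  assumes c: "c \<in> A" and y: "y \<in> img_chart c" and u: "Cfun 2 u"
  shows "laplacian A g u (inv_chart c y) = laplacian_coord (g c) (u \<circ> inv_chart c) y"
proof -
  define d where "d = chart_at A (inv_chart c y)"
  have d: "d \<in> A" "inv_chart c y \<in> dom_chart d"
    using chart_at[OF inv_chart_in_space[OF c y]] by (simp_all add: d_def)
  have o: "y \<in> overlap c d" using y d by (simp add: overlap_eq[OF c])
  have "laplacian_coord (g d) (u \<circ> inv_chart d) (transition c d y) = laplacian_coord (g c) (u \<circ> inv_chart c) y"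
    using laplacian_chart_le[OF c d(1) o u] laplacian_chart_le[OF d(1) c transition_in_overlap[OF c d(1) o] u]
    by (simp only: transition_transition[OF c d(1) o])
  then show ?thesis by (simp only: laplacian_def Let_def d_def[symmetric] transition_eq)
qed

lemma laplacian_Cfun: assumes u: "Cfun 2 u" shows "Cfun 0 (laplacian A g u)"
  unfolding Cfun_def Ck_on.simps
  by (intro ballI continuous_on_eq[OF laplacian_coord_continuous[OF _ u]])
    (simp_all only: o_apply laplacian_in_chart[OF _ _ u])

lemma grad_Cfun: assumes "Cfun (Suc 0) u" "Cfun (Suc 0) v" shows "Cfun 0 (grad u v)"
  unfolding Cfun_def Ck_on.simps using grad_continuous[OF _ assms] by blast

lemma chart_int_sum:
  assumes c: "c \<in> A" and s: "\<And>i. i \<in> I \<Longrightarrow> Cfun 0 (s i)" "\<And>i. i \<in> I \<Longrightarrow> supported c (s i)" and I: "finite I"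
  shows "chart_int c (\<lambda>q. \<Sum>i\<in>I. s i q) = (\<Sum>i\<in>I. chart_int c (s i))"
proof -
  have "(\<lambda>y. s i (inv_chart c y) * vol c y) integrable_on img_chart c" if "i \<in> I" for i
    using chart_integrable[OF c Ck_on_imp_cont[OF CfunD[OF s(1)[OF that] c]] s(2)[OF that]]
    by (rule set_lebesgue_integral_eq_integral)
  then show ?thesis unfolding chart_int_def sum_distrib_right by (intro integral_sum I)
qed

lemma chart_int_diff:
  assumes c: "c \<in> A" and s: "Cfun 0 s" "Cfun 0 s'" "supported c s" "supported c s'"
  shows "chart_int c (\<lambda>q. s q - s' q) = chart_int c s - chart_int c s'"
proof -
  have "(\<lambda>y. s (inv_chart c y) * vol c y) integrable_on img_chart c"
    "(\<lambda>y. s' (inv_chart c y) * vol c y) integrable_on img_chart c"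
    using chart_integrable[OF c Ck_on_imp_cont[OF CfunD[OF s(1) c]] s(3)]
      chart_integrable[OF c Ck_on_imp_cont[OF CfunD[OF s(2) c]] s(4)]
    by (auto intro: set_lebesgue_integral_eq_integral)
  then show ?thesis unfolding chart_int_def left_diff_distrib by (intro integral_diff)
qed

lemma chart_int_cong:
  "c \<in> A \<Longrightarrow> (\<And>q. q \<in> topspace X \<Longrightarrow> s q = s' q) \<Longrightarrow> chart_int c s = chart_int c s'"
  unfolding chart_int_def by (intro integral_cong) (simp add: inv_chart_in_space)

text \<open>Integration by parts turns the integrals of \<open>u \<Delta> v\<close> and of \<open>v \<Delta> u\<close> into minus that of the product of
the gradients, so their difference vanishes. To integrate by parts globally, split the test
function by the partition of unity and apply \<open>green_in_chart\<close> to each piece; the gradients of the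
pieces add up to the gradient of the test function.\<close>

lemma green_no_sign:
  assumes u: "Cfun 2 u" and v: "Cfun 2 v"
    and nn: "\<And>p. p \<in> topspace X \<Longrightarrow> u p * laplacian A g v p - v p * laplacian A g u p \<ge> 0"
    and p0: "p0 \<in> topspace X" "u p0 * laplacian A g v p0 - v p0 * laplacian A g u p0 > 0"
  shows False
proof -
  obtain P :: "'a set" and ch :: "'a \<Rightarrow> ('a, 2) chart" and \<rho> :: "'a \<Rightarrow> 'a \<Rightarrow> real"
  where P: "finite P" "\<And>p. p \<in> P \<Longrightarrow> ch p \<in> A" "\<And>p. p \<in> P \<Longrightarrow> Cfun (Suc 0) (\<rho> p)"
    "\<And>p. p \<in> P \<Longrightarrow> supported (ch p) (\<rho> p)" "\<And>p q. p \<in> P \<Longrightarrow> q \<in> topspace X \<Longrightarrow> \<rho> p q \<ge> 0"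
    "\<And>q. q \<in> topspace X \<Longrightarrow> (\<Sum>p\<in>P. \<rho> p q) = 1"
    using partition_of_unity by blast
  define I where "I s = (\<Sum>p\<in>P. chart_int (ch p) (\<lambda>q. \<rho> p q * s q))" for s
  have \<rho>0: "Cfun 0 (\<rho> p)" if "p \<in> P" for p using Cfun_mono[OF P(3)[OF that]] by simp
  have sum\<rho>: "(\<Sum>p\<in>P. \<rho> p q * w q) = w q" if "q \<in> topspace X" for q and w :: "'a \<Rightarrow> real"
    using P(6)[OF that] by (simp add: sum_distrib_right[symmetric])
  have I_chart: "I s = chart_int c s" if c: "c \<in> A" and s: "Cfun 0 s" "supported c s" for c s
  proof -
    have "chart_int (ch p) (\<lambda>q. \<rho> p q * s q) = chart_int c (\<lambda>q. \<rho> p q * s q)" if p: "p \<in> P" for p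
      by (intro chart_int_eq P(2)[OF p] c Ck_on_imp_cont[OF CfunD[OF Cfun_mult[OF \<rho>0[OF p] s(1)]]]
          supported_mult(1)[OF P(4)[OF p]] supported_mult(2)[OF s(2)])
    then have "I s = (\<Sum>p\<in>P. chart_int c (\<lambda>q. \<rho> p q * s q))" by (simp add: I_def)
    also have "\<dots> = chart_int c (\<lambda>q. \<Sum>p\<in>P. \<rho> p q * s q)"
      by (rule chart_int_sum[symmetric, OF c _ _ P(1)])
        (rule Cfun_mult[OF \<rho>0 s(1)], assumption, rule supported_mult(2)[OF s(2)])
    also have "\<dots> = chart_int c s" by (rule chart_int_cong[OF c sum\<rho>])
    finally show ?thesis .
  qed
  have I_sum: "I (\<lambda>q. \<Sum>k\<in>P. s k q) = (\<Sum>k\<in>P. I (s k))" if s: "\<And>k. k \<in> P \<Longrightarrow> Cfun 0 (s k)" for s :: "'a \<Rightarrow> 'a \<Rightarrow> real"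
  proof -
    have "chart_int (ch p) (\<lambda>q. \<rho> p q * (\<Sum>k\<in>P. s k q)) = (\<Sum>k\<in>P. chart_int (ch p) (\<lambda>q. \<rho> p q * s k q))"
      if p: "p \<in> P" for p
      unfolding sum_distrib_left
      by (rule chart_int_sum[OF P(2)[OF p] _ _ P(1)])
        (rule Cfun_mult[OF \<rho>0[OF p] s], assumption, rule supported_mult(1)[OF P(4)[OF p]])
    then have "I (\<lambda>q. \<Sum>k\<in>P. s k q) = (\<Sum>p\<in>P. \<Sum>k\<in>P. chart_int (ch p) (\<lambda>q. \<rho> p q * s k q))"
      unfolding I_def by (rule sum.cong[OF refl])
    also have "\<dots> = (\<Sum>k\<in>P. I (s k))" unfolding I_def by (rule sum.swap)
    finally show ?thesis .
  qed
  have green: "I (\<lambda>q. \<eta> q * laplacian A g w q) = - I (grad \<eta> w)" if \<eta>: "Cfun (Suc 0) \<eta>" and w: "Cfun 2 w" for \<eta> w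
  proof -
    have w1: "Cfun (Suc 0) w" using Cfun_mono[OF w] by simp
    have \<rho>\<eta>: "Cfun (Suc 0) (\<lambda>q. \<rho> p q * \<eta> q)" "supported (ch p) (\<lambda>q. \<rho> p q * \<eta> q)" if p: "p \<in> P" for p
      by (intro Cfun_mult P(3)[OF p] \<eta> supported_mult(1) P(4)[OF p])+
    have "chart_int (ch p) (\<lambda>q. \<rho> p q * (\<eta> q * laplacian A g w q)) = - I (grad (\<lambda>q. \<rho> p q * \<eta> q) w)" if p: "p \<in> P" for p
    proof -
      have "chart_int (ch p) (\<lambda>q. \<rho> p q * (\<eta> q * laplacian A g w q))
          = integral (img_chart (ch p)) (\<lambda>y. \<rho> p (inv_chart (ch p) y) * \<eta> (inv_chart (ch p) y)
              * laplacian_coord (g (ch p)) (w \<circ> inv_chart (ch p)) y * vol (ch p) y)"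
        unfolding chart_int_def by (intro integral_cong) (simp only: laplacian_in_chart[OF P(2)[OF p] _ w] mult.assoc)
      also have "\<dots> = - chart_int (ch p) (grad (\<lambda>q. \<rho> p q * \<eta> q) w)"
        by (rule green_in_chart[OF P(2)[OF p] \<rho>\<eta>[OF p] w])
      also have "\<dots> = - I (grad (\<lambda>q. \<rho> p q * \<eta> q) w)"
        using I_chart[OF P(2)[OF p] grad_Cfun[OF \<rho>\<eta>(1)[OF p] w1] supported_grad[OF P(2)[OF p] \<rho>\<eta>(2,1)[OF p]]] by simp
      finally show ?thesis .
    qed
    then have "I (\<lambda>q. \<eta> q * laplacian A g w q) = - (\<Sum>p\<in>P. I (grad (\<lambda>q. \<rho> p q * \<eta> q) w))"
      by (simp add: I_def[of "\<lambda>q. \<eta> q * laplacian A g w q"] sum_negf)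
    also have "(\<Sum>p\<in>P. I (grad (\<lambda>q. \<rho> p q * \<eta> q) w)) = I (\<lambda>q. \<Sum>p\<in>P. grad (\<lambda>q. \<rho> p q * \<eta> q) w q)"
      by (rule I_sum[symmetric]) (rule grad_Cfun[OF \<rho>\<eta>(1) w1])
    also have "\<dots> = I (grad \<eta> w)"
    proof -
      have "(\<Sum>p\<in>P. grad (\<lambda>q. \<rho> p q * \<eta> q) w q) = grad \<eta> w q" if q: "q \<in> topspace X" for q
      proof -
        define c where "c = chart_at A q"
        have c: "c \<in> A" "q \<in> dom_chart c" using chart_at[OF q] by (simp_all add: c_def)
        define y where "y = snd c q"
        have y: "y \<in> img_chart c" unfolding y_def using c(2) by (rule imageI)
        have dif: "((\<lambda>q. \<rho> p q * \<eta> q) \<circ> inv_chart c) differentiable (at y)" if "p \<in> P" for p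
          by (rule Ck_on_differentiable[OF chart_basic(2)[OF c(1)] CfunD[OF \<rho>\<eta>(1)[OF that] c(1)] y])
        have "(\<Sum>p\<in>P. partial i ((\<lambda>q. \<rho> p q * \<eta> q) \<circ> inv_chart c) y)
            = partial i (\<lambda>z. \<Sum>p\<in>P. ((\<lambda>q. \<rho> p q * \<eta> q) \<circ> inv_chart c) z) y" for i
          using partial_eqI[OF has_derivative_sum[of P, OF has_derivative_frechet[OF dif]]]
          by (simp add: partial_def)
        also have "partial i (\<lambda>z. \<Sum>p\<in>P. ((\<lambda>q. \<rho> p q * \<eta> q) \<circ> inv_chart c) z) y = partial i (\<eta> \<circ> inv_chart c) y" for i
          by (rule partial_cong[OF chart_basic(2)[OF c(1)] y]) (simp add: sum\<rho> inv_chart_in_space[OF c(1)])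
        finally have *: "(\<Sum>p\<in>P. partial i ((\<lambda>q. \<rho> p q * \<eta> q) \<circ> inv_chart c) y) = partial i (\<eta> \<circ> inv_chart c) y" for i .
        show ?thesis
          unfolding grad_def Let_def c_def[symmetric] y_def[symmetric] grad_prod_def sum_divide_distrib[symmetric]
            *[symmetric] sum_distrib_left sum_distrib_right
          by (simp add: sum.distrib sum_subtractf sum_distrib_left sum_distrib_right distrib_left)
      qed
      then show ?thesis unfolding I_def by (intro sum.cong refl chart_int_cong P(2)) auto
    qed
    finally show ?thesis .
  qed
  have u1: "Cfun (Suc 0) u" and v1: "Cfun (Suc 0) v" using Cfun_mono[OF u] Cfun_mono[OF v] by simp_all
  define s1 where "s1 q = u q * laplacian A g v q" for q
  define s2 where "s2 q = v q * laplacian A g u q" for q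
  have c12: "Cfun 0 s1" "Cfun 0 s2"
    unfolding s1_def[abs_def] s2_def[abs_def]
    by (intro Cfun_mult laplacian_Cfun u v Cfun_mono[OF u] Cfun_mono[OF v] le0)+
  have c3: "Cfun 0 (\<lambda>q. s1 q - s2 q)" by (rule Cfun_diff[OF c12])
  have "I (\<lambda>q. s1 q - s2 q) = I s1 - I s2"
  proof -
    have "chart_int (ch p) (\<lambda>q. \<rho> p q * (s1 q - s2 q))
        = chart_int (ch p) (\<lambda>q. \<rho> p q * s1 q) - chart_int (ch p) (\<lambda>q. \<rho> p q * s2 q)" if p: "p \<in> P" for p
      unfolding right_diff_distrib
      by (intro chart_int_diff P(2)[OF p] Cfun_mult \<rho>0[OF p] c12 supported_mult(1) P(4)[OF p])
    then show ?thesis by (simp add: I_def sum_subtractf)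
  qed
  also have "\<dots> = 0"
  proof -
    have "grad u v = grad v u" by (rule ext) (rule grad_sym)
    then show ?thesis using green[OF u1 v] green[OF v1 u] by (simp add: s1_def[abs_def] s2_def[abs_def])
  qed
  finally have I0: "I (\<lambda>q. s1 q - s2 q) = 0" .
  have ints: "(\<lambda>y. \<rho> p (inv_chart (ch p) y) * (s1 (inv_chart (ch p) y) - s2 (inv_chart (ch p) y)) * vol (ch p) y)
      integrable_on img_chart (ch p)" if p: "p \<in> P" for p
    using chart_integrable[OF P(2)[OF p] Ck_on_imp_cont[OF CfunD[OF Cfun_mult[OF \<rho>0[OF p] c3] P(2)[OF p]]] supported_mult(1)[OF P(4)[OF p]]]
    by (rule set_lebesgue_integral_eq_integral)
  have nonneg: "\<rho> p (inv_chart (ch p) y) * (s1 (inv_chart (ch p) y) - s2 (inv_chart (ch p) y)) * vol (ch p) y \<ge> 0"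
    if p: "p \<in> P" and y: "y \<in> img_chart (ch p)" for p y
    using P(5)[OF p inv_chart_in_space[OF P(2)[OF p] y]] nn[OF inv_chart_in_space[OF P(2)[OF p] y]] vol_pos[OF P(2)[OF p] y]
    by (simp add: s1_def s2_def)
  have terms: "chart_int (ch p) (\<lambda>q. \<rho> p q * (s1 q - s2 q)) \<ge> 0" if p: "p \<in> P" for p
    unfolding chart_int_def by (rule integral_nonneg[OF ints[OF p] nonneg[OF p]])
  obtain p where p: "p \<in> P" "\<rho> p p0 > 0"
  proof -
    have "\<not> (\<forall>p\<in>P. \<rho> p p0 \<le> 0)" using P(6)[OF p0(1)] sum_nonpos[of P "\<lambda>p. \<rho> p p0"] by force
    then show ?thesis using that by force
  qed
  have dom: "p0 \<in> dom_chart (ch p)"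
    using P(4)[OF p(1)] p0(1) p(2) unfolding supported_def by force
  define y where "y = snd (ch p) p0"
  have y: "y \<in> img_chart (ch p)" "inv_chart (ch p) y = p0"
    unfolding y_def using dom by (auto simp: inv_chart_chart[OF P(2)[OF p(1)] dom])
  have "chart_int (ch p) (\<lambda>q. \<rho> p q * (s1 q - s2 q)) > 0"
    unfolding chart_int_def
  proof (rule integral_pos_continuous[OF chart_basic(2)[OF P(2)[OF p(1)]] _ ints[OF p(1)] nonneg[OF p(1)] y(1)])
    show "continuous_on (img_chart (ch p)) (\<lambda>y. \<rho> p (inv_chart (ch p) y) * (s1 (inv_chart (ch p) y) - s2 (inv_chart (ch p) y)) * vol (ch p) y)"
      using Ck_on_imp_cont[OF CfunD[OF Cfun_mult[OF \<rho>0[OF p(1)] c3] P(2)[OF p(1)]]]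
        Ck_on_imp_cont[OF vol_smooth[OF P(2)[OF p(1)], of 0]]
      unfolding o_def by (rule continuous_on_mult)
    show "0 < \<rho> p (inv_chart (ch p) y) * (s1 (inv_chart (ch p) y) - s2 (inv_chart (ch p) y)) * vol (ch p) y"
      unfolding y(2) using p(2) p0(2) vol_pos[OF P(2)[OF p(1)] y(1)] by (simp add: s1_def s2_def)
  qed
  then have "I (\<lambda>q. s1 q - s2 q) > 0"
    unfolding I_def using P(1) p(1) terms by (intro sum_pos2) auto
  then show False using I0 by simp
qed

end

section \<open>Ricci flow in a chart\<close>

lemma Ck_on_eqI: "Ck_on k S f \<Longrightarrow> (\<And>x. x \<in> S \<Longrightarrow> h x = f x) \<Longrightarrow> Ck_on k S h"
  by (rule Ck_on_cong[THEN iffD2])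

definition tder :: "(real \<times> (real^2)) set \<Rightarrow> (real \<times> (real^2) \<Rightarrow> real) \<Rightarrow> real \<times> (real^2) \<Rightarrow> real" where
  "tder S F x = frechet_derivative F (at x within S) (1, 0)"

lemma tder_Ck: "Ck_on (Suc k) S F \<Longrightarrow> Ck_on k S (tder S F)"
  unfolding tder_def[abs_def] by (simp add: Ck_on.simps(2))

lemma time_slice_derivative:
  assumes F: "Ck_on (Suc k) (I \<times> U) F" and t: "t \<in> I" and y: "y \<in> U"
  shows "((\<lambda>s. F (s, y)) has_real_derivative tder (I \<times> U) F (t, y)) (at t within I)"
proof -
  let ?D = "frechet_derivative F (at (t, y) within I \<times> U)"
  have D: "(F has_derivative ?D) (at (t, y) within I \<times> U)"
    using Ck_on_deriv[OF F, of "(t, y)"] t y by simp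
  have "(F has_derivative ?D) (at (t, y) within (\<lambda>s. (s, y)) ` I)"
    by (rule has_derivative_subset[OF D]) (use y in auto)
  moreover have "((\<lambda>s. (s, y)) has_derivative (\<lambda>h. (h, 0))) (at t within I)"
    by (auto intro!: derivative_eq_intros)
  ultimately have "((\<lambda>s. F (s, y)) has_derivative (\<lambda>h. ?D (h, 0))) (at t within I)"
    using has_derivative_in_compose by blast
  moreover have "?D (h, 0) = tder (I \<times> U) F (t, y) * h" for h
    using linear_scale[OF has_derivative_linear[OF D], of h "(1, 0)"] by (simp add: tder_def)
  ultimately show ?thesis by (simp add: has_field_derivative_def)
qed

lemma space_slice_derivative:
  assumes F: "Ck_on (Suc k) (I \<times> U) F" and U: "open U" and t: "t \<in> I" and y: "y \<in> U"
  shows "((\<lambda>z. F (t, z)) has_derivative (\<lambda>v. frechet_derivative F (at (t, y) within I \<times> U) (0, v))) (at y)"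
proof -
  let ?D = "frechet_derivative F (at (t, y) within I \<times> U)"
  have D: "(F has_derivative ?D) (at (t, y) within I \<times> U)"
    using Ck_on_deriv[OF F, of "(t, y)"] t y by simp
  have "(F has_derivative ?D) (at (t, y) within (\<lambda>z. (t, z)) ` U)"
    by (rule has_derivative_subset[OF D]) (use t in auto)
  moreover have "((\<lambda>z. (t, z)) has_derivative (\<lambda>v. (0, v))) (at y within U)"
    by (auto intro!: derivative_eq_intros)
  ultimately have "((\<lambda>z. F (t, z)) has_derivative (\<lambda>v. ?D (0, v))) (at y within U)"
    using has_derivative_in_compose by blast
  then show ?thesis using at_within_open[OF y U] by simp
qed

lemma partial_slice:
  assumes "Ck_on (Suc k) (I \<times> U) F" "open U" "t \<in> I" "y \<in> U"
  shows "partial i (\<lambda>z. F (t, z)) y = frechet_derivative F (at (t, y) within I \<times> U) (0, axis i 1)"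
  by (rule partial_eqI[OF space_slice_derivative[OF assms]])

lemma Ck_on_partial_slice:
  assumes F: "Ck_on (Suc k) (I \<times> U) F" and U: "open U"
  shows "Ck_on k (I \<times> U) (\<lambda>(t, y). partial i (\<lambda>z. F (t, z)) y)"
proof -
  have "Ck_on k (I \<times> U) (\<lambda>x. frechet_derivative F (at x within I \<times> U) (0, axis i 1))"
    using F by (simp add: Ck_on.simps(2))
  moreover have "(\<lambda>(t, y). partial i (\<lambda>z. F (t, z)) y) x = frechet_derivative F (at x within I \<times> U) (0, axis i 1)"
    if "x \<in> I \<times> U" for x
    using that partial_slice[OF F U, of "fst x" "snd x"] by (simp add: case_prod_beta mem_Times_iff)
  ultimately show ?thesis by (rule Ck_on_eqI)
qed

lemma Ck_on_space_slice:
  assumes F: "Ck_on k (I \<times> U) F" and U: "open U" and t: "t \<in> I"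
  shows "Ck_on k U (\<lambda>y. F (t, y))"
  using F
proof (induction k arbitrary: F)
  case 0
  then have "continuous_on U (\<lambda>y. F (t, y))"
    by (intro continuous_on_compose2[OF Ck_on_imp_cont[OF 0]] continuous_on_Pair continuous_on_const continuous_on_id)
      (use t in blast)
  then show ?case by (simp add: Ck_on.simps)
next
  case (Suc k)
  show ?case
  proof (rule Ck_on_SucI[OF thick_open[OF U]])
    show "((\<lambda>y. F (t, y)) has_derivative (\<lambda>v. frechet_derivative F (at (t, y) within I \<times> U) (0, v))) (at y within U)"
      if "y \<in> U" for y
      using space_slice_derivative[OF Suc.prems U t that] has_derivative_at_withinI by blast
    show "Ck_on k U (\<lambda>y. frechet_derivative F (at (t, y) within I \<times> U) (0, v))" for v
      using Suc.IH[of "\<lambda>x. frechet_derivative F (at x within I \<times> U) (0, v)"] Suc.prems by (simp add: Ck_on.simps(2))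
  qed
qed

text \<open>Schwarz's theorem for a time and a space direction. The derivatives within the closed cylinder
are ordinary ones at interior times.\<close>

lemma partial_time_commute:
  assumes F: "Ck_on 2 ({0..T} \<times> U) F" and U: "open U" and t: "0 < t" "t < T" and y: "y \<in> U"
  shows "((\<lambda>s. partial i (\<lambda>z. F (s, z)) y) has_real_derivative
           partial i (\<lambda>z. tder ({0..T} \<times> U) F (t, z)) y) (at t)"
proof -
  define S where "S = {0..T} \<times> U"
  define W where "W = {0<..<T} \<times> U"
  have W: "open W" "W \<subseteq> S" unfolding W_def S_def using U by (auto intro: open_Times)
  have F2: "Ck_on (Suc (Suc 0)) S F" using F by (simp add: S_def numeral_2_eq_2)
  have FW: "Ck_on 2 W F" using Ck_on_open_subset[OF W] F by (simp add: S_def)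
  have within: "frechet_derivative G (at x within S) = frechet_derivative G (at x)" if "x \<in> W" for G :: "_ \<Rightarrow> real" and x
    by (metis W at_within_open_subset that)
  have ty: "(t, y) \<in> W" using t y by (simp add: W_def)
  have tI: "t \<in> {0..T}" using t by simp
  define D where "D = (\<lambda>(s, y). partial i (\<lambda>z. F (s, z)) y)"
  have DC: "Ck_on (Suc 0) S D" unfolding D_def S_def by (rule Ck_on_partial_slice[OF F2[unfolded S_def] U])
  have D_eq: "D x = frechet_derivative F (at x) (0, axis i 1)" if "x \<in> W" for x
  proof -
    have "D x = frechet_derivative F (at x within S) (0, axis i 1)"
      using partial_slice[OF F2[unfolded S_def] U] that W(2) unfolding D_def S_def W_def by auto
    then show ?thesis by (simp add: within[OF that])
  qed
  have dt: "((\<lambda>s. D (s, y)) has_real_derivative tder S D (t, y)) (at t)"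
    using time_slice_derivative[OF DC[unfolded S_def] tI y] t at_within_Icc_at[of 0 t T] by (simp add: S_def)
  have cong: "frechet_derivative G (at (t, y)) = frechet_derivative G' (at (t, y))"
    if "\<And>x. x \<in> W \<Longrightarrow> G x = G' x" for G G' :: "real \<times> (real^2) \<Rightarrow> real"
    using frechet_derivative_within_cong[of W G G', OF that ty] at_within_open[OF ty W(1)] by simp
  have "tder S D (t, y) = frechet_derivative (\<lambda>x. frechet_derivative F (at x) (0, axis i 1)) (at (t, y)) (1, 0)"
    unfolding tder_def within[OF ty] using cong[OF D_eq] by simp
  also have "\<dots> = frechet_derivative (\<lambda>x. frechet_derivative F (at x) (1, 0)) (at (t, y)) (0, axis i 1)"
    by (rule frechet_derivative_symmetric[OF W(1) FW ty])
  also have "\<dots> = frechet_derivative (tder S F) (at (t, y) within S) (0, axis i 1)"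
    unfolding within[OF ty] using cong[of "tder S F" "\<lambda>x. frechet_derivative F (at x) (1, 0)"]
    by (simp add: tder_def within)
  also have "\<dots> = partial i (\<lambda>z. tder S F (t, z)) y"
    using partial_slice[OF tder_Ck[OF F2, unfolded S_def] U tI y] by (simp add: S_def)
  finally show ?thesis using dt by (simp add: D_def S_def)
qed

lemma div_op_time_derivative:
  assumes F: "Ck_on 3 ({0..T} \<times> U) F" and U: "open U" and t: "0 < t" "t < T" and y: "y \<in> U"
    and c: "Ck_on (Suc 0) U e" "Ck_on (Suc 0) U f" "Ck_on (Suc 0) U h"
  shows "((\<lambda>s. div_op e f h (\<lambda>z. F (s, z)) y) has_real_derivative
           div_op e f h (\<lambda>z. tder ({0..T} \<times> U) F (t, z)) y) (at t)"
proof -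
  define S where "S = {0..T} \<times> U"
  have F3: "Ck_on (Suc 2) S F" using F by (simp add: S_def numeral_eq_Suc)
  have F2: "Ck_on 2 S F" by (rule Ck_on_SucD[OF F3])
  have Ft: "Ck_on 2 S (tder S F)" by (rule tder_Ck[OF F3])
  define P where "P j = (\<lambda>(s, y). partial j (\<lambda>z. F (s, z)) y)" for j
  have P2: "Ck_on 2 S (P j)" for j unfolding P_def S_def by (rule Ck_on_partial_slice[OF F3[unfolded S_def] U])
  have d1: "((\<lambda>s. partial j (\<lambda>z. F (s, z)) y) has_real_derivative partial j (\<lambda>z. tder S F (t, z)) y) (at t)"
    if "y \<in> U" for j y
    using partial_time_commute[OF F2[unfolded S_def] U t that] by (simp add: S_def)
  have tI: "t \<in> {0..T}" using t by simp
  have tP: "tder S (P j) (t, z) = partial j (\<lambda>z. tder S F (t, z)) z" if z: "z \<in> U" for j z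
  proof -
    have P2': "Ck_on (Suc (Suc 0)) ({0..T} \<times> U) (P j)" using P2[of j] by (simp add: S_def numeral_2_eq_2)
    have "((\<lambda>s. partial j (\<lambda>z. F (s, z)) z) has_real_derivative tder S (P j) (t, z)) (at t)"
      using time_slice_derivative[OF P2' tI z] t at_within_Icc_at[of 0 t T] by (simp add: S_def P_def)
    then show ?thesis using d1[OF z] DERIV_unique by blast
  qed
  have d2: "((\<lambda>s. partial i (partial j (\<lambda>z. F (s, z))) y) has_real_derivative
      partial i (partial j (\<lambda>z. tder S F (t, z))) y) (at t)" for i j
  proof -
    have "((\<lambda>s. partial i (\<lambda>z. P j (s, z)) y) has_real_derivative partial i (\<lambda>z. tder S (P j) (t, z)) y) (at t)"
      using partial_time_commute[OF P2[unfolded S_def] U t y] by (simp add: S_def)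
    moreover have "partial i (\<lambda>z. tder S (P j) (t, z)) y = partial i (partial j (\<lambda>z. tder S F (t, z))) y"
      by (rule partial_cong[OF U y tP])
    ultimately show ?thesis by (simp add: P_def)
  qed
  define Y where "Y w = h y * partial 1 (partial 1 w) y - 2 * f y * partial 1 (partial 2 w) y
     + e y * partial 2 (partial 2 w) y
     + (partial 1 h y - partial 2 f y) * partial 1 w y + (partial 2 e y - partial 1 f y) * partial 2 w y"
    for w :: "real^2 \<Rightarrow> real"
  have "((\<lambda>s. Y (\<lambda>z. F (s, z))) has_real_derivative Y (\<lambda>z. tder S F (t, z))) (at t)"
    unfolding Y_def by (intro DERIV_add DERIV_diff DERIV_cmult d2 d1 y)
  moreover have "div_op e f h (\<lambda>z. F (s, z)) y = Y (\<lambda>z. F (s, z))" if "s \<in> {0<..<T}" for s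
    unfolding Y_def
    by (rule div_op_expand[OF U y _ c]) (rule Ck_on_space_slice[OF F2[unfolded S_def] U], use that in auto)
  moreover have "div_op e f h (\<lambda>z. tder S F (t, z)) y = Y (\<lambda>z. tder S F (t, z))"
    unfolding Y_def
    by (rule div_op_expand[OF U y _ c]) (rule Ck_on_space_slice[OF Ft[unfolded S_def] U tI, folded S_def])
  ultimately show ?thesis
    unfolding S_def[symmetric]
    using has_field_derivative_transform_within_open[of "\<lambda>s. Y (\<lambda>z. F (s, z))" _ t "{0<..<T}"] t by auto
qed

lemma div_op_cong:
  assumes U: "open U" and y: "y \<in> U" and eq: "\<And>z. z \<in> U \<Longrightarrow> e z = e' z" "\<And>z. z \<in> U \<Longrightarrow> f z = f' z"
    "\<And>z. z \<in> U \<Longrightarrow> h z = h' z" "\<And>z. z \<in> U \<Longrightarrow> u z = u' z"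
  shows "div_op e f h u y = div_op e' f' h' u' y"
proof -
  have p: "partial i u z = partial i u' z" if "z \<in> U" for i z by (rule partial_cong[OF U that eq(4)])
  show ?thesis unfolding div_op_def
    by (intro arg_cong2[where f = "(+)"] partial_cong[OF U y]) (simp_all add: eq p)
qed

lemma conf_curv_cong:
  assumes U: "open U" and y: "y \<in> U" and eq: "\<And>z. z \<in> U \<Longrightarrow> e z = e' z" "\<And>z. z \<in> U \<Longrightarrow> f z = f' z"
    "\<And>z. z \<in> U \<Longrightarrow> h z = h' z"
  shows "conf_curv e f h y = conf_curv e' f' h' y"
proof -
  have p: "partial i e z = partial i e' z" "partial i f z = partial i f' z" "partial i h z = partial i h' z"
    if "z \<in> U" for i z by (rule partial_cong[OF U that eq(1)], assumption, rule partial_cong[OF U that eq(2)], assumption,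
        rule partial_cong[OF U that eq(3)], assumption)
  show ?thesis unfolding conf_curv_def
    by (intro arg_cong2[where f = "(-)"] partial_cong[OF U y]) (simp_all add: eq p)
qed

lemma div_op_affine:
  assumes U: "open U" and y: "y \<in> U" and u: "Ck_on 2 U u"
    and c: "Ck_on (Suc 0) U e" "Ck_on (Suc 0) U f" "Ck_on (Suc 0) U h"
  shows "div_op e f h (\<lambda>z. a * u z + b) y = a * div_op e f h u y"
proof -
  have u': "Ck_on (Suc (Suc 0)) U u" using u by (simp add: numeral_2_eq_2)
  have p: "partial i (\<lambda>z. a * u z + b) z = a * partial i u z" if "z \<in> U" for i z
    using Ck_on_differentiable[OF U u' that] by (simp add: partial_add partial_cmult)
  have pp: "partial j (partial i (\<lambda>z. a * u z + b)) y = a * partial j (partial i u) y" for i j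
    by (subst partial_cong[OF U y p])
      (simp_all add: partial_cmult Ck_on_differentiable[OF U Ck_on_partial[OF U u'] y])
  have au: "Ck_on 2 U (\<lambda>z. a * u z + b)"
    by (intro Ck_on_add Ck_on_mult Ck_on_const thick_open U u)
  show ?thesis
    unfolding div_op_expand[OF U y au c] div_op_expand[OF U y u c] pp p[OF y] by (simp add: algebra_simps)
qed

lemma DERIV_within_Icc_unique:
  assumes "0 < T" "t \<in> {0..T}"
    and "(f has_real_derivative a) (at t within {0..T})" "(f has_real_derivative b) (at t within {0..T})"
  shows "a = b"
proof -
  have "(*) a = (*) b"
    using assms(3,4) frechet_derivative_within_eq[OF thick_Icc[OF assms(1)] assms(2)]
    unfolding has_field_derivative_def by metis
  from fun_cong[OF this, of 1] show ?thesis by simp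
qed

locale surface_ricci_flow = surface +
  fixes T :: real and g :: "real \<Rightarrow> ('a, 2) tensor02"
  assumes T: "0 < T" and flow: "ricci_flow A T g"
begin

lemma riemannian_surface: "t \<in> {0..T} \<Longrightarrow> riemannian_surface X A (g t)"
  using flow by unfold_locales (auto simp: ricci_flow_def smooth_metric_family_def)

lemma metric2: "t \<in> {0..T} \<Longrightarrow> c \<in> A \<Longrightarrow> metric2 (img_chart c) (g t c)"
  by (rule riemannian_surface.metric2[OF riemannian_surface])

abbreviation "cyl c \<equiv> {0..T} \<times> img_chart c"

lemma thick_cyl: "c \<in> A \<Longrightarrow> thick (cyl c)"
  by (intro thick_Times thick_Icc T thick_img)

definition "W c = (\<lambda>(t, y). metric2.vol (g t c) y)"
definition "R c = (\<lambda>(t, y). scalar_coord (g t c) y)"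

lemma W_pos: "c \<in> A \<Longrightarrow> t \<in> {0..T} \<Longrightarrow> y \<in> img_chart c \<Longrightarrow> W c (t, y) > 0"
  using metric2.vol_pos[OF metric2] by (simp add: W_def)

lemma W_smooth: assumes c: "c \<in> A" shows "Ck_on k (cyl c) (W c)"
proof -
  define G where "G i j = (\<lambda>x. (case x of (t, y) \<Rightarrow> g t c y) $ i $ j)" for i j :: 2
  have "Ck_on k (cyl c) (\<lambda>(t, y). g t c y)"
    using flow c unfolding ricci_flow_def smooth_metric_family_def smooth_on_def by blast
  from Ck_on_linear_comp[OF thick_cyl[OF c] bounded_linear_compose[OF bounded_linear_vec_nth bounded_linear_vec_nth] this]
  have G: "Ck_on k (cyl c) (G i j)" for i j unfolding G_def .
  have pos: "G 1 1 x * G 2 2 x - (G 1 2 x)\<^sup>2 > 0" if "x \<in> cyl c" for x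
    using that metric2.D_pos[OF metric2[OF _ c]] by (auto simp: G_def metric2.coef_def[OF metric2[OF _ c]])
  have "Ck_on k (cyl c) (\<lambda>x. sqrt (G 1 1 x * G 2 2 x - (G 1 2 x)\<^sup>2))"
    by (intro Ck_on_sqrt Ck_on_diff Ck_on_mult Ck_on_power2 G pos thick_cyl c)
  moreover have "W c x = sqrt (G 1 1 x * G 2 2 x - (G 1 2 x)\<^sup>2)" if "x \<in> cyl c" for x
    using that metric2.vol_def[OF metric2[OF _ c]] by (auto simp: W_def G_def metric2.coef_def[OF metric2[OF _ c]])
  ultimately show ?thesis by (rule Ck_on_eqI)
qed

lemma metric_derivative:
  assumes c: "c \<in> A" and t: "t \<in> {0..T}" and y: "y \<in> img_chart c"
  shows "((\<lambda>s. g s c y $ i $ j) has_real_derivative - R c (t, y) * g t c y $ i $ j) (at t within {0..T})"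
proof -
  interpret M: metric2 "img_chart c" "g t c" by (rule metric2[OF t c])
  have "((\<lambda>s. g s c y) has_vector_derivative (- 2) *\<^sub>R ricci_coord (g t c) y) (at t within {0..T})"
    using flow c t y unfolding ricci_flow_def ricci_def by blast
  from bounded_linear.has_vector_derivative[OF bounded_linear_compose[OF bounded_linear_vec_nth bounded_linear_vec_nth] this]
  have "((\<lambda>s. g s c y $ i $ j) has_vector_derivative ((- 2) *\<^sub>R ricci_coord (g t c) y) $ i $ j) (at t within {0..T})" .
  moreover have "((- 2) *\<^sub>R ricci_coord (g t c) y) $ i $ j = - R c (t, y) * g t c y $ i $ j"
    using M.ricci_conformal(1)[OF y, of i j] by (simp add: R_def M.coef_def)
  ultimately show ?thesis by (simp add: has_real_derivative_iff_has_vector_derivative)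
qed

lemma W_derivative:
  assumes c: "c \<in> A" and t: "t \<in> {0..T}" and y: "y \<in> img_chart c"
  shows "((\<lambda>s. W c (s, y)) has_real_derivative - R c (t, y) * W c (t, y)) (at t within {0..T})"
proof -
  define D where "D s = g s c y $ 1 $ 1 * g s c y $ 2 $ 2 - g s c y $ 1 $ 2 * g s c y $ 1 $ 2" for s
  have WD: "W c (s, y) = sqrt (D s)" "D s > 0" if "s \<in> {0..T}" for s
    using metric2.vol_def[OF metric2[OF that c]] metric2.D_pos[OF metric2[OF that c] y]
    by (simp_all add: W_def D_def metric2.coef_def[OF metric2[OF that c]] power2_eq_square)
  note d = metric_derivative[OF c t y]
  have "(D has_real_derivative - 2 * R c (t, y) * D t) (at t within {0..T})"
    unfolding D_def by (rule DERIV_cong[OF DERIV_diff[OF DERIV_mult[OF d d] DERIV_mult[OF d d]]]) (simp add: algebra_simps)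
  from DERIV_chain2[OF DERIV_real_sqrt[OF WD(2)[OF t]] this]
  have "((\<lambda>s. sqrt (D s)) has_real_derivative inverse (sqrt (D t)) / 2 * (- 2 * R c (t, y) * D t)) (at t within {0..T})" .
  moreover have "inverse (sqrt (D t)) / 2 * (- 2 * R c (t, y) * D t) = - R c (t, y) * W c (t, y)"
    unfolding WD(1)[OF t] using WD(2)[OF t] by (simp add: field_simps)
  ultimately have "((\<lambda>s. sqrt (D s)) has_real_derivative - R c (t, y) * W c (t, y)) (at t within {0..T})" by (simp only:)
  then show ?thesis
    by (rule has_field_derivative_transform_within[OF _ zero_less_one t]) (simp add: WD(1))
qed

text \<open>This expresses the curvature by the area density and its time derivative, so that it is smooth in
time and space jointly because the metric is.\<close>

lemma R_eq: "c \<in> A \<Longrightarrow> t \<in> {0..T} \<Longrightarrow> y \<in> img_chart c \<Longrightarrow> R c (t, y) = - tder (cyl c) (W c) (t, y) / W c (t, y)"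
proof -
  assume c: "c \<in> A" and t: "t \<in> {0..T}" and y: "y \<in> img_chart c"
  have "- R c (t, y) * W c (t, y) = tder (cyl c) (W c) (t, y)"
    by (rule DERIV_within_Icc_unique[OF T t W_derivative[OF c t y]
          time_slice_derivative[OF W_smooth[OF c, of "Suc 0"] t y]])
  then show ?thesis using W_pos[OF c t y] by (simp add: field_simps)
qed

lemma R_smooth: assumes c: "c \<in> A" shows "Ck_on k (cyl c) (R c)"
proof -
  have "Ck_on k (cyl c) (\<lambda>x. - tder (cyl c) (W c) x / W c x)"
    by (intro Ck_on_divide Ck_on_uminus tder_Ck W_smooth thick_cyl c)
      (use W_pos[OF c] in \<open>simp only: mem_Times_iff split_paired_all fst_conv snd_conv, metis less_irrefl\<close>)
  then show ?thesis
    by (rule Ck_on_eqI) (use R_eq[OF c] in \<open>simp only: mem_Times_iff split_paired_all fst_conv snd_conv\<close>)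
qed

text \<open>The flow changes the metric and its area density at the same relative rate \<open>- R\<close>.\<close>

lemma cf_constant:
  assumes c: "c \<in> A" and t: "t \<in> {0..T}" and s: "s \<in> {0..T}" and y: "y \<in> img_chart c"
  shows "metric2.cf (g t c) i j y = metric2.cf (g s c) i j y"
proof -
  define q where "q s = g s c y $ i $ j / W c (s, y)" for s
  have "(q has_real_derivative 0) (at s within {0..T})" if s: "s \<in> {0..T}" for s
  proof -
    have nz: "W c (s, y) \<noteq> 0" using W_pos[OF c s y] by simp
    show ?thesis unfolding q_def
      by (rule DERIV_cong[OF DERIV_divide[OF metric_derivative[OF c s y] W_derivative[OF c s y] nz]])
        (simp add: algebra_simps)
  qed
  then obtain k where "\<And>s. s \<in> {0..T} \<Longrightarrow> q s = k"
    using has_field_derivative_zero_constant[of "{0..T}" q] by auto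
  then have "q t = q s" using t s by simp
  then show ?thesis
    by (simp add: q_def W_def metric2.cf_def[OF metric2[OF t c]] metric2.cf_def[OF metric2[OF s c]]
        metric2.coef_def[OF metric2[OF t c]] metric2.coef_def[OF metric2[OF s c]])
qed

text \<open>The area density times the Laplacian of \<open>g t\<close>.\<close>

definition "L t c = div_op (metric2.cf (g t c) 1 1) (metric2.cf (g t c) 1 2) (metric2.cf (g t c) 2 2)"

lemma L_constant:
  assumes "c \<in> A" "t \<in> {0..T}" "s \<in> {0..T}" "y \<in> img_chart c"
  shows "L s c u y = L t c u y"
  unfolding L_def
  by (rule div_op_cong[OF chart_basic(2)[OF assms(1)] assms(4)])
    (rule cf_constant[OF assms(1,3,2)] refl, assumption?)+

lemma L_time_derivative:
  assumes c: "c \<in> A" and F: "Ck_on 3 (cyl c) F" and t: "0 < t" "t < T" and y: "y \<in> img_chart c"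
  shows "((\<lambda>s. L s c (\<lambda>z. F (s, z)) y) has_real_derivative L t c (\<lambda>z. tder (cyl c) F (t, z)) y) (at t)"
proof -
  have tI: "t \<in> {0..T}" using t by simp
  note cf = metric2.cf_smooth[OF metric2[OF tI c]]
  have "((\<lambda>s. L t c (\<lambda>z. F (s, z)) y) has_real_derivative L t c (\<lambda>z. tder (cyl c) F (t, z)) y) (at t)"
    unfolding L_def by (rule div_op_time_derivative[OF F chart_basic(2)[OF c] t y cf cf cf])
  then show ?thesis
    by (rule has_field_derivative_transform_within_open[of _ _ _ "{0<..<T}"])
      (use t tI in \<open>auto intro!: L_constant[OF c _ _ y]\<close>)
qed

text \<open>The time derivative of \<open>scalar_conformal\<close>. On its right-hand side only \<open>ln W\<close> depends on time, and
its time derivative is \<open>- R\<close>.\<close>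

lemma curvature_evolution:
  assumes c: "c \<in> A" and t: "0 < t" "t < T" and y: "y \<in> img_chart c"
  shows "((\<lambda>s. R c (s, y)) has_real_derivative L t c (\<lambda>z. R c (t, z)) y / W c (t, y) + (R c (t, y))\<^sup>2) (at t)"
proof -
  have tI: "t \<in> {0..T}" using t by simp
  have at: "at t within {0..T} = at t" using t by (simp add: at_within_Icc_at)
  define \<psi> where "\<psi> x = ln (W c x)" for x
  have \<psi>: "Ck_on k (cyl c) \<psi>" for k
    unfolding \<psi>_def[abs_def] by (intro Ck_on_ln thick_cyl W_smooth c) (use W_pos[OF c] in auto)
  define \<kappa> where "\<kappa> s = conf_curv (metric2.cf (g s c) 1 1) (metric2.cf (g s c) 1 2) (metric2.cf (g s c) 2 2) y" for s
  have \<kappa>: "\<kappa> s = \<kappa> t" if "s \<in> {0..T}" for s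
    unfolding \<kappa>_def
    by (rule conf_curv_cong[OF chart_basic(2)[OF c] y])
      (rule cf_constant[OF c that tI], assumption)+
  have WR: "W c (s, y) * R c (s, y) = \<kappa> t - L s c (\<lambda>z. \<psi> (s, z)) y" if s: "s \<in> {0..T}" for s
    unfolding \<kappa>[OF s, symmetric]
    using metric2.scalar_conformal[OF metric2[OF s c] y] by (simp add: W_def R_def \<kappa>_def L_def \<psi>_def)
  have t\<psi>: "tder (cyl c) \<psi> (t, z) = - 1 * R c (t, z)" if z: "z \<in> img_chart c" for z
  proof -
    have "((\<lambda>s. \<psi> (s, z)) has_real_derivative tder (cyl c) \<psi> (t, z)) (at t)"
      using time_slice_derivative[OF \<psi>[of "Suc 0"] tI z] by (simp add: at)
    moreover have "((\<lambda>s. \<psi> (s, z)) has_real_derivative inverse (W c (t, z)) * (- R c (t, z) * W c (t, z))) (at t)"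
      unfolding \<psi>_def using DERIV_chain2[OF DERIV_ln[OF W_pos[OF c tI z]] W_derivative[OF c tI z]] by (simp add: at)
    ultimately have "tder (cyl c) \<psi> (t, z) = inverse (W c (t, z)) * (- R c (t, z) * W c (t, z))"
      by (rule DERIV_unique)
    then show ?thesis using W_pos[OF c tI z] by simp
  qed
  have RC: "Ck_on 2 (img_chart c) (\<lambda>z. R c (t, z))"
    by (rule Ck_on_space_slice[OF R_smooth[OF c] chart_basic(2)[OF c] tI])
  have "((\<lambda>s. W c (s, y) * R c (s, y)) has_real_derivative 0 - L t c (\<lambda>z. tder (cyl c) \<psi> (t, z)) y) (at t)"
  proof (rule has_field_derivative_transform_within_open[of _ _ _ "{0<..<T}"])
    show "((\<lambda>s. \<kappa> t - L s c (\<lambda>z. \<psi> (s, z)) y) has_real_derivative 0 - L t c (\<lambda>z. tder (cyl c) \<psi> (t, z)) y) (at t)"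
      by (intro DERIV_diff DERIV_const L_time_derivative[OF c \<psi> t y])
  qed (use t WR in auto)
  moreover have "L t c (\<lambda>z. tder (cyl c) \<psi> (t, z)) y = - L t c (\<lambda>z. R c (t, z)) y"
  proof -
    note cf = metric2.cf_smooth[OF metric2[OF tI c]]
    have "L t c (\<lambda>z. tder (cyl c) \<psi> (t, z)) y = L t c (\<lambda>z. - 1 * R c (t, z) + 0) y"
      unfolding L_def by (rule div_op_cong[OF chart_basic(2)[OF c] y]) (simp_all add: t\<psi>)
    also have "\<dots> = - 1 * L t c (\<lambda>z. R c (t, z)) y"
      unfolding L_def by (rule div_op_affine[OF chart_basic(2)[OF c] y RC cf cf cf])
    finally show ?thesis by simp
  qed
  ultimately have d: "((\<lambda>s. W c (s, y) * R c (s, y)) has_real_derivative L t c (\<lambda>z. R c (t, z)) y) (at t)"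
    by simp
  have nz: "W c (t, y) \<noteq> 0" using W_pos[OF c tI y] by simp
  have dW: "((\<lambda>s. W c (s, y)) has_real_derivative - R c (t, y) * W c (t, y)) (at t)"
    using W_derivative[OF c tI y] by (simp add: at)
  have "((\<lambda>s. (W c (s, y) * R c (s, y)) / W c (s, y)) has_real_derivative
      L t c (\<lambda>z. R c (t, z)) y / W c (t, y) + (R c (t, y))\<^sup>2) (at t)"
    by (rule DERIV_cong[OF DERIV_divide[OF d dW nz]]) (use nz in \<open>simp add: field_simps power2_eq_square\<close>)
  then show ?thesis
  proof (rule has_field_derivative_transform_within_open[of _ _ _ "{0<..<T}"])
    fix s assume "s \<in> {0<..<T}"
    then have "W c (s, y) > 0" by (intro W_pos[OF c _ y]) auto
    then show "W c (s, y) * R c (s, y) / W c (s, y) = R c (s, y)" by simp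
  qed (use t in auto)
qed

section \<open>The minimum principle and the eigenvalue\<close>

lemma L_affine:
  assumes c: "c \<in> A" and t: "t \<in> {0..T}" and y: "y \<in> img_chart c" and u: "Ck_on 2 (img_chart c) u"
  shows "L t c (\<lambda>z. a * u z + b) y = a * L t c u y"
proof -
  note cf = metric2.cf_smooth[OF metric2[OF t c]]
  show ?thesis unfolding L_def by (rule div_op_affine[OF chart_basic(2)[OF c] y u cf cf cf])
qed

lemma L_local_min:
  assumes c: "c \<in> A" and t: "t \<in> {0..T}" and y: "y \<in> img_chart c" and u: "Ck_on 2 (img_chart c) u"
    and min: "\<And>z. z \<in> img_chart c \<Longrightarrow> u y \<le> u z"
  shows "L t c u y \<ge> 0"
proof -
  interpret M: metric2 "img_chart c" "g t c" by (rule metric2[OF t c])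
  show ?thesis
    unfolding L_def
  proof (rule div_op_local_min[OF chart_basic(2)[OF c] y u min M.cf_smooth M.cf_smooth M.cf_smooth])
    show "M.cf 1 1 y > 0" using M.E_pos[OF y] M.vol_pos[OF y] by (simp add: M.cf_def)
    have "M.cf 1 1 y * M.cf 2 2 y - (M.cf 1 2 y)\<^sup>2 = (M.coef 1 1 y * M.coef 2 2 y - (M.coef 1 2 y)\<^sup>2) / (M.vol y)\<^sup>2"
      by (simp add: M.cf_def power2_eq_square diff_divide_distrib)
    then show "M.cf 1 1 y * M.cf 2 2 y - (M.cf 1 2 y)\<^sup>2 \<ge> 0" using M.D_pos[OF y] by simp
  qed
qed

text \<open>The area densities of two charts differ by a factor independent of time, and \<open>- R\<close> is their
logarithmic time derivative.\<close>

lemma R_invariant: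
  assumes c: "c \<in> A" and d: "d \<in> A" and t: "t \<in> {0..T}" and y: "y \<in> overlap c d"
  shows "R c (t, y) = R d (t, transition c d y)"
proof -
  define k where "k = \<bar>det (matrix (frechet_derivative (transition c d) (at y)))\<bar>"
  define z where "z = transition c d y"
  have yc: "y \<in> img_chart c" by (rule subsetD[OF overlap_subset y])
  have zd: "z \<in> img_chart d" unfolding z_def by (rule subsetD[OF overlap_subset transition_in_overlap[OF c d y]])
  have eq: "W c (s, y) = k * W d (s, z)" if "s \<in> {0..T}" for s
    using riemannian_surface.transition_vol_and_gradient(1)[OF riemannian_surface[OF that] c d y]
    by (simp add: W_def k_def z_def)
  have "((\<lambda>s. k * W d (s, z)) has_real_derivative k * (- R d (t, z) * W d (t, z))) (at t within {0..T})"
    by (rule DERIV_cmult[OF W_derivative[OF d t zd]])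
  then have "((\<lambda>s. W c (s, y)) has_real_derivative k * (- R d (t, z) * W d (t, z))) (at t within {0..T})"
    by (rule has_field_derivative_transform_within[OF _ zero_less_one t]) (simp add: eq)
  from DERIV_within_Icc_unique[OF T t this W_derivative[OF c t yc]]
  have "R d (t, z) * (k * W d (t, z)) = R c (t, y) * W c (t, y)" by (simp add: mult_ac)
  then have "R d (t, z) * W c (t, y) = R c (t, y) * W c (t, y)" unfolding eq[OF t] .
  then show ?thesis using W_pos[OF c t yc] by (simp add: z_def)
qed

lemma scalar_curvature_in_chart:
  assumes c: "c \<in> A" and t: "t \<in> {0..T}" and y: "y \<in> img_chart c"
  shows "scalar_curvature A (g t) (inv_chart c y) = R c (t, y)"
proof -
  define d where "d = chart_at A (inv_chart c y)"
  have d: "d \<in> A" "inv_chart c y \<in> dom_chart d"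
    using chart_at[OF inv_chart_in_space[OF c y]] by (simp_all add: d_def)
  have o: "y \<in> overlap c d" using y d by (simp add: overlap_eq[OF c])
  show ?thesis unfolding R_invariant[OF c d(1) t o]
    by (simp add: scalar_curvature_def Let_def d_def[symmetric] R_def transition_eq)
qed

lemma scalar_curvature_continuous:
  assumes c: "c \<in> A" and J: "J \<subseteq> {0..T}"
  shows "continuous_on (J \<times> img_chart c) (\<lambda>(t, y). scalar_curvature A (g t) (inv_chart c y))"
proof -
  have "continuous_on (J \<times> img_chart c) (R c)"
    by (rule continuous_on_subset[OF Ck_on_imp_cont[OF R_smooth[OF c]] Sigma_mono[OF J order_refl]])
  then show ?thesis
    by (rule continuous_on_eq) (use J scalar_curvature_in_chart[OF c] in \<open>simp only: mem_Times_iff case_prod_beta prod.collapse subset_eq\<close>)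
qed

text \<open>The minimum principle for \<open>Q = (1 - m t) R - m\<close>, which solves \<open>\<partial>\<^sub>t Q = \<Delta> Q + R Q\<close>. Multiplication by
\<open>exp (- K t)\<close> with \<open>K > R\<close> makes the zeroth-order coefficient negative. At a negative minimum the
right-hand side is then positive, so that the function was smaller at an earlier time.\<close>

lemma curvature_barrier:
  assumes m: "\<And>p. p \<in> topspace X \<Longrightarrow> m \<le> scalar_curvature A (g 0) p"
    and t: "0 \<le> t" "t < T" and p: "p \<in> topspace X"
  shows "m \<le> (1 - m * t) * scalar_curvature A (g t) p"
proof -
  define J where "J = {0..t}"
  have J: "compact J" "J \<noteq> {}" "J \<subseteq> {0..T}" using t by (auto simp: J_def)
  have X: "topspace X \<noteq> {}" using p by blast
  define S where "S t p = scalar_curvature A (g t) p" for t p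
  have contS: "continuous_on (J \<times> img_chart c) (\<lambda>x. S (fst x) (inv_chart c (snd x)))" if "c \<in> A" for c
    using scalar_curvature_continuous[OF that J(3)] by (simp add: S_def case_prod_beta)
  have "continuous_on (J \<times> img_chart c) (\<lambda>(s, y). - S s (inv_chart c y))" if "c \<in> A" for c
    unfolding case_prod_beta by (intro continuous_on_minus contS that)
  from attains_min[where Q = "\<lambda>s q. - S s q", OF J(1,2) X this]
  obtain s0 q0 where sq: "\<And>s q. s \<in> J \<Longrightarrow> q \<in> topspace X \<Longrightarrow> - S s0 q0 \<le> - S s q" by metis
  define K where "K = S s0 q0 + 1"
  have K: "S s q < K" if "s \<in> J" "q \<in> topspace X" for s q using sq[OF that] by (simp add: K_def)
  define Q where "Q s q = exp (- K * s) * ((1 - m * s) * S s q - m)" for s q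
  have "continuous_on (J \<times> img_chart c) (\<lambda>(s, y). Q s (inv_chart c y))" if "c \<in> A" for c
    unfolding case_prod_beta Q_def by (intro continuous_intros contS that)
  from attains_min[where Q = Q, OF J(1,2) X this]
  obtain t0 p0 where t0: "t0 \<in> J" and p0: "p0 \<in> topspace X"
    and min: "\<And>s q. s \<in> J \<Longrightarrow> q \<in> topspace X \<Longrightarrow> Q t0 p0 \<le> Q s q" by metis
  have "Q t0 p0 \<ge> 0"
  proof (rule ccontr)
    assume "\<not> Q t0 p0 \<ge> 0"
    then have neg: "(1 - m * t0) * S t0 p0 - m < 0" by (simp add: Q_def zero_le_mult_iff not_le)
    have "t0 \<noteq> 0" using neg m[OF p0] by (auto simp: S_def)
    then have t0': "0 < t0" "t0 < T" "t0 \<in> {0..T}" using t0 t by (auto simp: J_def)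
    obtain c where c: "c \<in> A" "p0 \<in> dom_chart c" using chart_cover[OF p0] by blast
    define y where "y = snd c p0"
    have y: "y \<in> img_chart c" unfolding y_def using c(2) by (rule imageI)
    have py: "inv_chart c y = p0" unfolding y_def by (rule inv_chart_chart[OF c])
    have SR: "S s (inv_chart c z) = R c (s, z)" if "s \<in> {0..T}" "z \<in> img_chart c" for s z
      using scalar_curvature_in_chart[OF c(1) that] by (simp add: S_def)
    define r where "r = R c (t0, y)"
    define l where "l = L t0 c (\<lambda>z. R c (t0, z)) y"
    have RC: "Ck_on 2 (img_chart c) (\<lambda>z. R c (t0, z))"
      by (rule Ck_on_space_slice[OF R_smooth[OF c(1)] chart_basic(2)[OF c(1)] t0'(3)])
    have r: "S t0 p0 = r" using SR[OF t0'(3) y] by (simp add: py r_def)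
    \<comment> \<open>The minimum is one in space as well, so the elliptic term is nonnegative.\<close>
    have lpos: "(1 - m * t0) * l \<ge> 0"
    proof -
      have "L t0 c (\<lambda>z. (1 - m * t0) * R c (t0, z) + - m) y \<ge> 0"
      proof (rule L_local_min[OF c(1) t0'(3) y])
        show "Ck_on 2 (img_chart c) (\<lambda>z. (1 - m * t0) * R c (t0, z) + - m)"
          by (intro Ck_on_add Ck_on_mult Ck_on_const thick_img c RC)
        show "(1 - m * t0) * R c (t0, y) + - m \<le> (1 - m * t0) * R c (t0, z) + - m" if z: "z \<in> img_chart c" for z
          using min[OF t0 inv_chart_in_space[OF c(1) z]] SR[OF t0'(3) z] r by (simp add: Q_def r_def)
      qed
      then show ?thesis unfolding L_affine[OF c(1) t0'(3) y RC] l_def .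
    qed
    define w where "w = W c (t0, y)"
    have w: "w > 0" unfolding w_def by (rule W_pos[OF c(1) t0'(3) y])
    define v where "v = l / w"
    define q where "q s = exp (- K * s) * ((1 - m * s) * R c (s, y) - m)" for s
    have dR: "((\<lambda>s. R c (s, y)) has_real_derivative v + r\<^sup>2) (at t0)"
      using curvature_evolution[OF c(1) t0'(1,2) y] by (simp add: v_def l_def w_def r_def)
    define D where "D = exp (- K * t0) * ((1 - m * t0) * v + (r - K) * ((1 - m * t0) * r - m))"
    have "(q has_real_derivative D) (at t0)"
      unfolding q_def[abs_def] D_def
      by (rule derivative_eq_intros dR refl)+ (simp add: r_def[symmetric] algebra_simps power2_eq_square)
    moreover have "D > 0"
    proof -
      have "r < K" using K[OF t0 p0] r by simp
      then have "(r - K) * ((1 - m * t0) * r - m) > 0" using neg r by (simp add: mult_neg_neg)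
      moreover have "(1 - m * t0) * v \<ge> 0" using lpos w by (simp add: v_def)
      ultimately show ?thesis by (simp add: D_def)
    qed
    ultimately obtain d where d: "d > 0" "\<And>h. 0 < h \<Longrightarrow> h < d \<Longrightarrow> q (t0 - h) < q t0"
      using DERIV_pos_inc_left by blast
    define h where "h = min d t0 / 2"
    have h: "0 < h" "h < d" "h < t0" using d(1) t0'(1) by (auto simp: h_def)
    have hJ: "t0 - h \<in> J" "t0 - h \<in> {0..T}" using h t0 t by (auto simp: J_def)
    have "Q t0 p0 \<le> Q (t0 - h) p0" by (rule min[OF hJ(1) p0])
    moreover have "Q s p0 = q s" if "s \<in> {0..T}" for s
      using SR[OF that y] by (simp add: Q_def q_def py)
    ultimately show False using d(2)[OF h(1,2)] hJ(2) t0'(3) by (metis not_less)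
  qed
  then have "0 \<le> Q t p" using min[of t p] t p by (simp add: J_def)
  then show ?thesis by (simp add: Q_def zero_le_mult_iff S_def)
qed

lemma min_scalar_curvature_le:
  assumes p: "p \<in> topspace X"
  shows "min_scalar_curvature X A (g 0) \<le> scalar_curvature A (g 0) p"
proof -
  have "continuous_on ({0} \<times> img_chart c) (\<lambda>(t, y). scalar_curvature A (g t) (inv_chart c y))" if "c \<in> A" for c
    using T by (intro scalar_curvature_continuous that) simp
  from attains_min[where Q = "\<lambda>t p. scalar_curvature A (g t) p", OF compact_sing _ _ this]
  obtain p0 where p0: "p0 \<in> topspace X"
    "\<And>q. q \<in> topspace X \<Longrightarrow> scalar_curvature A (g 0) p0 \<le> scalar_curvature A (g 0) q"
    using p by (metis empty_iff insert_not_empty singletonD singletonI)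
  have "min_scalar_curvature X A (g 0) = scalar_curvature A (g 0) p0"
    unfolding min_scalar_curvature_def by (rule Least_equality) (use p0 in auto)
  then show ?thesis using p0(2)[OF p] by simp
qed

end

locale eigenvalue_flow = surface_ricci_flow +
  fixes lam :: "real \<Rightarrow> real" and f :: "real \<Rightarrow> 'a \<Rightarrow> real"
  assumes lam: "smooth_on {0..T} lam" and f: "smooth_function_family A T f"
    and eigen: "\<And>t. t \<in> {0..T} \<Longrightarrow> laplace_eigenpair X A (g t) (lam t) (f t)"
begin

definition "F c = (\<lambda>(t, y). f t (inv_chart c y))"

lemma F_smooth: "c \<in> A \<Longrightarrow> Ck_on k (cyl c) (F c)"
  using f unfolding smooth_function_family_def smooth_on_def F_def by blast

lemma f_Cfun: assumes t: "t \<in> {0..T}" shows "Cfun k (f t)"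
  unfolding Cfun_def
proof
  fix c assume c: "c \<in> A"
  show "Ck_on k (img_chart c) (f t \<circ> inv_chart c)"
    using Ck_on_space_slice[OF F_smooth[OF c] chart_basic(2)[OF c] t, of k] by (simp add: F_def o_def)
qed

lemma vol_laplacian:
  assumes c: "c \<in> A" and t: "t \<in> {0..T}" and y: "y \<in> img_chart c" and u: "Cfun 2 u"
  shows "W c (t, y) * laplacian A (g t) u (inv_chart c y) = L t c (u \<circ> inv_chart c) y"
  unfolding riemannian_surface.laplacian_in_chart[OF riemannian_surface[OF t] c y u] L_def
  using metric2.laplacian_divergence[OF metric2[OF t c] y CfunD[OF u c]] by (simp add: W_def)

lemma eigen_in_chart:
  assumes c: "c \<in> A" and t: "t \<in> {0..T}" and y: "y \<in> img_chart c"
  shows "L t c (\<lambda>z. F c (t, z)) y = - (lam t * F c (t, y) * W c (t, y))"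
proof -
  have "- laplacian A (g t) (f t) (inv_chart c y) = lam t * f t (inv_chart c y)"
    using eigen[OF t] inv_chart_in_space[OF c y] by (simp add: laplace_eigenpair_def)
  then have "laplacian A (g t) (f t) (inv_chart c y) = - (lam t * F c (t, y))" by (simp add: F_def)
  then show ?thesis
    using vol_laplacian[OF c t y f_Cfun[OF t]] by (simp add: F_def o_def mult.commute)
qed

text \<open>At a maximum of \<open>\<bar>f\<bar>\<close>, \<open>\<Delta> f\<close> has the sign of \<open>- f\<close> or vanishes.\<close>

lemma eigenvalue_nonneg:
  assumes t: "t \<in> {0..T}"
  shows "lam t \<ge> 0"
proof -
  obtain p1 where p1: "p1 \<in> topspace X" "f t p1 \<noteq> 0" using eigen[OF t] by (auto simp: laplace_eigenpair_def)
  have "continuous_on ({t} \<times> img_chart c) (\<lambda>(s, y). - (f s (inv_chart c y))\<^sup>2)" if c: "c \<in> A" for c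
  proof -
    have "continuous_on ({t} \<times> img_chart c) (F c)"
      by (rule continuous_on_subset[OF Ck_on_imp_cont[OF F_smooth[OF c]] Sigma_mono]) (use t in auto)
    then have "continuous_on ({t} \<times> img_chart c) (\<lambda>x. - (F c x)\<^sup>2)" by (intro continuous_intros)
    then show ?thesis by (simp add: F_def case_prod_beta)
  qed
  from attains_min[where Q = "\<lambda>s q. - (f s q)\<^sup>2", OF compact_sing _ _ this]
  obtain p where p: "p \<in> topspace X" "\<And>q. q \<in> topspace X \<Longrightarrow> - (f t p)\<^sup>2 \<le> - (f t q)\<^sup>2"
    using p1(1) by (metis empty_iff insert_not_empty singletonD singletonI)
  have abs_max: "\<bar>f t q\<bar> \<le> \<bar>f t p\<bar>" if "q \<in> topspace X" for q
    using p(2)[OF that] by (simp add: abs_le_square_iff)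
  have nz: "f t p \<noteq> 0" using abs_max[OF p1(1)] p1(2) by auto
  obtain c where c: "c \<in> A" "p \<in> dom_chart c" using chart_cover[OF p(1)] by blast
  define y where "y = snd c p"
  have y: "y \<in> img_chart c" unfolding y_def using c(2) by (rule imageI)
  have py: "inv_chart c y = p" unfolding y_def by (rule inv_chart_chart[OF c])
  \<comment> \<open>With this sign, \<open>a * f t\<close> has a minimum at \<open>p\<close>.\<close>
  define a where "a = - sgn (f t p)"
  have FC: "Ck_on 2 (img_chart c) (\<lambda>z. F c (t, z))"
    by (rule Ck_on_space_slice[OF F_smooth[OF c(1)] chart_basic(2)[OF c(1)] t])
  have "L t c (\<lambda>z. a * F c (t, z) + 0) y \<ge> 0"
  proof (rule L_local_min[OF c(1) t y])
    show "Ck_on 2 (img_chart c) (\<lambda>z. a * F c (t, z) + 0)"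
      by (intro Ck_on_add Ck_on_mult Ck_on_const thick_img c FC)
    show "a * F c (t, y) + 0 \<le> a * F c (t, z) + 0" if z: "z \<in> img_chart c" for z
      using abs_max[OF inv_chart_in_space[OF c(1) z]] nz by (auto simp: a_def F_def py sgn_if split: if_splits)
  qed
  then have "0 \<le> a * L t c (\<lambda>z. F c (t, z)) y" unfolding L_affine[OF c(1) t y FC] .
  also have "\<dots> = lam t * (\<bar>f t p\<bar> * W c (t, y))"
    unfolding eigen_in_chart[OF c(1) t y] by (simp add: a_def F_def py abs_sgn)
  finally have "0 \<le> lam t * (\<bar>f t p\<bar> * W c (t, y))" .
  moreover have "\<bar>f t p\<bar> * W c (t, y) > 0" using nz W_pos[OF c(1) t y] by simp
  ultimately show ?thesis by (meson not_less mult_neg_pos)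
qed

text \<open>With \<open>h = \<partial>\<^sub>t f\<close>, the time derivative of the eigenvalue equation gives
\<open>f \<Delta> h - h \<Delta> f = (\<lambda> R - l) f\<^sup>2\<close>. If the bound failed, the factor of \<open>f\<^sup>2\<close> would be positive, in
contradiction to \<open>green_no_sign\<close>.\<close>

lemma eigenvalue_derivative_bound:
  assumes t: "0 < t" "t < T" and l: "(lam has_real_derivative l) (at t)"
    and m: "1 - m * t > 0" and barrier: "\<And>p. p \<in> topspace X \<Longrightarrow> m \<le> (1 - m * t) * scalar_curvature A (g t) p"
  shows "(1 - m * t) * l - m * lam t \<ge> 0"
proof (rule ccontr)
  assume "\<not> ?thesis"
  then have neg: "m * lam t - (1 - m * t) * l > 0" by simp
  have tI: "t \<in> {0..T}" using t by simp
  have at: "at t within {0..T} = at t" using t by (simp add: at_within_Icc_at)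
  define h where "h p = deriv (\<lambda>s. f s p) t" for p
  have h_chart: "h (inv_chart c y) = tder (cyl c) (F c) (t, y)" if c: "c \<in> A" and y: "y \<in> img_chart c" for c y
  proof -
    have "((\<lambda>s. f s (inv_chart c y)) has_real_derivative tder (cyl c) (F c) (t, y)) (at t)"
      using time_slice_derivative[OF F_smooth[OF c, of "Suc 0"] tI y] by (simp add: at F_def)
    then show ?thesis unfolding h_def by (rule DERIV_imp_deriv)
  qed
  have hC: "Cfun 2 h"
    unfolding Cfun_def
  proof
    fix c assume c: "c \<in> A"
    show "Ck_on 2 (img_chart c) (h \<circ> inv_chart c)"
      by (rule Ck_on_eqI[OF Ck_on_space_slice[OF tder_Ck[OF F_smooth[OF c]] chart_basic(2)[OF c] tI]])
        (simp add: h_chart[OF c])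
  qed
  have lap_h: "laplacian A (g t) h p = - (l * f t p) - lam t * h p + lam t * scalar_curvature A (g t) p * f t p"
    if p: "p \<in> topspace X" for p
  proof -
    obtain c where c: "c \<in> A" "p \<in> dom_chart c" using chart_cover[OF p] by blast
    define y where "y = snd c p"
    have y: "y \<in> img_chart c" unfolding y_def using c(2) by (rule imageI)
    have py: "inv_chart c y = p" unfolding y_def by (rule inv_chart_chart[OF c])
    have dF: "((\<lambda>s. F c (s, y)) has_real_derivative h p) (at t)"
      using time_slice_derivative[OF F_smooth[OF c(1), of "Suc 0"] tI y] h_chart[OF c(1) y] by (simp add: at py)
    have dW: "((\<lambda>s. W c (s, y)) has_real_derivative - R c (t, y) * W c (t, y)) (at t)"
      using W_derivative[OF c(1) tI y] by (simp add: at)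
    have "((\<lambda>s. - (lam s * F c (s, y) * W c (s, y))) has_real_derivative
        L t c (\<lambda>z. tder (cyl c) (F c) (t, z)) y) (at t)"
      by (rule has_field_derivative_transform_within_open[OF L_time_derivative[OF c(1) F_smooth[OF c(1)] t y], of "{0<..<T}"])
        (use t in \<open>auto intro!: eigen_in_chart[OF c(1) _ y]\<close>)
    moreover have "((\<lambda>s. - (lam s * F c (s, y) * W c (s, y))) has_real_derivative
        - ((l * F c (t, y) + h p * lam t) * W c (t, y) + (- R c (t, y) * W c (t, y)) * (lam t * F c (t, y)))) (at t)"
      by (intro DERIV_minus DERIV_mult l dF dW)
    ultimately have "L t c (\<lambda>z. tder (cyl c) (F c) (t, z)) y =
        - ((l * F c (t, y) + h p * lam t) * W c (t, y) + (- R c (t, y) * W c (t, y)) * (lam t * F c (t, y)))"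
      by (rule DERIV_unique)
    moreover have "L t c (h \<circ> inv_chart c) y = L t c (\<lambda>z. tder (cyl c) (F c) (t, z)) y"
      unfolding L_def by (rule div_op_cong[OF chart_basic(2)[OF c(1)] y]) (simp_all add: h_chart[OF c(1)])
    ultimately have "W c (t, y) * laplacian A (g t) h p = W c (t, y) *
        (- (l * F c (t, y)) - lam t * h p + lam t * R c (t, y) * F c (t, y))"
      using vol_laplacian[OF c(1) tI y hC] by (simp add: py algebra_simps)
    then have "laplacian A (g t) h p = - (l * F c (t, y)) - lam t * h p + lam t * R c (t, y) * F c (t, y)"
      using W_pos[OF c(1) tI y] by simp
    then show ?thesis using scalar_curvature_in_chart[OF c(1) tI y] by (simp add: F_def py)
  qed
  have lap_f: "laplacian A (g t) (f t) p = - (lam t * f t p)" if "p \<in> topspace X" for p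
  proof -
    have "- laplacian A (g t) (f t) p = lam t * f t p" using eigen[OF tI] that by (simp add: laplace_eigenpair_def)
    then show ?thesis by linarith
  qed
  have wr: "f t p * laplacian A (g t) h p - h p * laplacian A (g t) (f t) p
      = (lam t * scalar_curvature A (g t) p - l) * (f t p)\<^sup>2" if "p \<in> topspace X" for p
    unfolding lap_h[OF that] lap_f[OF that] by (simp add: algebra_simps power2_eq_square)
  have pos: "lam t * scalar_curvature A (g t) p - l > 0" if p: "p \<in> topspace X" for p
  proof -
    have "lam t * m \<le> lam t * ((1 - m * t) * scalar_curvature A (g t) p)"
      by (rule mult_left_mono[OF barrier[OF p] eigenvalue_nonneg[OF tI]])
    then have "0 < (1 - m * t) * (lam t * scalar_curvature A (g t) p - l)" using neg by (simp add: algebra_simps)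
    then show ?thesis using m by (simp add: zero_less_mult_iff)
  qed
  obtain p1 where p1: "p1 \<in> topspace X" "f t p1 \<noteq> 0" using eigen[OF tI] by (auto simp: laplace_eigenpair_def)
  show False
  proof (rule riemannian_surface.green_no_sign[OF riemannian_surface[OF tI] f_Cfun[OF tI] hC _ p1(1)])
    show "0 \<le> f t p * laplacian A (g t) h p - h p * laplacian A (g t) (f t) p" if "p \<in> topspace X" for p
      unfolding wr[OF that] using pos[OF that] by simp
    show "0 < f t p1 * laplacian A (g t) h p1 - h p1 * laplacian A (g t) (f t) p1"
      unfolding wr[OF p1(1)] using pos[OF p1(1)] p1(2) by simp
  qed
qed

lemma eigenvalue_monotone:
  assumes m: "\<And>p. p \<in> topspace X \<Longrightarrow> m \<le> scalar_curvature A (g 0) p"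
    and mT: "\<And>t. 0 < t \<Longrightarrow> t < T \<Longrightarrow> m * t < 1"
  shows "mono_on {0..T} (\<lambda>t. (1 - m * t) * lam t)"
proof (rule mono_onI)
  have lam1: "Ck_on (Suc 0) {0..T} lam" using lam by (simp add: smooth_on_def)
  have cont: "continuous_on {0..T} lam" by (rule Ck_on_imp_cont[OF lam1])
  fix r s assume rs: "r \<in> {0..T}" "s \<in> {0..T}" "r \<le> s"
  show "(1 - m * r) * lam r \<le> (1 - m * s) * lam s"
  proof (rule DERIV_nonneg_imp_increasing_open[OF rs(3), of "\<lambda>t. (1 - m * t) * lam t"])
    fix t assume "r < t" "t < s"
    then have t: "0 < t" "t < T" and tI: "t \<in> {0..T}" using rs by auto
    define D where "D = frechet_derivative lam (at t within {0..T})"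
    have D: "(lam has_derivative D) (at t)"
      using Ck_on_deriv[OF lam1 tI] t by (simp add: D_def at_within_Icc_at)
    have "D = (*) (D 1)"
    proof
      fix x show "D x = D 1 * x" using linear_scale[OF has_derivative_linear[OF D], of x 1] by simp
    qed
    with D have l: "(lam has_real_derivative D 1) (at t)" unfolding has_field_derivative_def by (rule has_derivative_eq_rhs)
    have "((\<lambda>t. (1 - m * t) * lam t) has_real_derivative (1 - m * t) * D 1 - m * lam t) (at t)"
      by (rule derivative_eq_intros l refl)+ simp
    moreover have "(1 - m * t) * D 1 - m * lam t \<ge> 0"
      by (rule eigenvalue_derivative_bound[OF t l]) (use mT[OF t] curvature_barrier[OF m _ t(2)] t in auto)
    ultimately show "\<exists>y. ((\<lambda>t. (1 - m * t) * lam t) has_real_derivative y) (at t) \<and> 0 \<le> y" by blast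
  next
    show "continuous_on {r..s} (\<lambda>t. (1 - m * t) * lam t)"
      by (intro continuous_intros continuous_on_subset[OF cont]) (use rs in auto)
  qed
qed

end

theorem corollary1p8:
  fixes X :: "'a topology" and A :: "('a, 2) chart set"
    and g :: "real \<Rightarrow> ('a, 2) tensor02"
    and lam :: "real \<Rightarrow> real" and f :: "real \<Rightarrow> 'a \<Rightarrow> real"
    and T Rmin0 :: real
  assumes "compact_surface X A"
    and "0 < T"
    and "ricci_flow A T g"
    and "smooth_on {0..T} lam"
    and "smooth_function_family A T f"
    and "\<And>t. t \<in> {0..T} \<Longrightarrow> laplace_eigenpair X A (g t) (lam t) (f t)"
    and "Rmin0 = min_scalar_curvature X A (g 0)"
  shows "(Rmin0 \<ge> 0 \<longrightarrow> mono_on {0..T} lam) \<and>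
         (Rmin0 > 0 \<and> T \<le> 1 / Rmin0 \<longrightarrow> mono_on {0..T} (\<lambda>t. (1 - Rmin0 * t) * lam t)) \<and>
         (Rmin0 < 0 \<longrightarrow> mono_on {0..T} (\<lambda>t. (1 - Rmin0 * t) * lam t))"
proof -
  interpret eigenvalue_flow X A T g lam f
    using assms by unfold_locales auto
  have R0: "Rmin0 \<le> scalar_curvature A (g 0) p" if "p \<in> topspace X" for p
    using min_scalar_curvature_le[OF that] assms(7) by simp
  have "mono_on {0..T} lam" if "Rmin0 \<ge> 0"
    using eigenvalue_monotone[of 0] R0 that by fastforce
  moreover have "mono_on {0..T} (\<lambda>t. (1 - Rmin0 * t) * lam t)" if "Rmin0 > 0" "T \<le> 1 / Rmin0"
  proof (rule eigenvalue_monotone[OF R0])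
    fix t assume "0 < t" "t < T"
    then have "t < 1 / Rmin0" using that(2) by linarith
    then show "Rmin0 * t < 1" using that(1) by (simp add: field_simps)
  qed
  moreover have "mono_on {0..T} (\<lambda>t. (1 - Rmin0 * t) * lam t)" if "Rmin0 < 0"
  proof (rule eigenvalue_monotone[OF R0])
    fix t assume "0 < t" "t < T"
    then have "Rmin0 * t < 0" using that by (simp add: mult_neg_pos)
    then show "Rmin0 * t < 1" by simp
  qed
  ultimately show ?thesis by blast
qed

end
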